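(* $\Delta_2(\ker\Delta_0)=\Delta_1(\mathcal C)=\ell_f^*$.
   Context: All spaces are complex. For the couple $(X_0,X_1)=(\ell_\infty,\ell_1)$ put $\Sigma=\ell_\infty+\ell_1$. The Calderón space $\mathcal C$ of the couple is the Banach space of bounded continuous functions $F:\{z\in\mathbb C:0\le \mathrm{Re}\,z\le 1\}\to\Sigma$, analytic on the open strip, such that for $j=0,1$ the map $t\mapsto F(j+it)$ is continuous from $\mathbb R$ into $X_j$ and tends to $0$ as $|t|\to\infty$, with norm $\|F\|=\max_{j=0,1}\sup_{t}\|F(j+it)\|_{X_j}$. For $k=0,1,2$ let $\Delta_k:\mathcal C\to\Sigma$, $\Delta_k(F)=F^{(k)}(1/2)/k!$. $\ell_f$ is the Orlicz sequence space of the Orlicz function which near $0$ is $f(t)=t^2\log^2t$; that is, $\ell_f=\{x\in\ell_2:x\log|x|\in\ell_2\}$. Its dual $\ell_f^*$ is regarded as a sequence space through the pairing $\langle x,y\rangle=\sum_n x_ny_n$. The space $T(K)$ carries the quotient norm $\|x\|=\inf\{\|F\|:F\in K,\ TF=x\}$, and equality means equality of sets of sequences with equivalence of norms. *)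

theory Defs
  imports "HOL-Analysis.Analysis" "HOL-Real_Asymp.Real_Asymp"
begin

type_synonym cseq = "nat \<Rightarrow> complex"

section \<open>Normed sequence spaces\<close>

text \<open>A complex normed space of sequences is given by its carrier and its norm; the value of
  \<open>nrm X\<close> outside \<open>elems X\<close> carries no meaning.\<close>

record seq_space =
  elems :: "cseq set"
  nrm :: "cseq \<Rightarrow> real"

definition same_space :: "seq_space \<Rightarrow> seq_space \<Rightarrow> bool" where
  "same_space X Y \<longleftrightarrow> elems X = elems Y \<and>
     (\<exists>c>0. \<exists>C>0. \<forall>x\<in>elems X. c * nrm X x \<le> nrm Y x \<and> nrm Y x \<le> C * nrm X x)"

definition ell_infty :: seq_space where
  "ell_infty = \<lparr> elems = {x. bounded (range x)}, nrm = (\<lambda>x. SUP n. cmod (x n)) \<rparr>"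

definition ell_1 :: seq_space where
  "ell_1 = \<lparr> elems = {x. summable (\<lambda>n. cmod (x n))}, nrm = (\<lambda>x. \<Sum>n. cmod (x n)) \<rparr>"

definition sum_space :: "seq_space \<Rightarrow> seq_space \<Rightarrow> seq_space" where
  "sum_space X Y = \<lparr>
     elems = {(\<lambda>n. a n + b n) | a b. a \<in> elems X \<and> b \<in> elems Y},
     nrm = (\<lambda>x. Inf {nrm X a + nrm Y b | a b.
                       a \<in> elems X \<and> b \<in> elems Y \<and> x = (\<lambda>n. a n + b n)}) \<rparr>"

text \<open>Convergence in norm; membership in \<open>elems X\<close> is required separately where it is used.\<close>

definition tends_in :: "seq_space \<Rightarrow> ('a \<Rightarrow> cseq) \<Rightarrow> cseq \<Rightarrow> 'a filter \<Rightarrow> bool" where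
  "tends_in X u l Fl \<longleftrightarrow> ((\<lambda>w. nrm X (\<lambda>n. u w n - l n)) \<longlongrightarrow> 0) Fl"

definition has_seq_deriv :: "seq_space \<Rightarrow> (complex \<Rightarrow> cseq) \<Rightarrow> cseq \<Rightarrow> complex \<Rightarrow> bool" where
  "has_seq_deriv X F d z \<longleftrightarrow>
     d \<in> elems X \<and> tends_in X (\<lambda>w n. (F w n - F z n) / (w - z)) d (at z)"

definition seq_deriv :: "seq_space \<Rightarrow> (complex \<Rightarrow> cseq) \<Rightarrow> complex \<Rightarrow> cseq" where
  "seq_deriv X F z = (THE d. has_seq_deriv X F d z)"

section \<open>The Calderon space\<close>

definition strip :: "complex set" where
  "strip = {z. 0 \<le> Re z \<and> Re z \<le> 1}"

definition open_strip :: "complex set" where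
  "open_strip = {z. 0 < Re z \<and> Re z < 1}"

definition vanishing_curve :: "seq_space \<Rightarrow> (real \<Rightarrow> cseq) \<Rightarrow> bool" where
  "vanishing_curve X u \<longleftrightarrow>
     (\<forall>t. u t \<in> elems X) \<and> (\<forall>t. tends_in X u (u t) (at t)) \<and>
     tends_in X u (\<lambda>n. 0) at_infinity"

text \<open>The functions live on the closed strip; they are extended by \<open>0\<close>, so that elements of the
  space are determined by their values on the strip.\<close>

definition calderon :: "seq_space \<Rightarrow> seq_space \<Rightarrow> (complex \<Rightarrow> cseq) set" where
  "calderon X0 X1 = {F.
     (\<forall>z. z \<notin> strip \<longrightarrow> F z = (\<lambda>n. 0)) \<and>
     (\<forall>z\<in>strip. F z \<in> elems (sum_space X0 X1)) \<and>
     (\<exists>B. \<forall>z\<in>strip. nrm (sum_space X0 X1) (F z) \<le> B) \<and>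
     (\<forall>z\<in>strip. tends_in (sum_space X0 X1) F (F z) (at z within strip)) \<and>
     (\<forall>z\<in>open_strip. \<exists>d. has_seq_deriv (sum_space X0 X1) F d z) \<and>
     vanishing_curve X0 (\<lambda>t. F (Complex 0 t)) \<and>
     vanishing_curve X1 (\<lambda>t. F (Complex 1 t))}"

definition calderon_norm :: "seq_space \<Rightarrow> seq_space \<Rightarrow> (complex \<Rightarrow> cseq) \<Rightarrow> real" where
  "calderon_norm X0 X1 F =
     max (SUP t. nrm X0 (F (Complex 0 t))) (SUP t. nrm X1 (F (Complex 1 t)))"

definition Delta :: "seq_space \<Rightarrow> seq_space \<Rightarrow> nat \<Rightarrow> (complex \<Rightarrow> cseq) \<Rightarrow> cseq" where
  "Delta X0 X1 k F = (\<lambda>n. (seq_deriv (sum_space X0 X1) ^^ k) F (1/2) n / fact k)"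

definition ker_Delta :: "seq_space \<Rightarrow> seq_space \<Rightarrow> nat \<Rightarrow> (complex \<Rightarrow> cseq) set" where
  "ker_Delta X0 X1 k = {F \<in> calderon X0 X1. Delta X0 X1 k F = (\<lambda>n. 0)}"

definition Delta_image ::
  "seq_space \<Rightarrow> seq_space \<Rightarrow> nat \<Rightarrow> (complex \<Rightarrow> cseq) set \<Rightarrow> seq_space" where
  "Delta_image X0 X1 k K = \<lparr>
     elems = Delta X0 X1 k ` K,
     nrm = (\<lambda>x. Inf {calderon_norm X0 X1 F | F. F \<in> K \<and> Delta X0 X1 k F = x}) \<rparr>"

section \<open>Orlicz sequence spaces and duality\<close>

definition orlicz_function :: "(real \<Rightarrow> real) \<Rightarrow> bool" where
  "orlicz_function f \<longleftrightarrow> continuous_on {0..} f \<and> mono_on {0..} f \<and> convex_on {0..} f \<and>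
     f 0 = 0 \<and> filterlim f at_top at_top"

text \<open>The Orlicz sequence space with its Luxemburg norm.\<close>

definition orlicz_space :: "(real \<Rightarrow> real) \<Rightarrow> seq_space" where
  "orlicz_space f = \<lparr>
     elems = {x. \<exists>r>0. summable (\<lambda>n. f (cmod (x n) / r))},
     nrm = (\<lambda>x. Inf {r. r > 0 \<and> summable (\<lambda>n. f (cmod (x n) / r)) \<and>
                                   (\<Sum>n. f (cmod (x n) / r)) \<le> 1}) \<rparr>"

definition t2log2_near_0 :: "(real \<Rightarrow> real) \<Rightarrow> bool" where
  "t2log2_near_0 f \<longleftrightarrow> (\<exists>\<delta>>0. \<forall>t. 0 < t \<and> t < \<delta> \<longrightarrow> f t = t\<^sup>2 * (ln t)\<^sup>2)"

definition bounded_functional :: "seq_space \<Rightarrow> (cseq \<Rightarrow> complex) \<Rightarrow> bool" where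
  "bounded_functional X \<phi> \<longleftrightarrow>
     (\<forall>x\<in>elems X. \<forall>y\<in>elems X. \<phi> (\<lambda>n. x n + y n) = \<phi> x + \<phi> y) \<and>
     (\<forall>x\<in>elems X. \<forall>c. \<phi> (\<lambda>n. c * x n) = c * \<phi> x) \<and>
     (\<exists>C. \<forall>x\<in>elems X. cmod (\<phi> x) \<le> C * nrm X x)"

text \<open>The dual as a sequence space: the sequence \<open>y\<close> stands for the functional
  \<open>x \<mapsto> (\<Sum>n. x n * y n)\<close>, and its norm is the norm of that functional. For the Orlicz
  spaces considered here this is the whole dual, see \<open>orlicz_dual_represented\<close>.\<close>

definition seq_dual :: "seq_space \<Rightarrow> seq_space" where
  "seq_dual X = \<lparr>
     elems = {y. \<exists>\<phi>. bounded_functional X \<phi> \<and> (\<forall>x\<in>elems X. (\<lambda>n. x n * y n) sums \<phi> x)},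
     nrm = (\<lambda>y. SUP x\<in>{x \<in> elems X. nrm X x \<le> 1}. cmod (\<Sum>n. x n * y n)) \<rparr>"

section \<open>Orlicz functions equal to \<open>t\<^sup>2 (ln t)\<^sup>2\<close> near 0\<close>

lemma orlicz_space_elems:
  assumes f: "orlicz_function f" "t2log2_near_0 f"
  shows "elems (orlicz_space f) =
    {x. summable (\<lambda>n. (cmod (x n))\<^sup>2) \<and> summable (\<lambda>n. (cmod (x n) * ln (cmod (x n)))\<^sup>2)}"
proof -
  obtain d0 where d0: "d0 > 0" "\<And>t. 0 < t \<Longrightarrow> t < d0 \<Longrightarrow> f t = t\<^sup>2 * (ln t)\<^sup>2"
    using f(2) unfolding t2log2_near_0_def by blast
  define d where "d = min d0 (exp (-1))"
  have f0: "f 0 = 0" and mf: "mono_on {0..} f"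
    using f(1) by (auto simp: orlicz_function_def)
  have d: "d > 0" "\<And>t. 0 \<le> t \<Longrightarrow> t < d \<Longrightarrow> f t = t\<^sup>2 * (ln t)\<^sup>2"
    using d0 f0 unfolding d_def by (auto simp: order_le_less)
  have lnbig: "(ln t)\<^sup>2 \<ge> 1" if "0 < t" "t < d" for t :: real
  proof -
    have "t < exp (-1)" using that d_def by auto
    hence "ln t < -1" using that by (metis exp_gt_zero ln_exp ln_less_cancel_iff)
    thus ?thesis using abs_le_square_iff[of 1 "ln t"] by simp
  qed
  show ?thesis
  proof (intro set_eqI iffI)
    fix x assume "x \<in> elems (orlicz_space f)"
    then obtain r where r: "r > 0" "summable (\<lambda>n. f (cmod (x n) / r))"
      by (auto simp: orlicz_space_def)
    define t where "t = (\<lambda>n. cmod (x n) / r)"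
    have t0: "t n \<ge> 0" for n using r by (simp add: t_def)
    have xt: "cmod (x n) = r * t n" for n using r by (simp add: t_def)
    define e where "e = d / 2"
    have e: "0 < e" "e < d" using d by (auto simp: e_def)
    have fe: "f e > 0"
    proof -
      have "e\<^sup>2 * (ln e)\<^sup>2 > 0"
        using e lnbig[of e] by (intro mult_pos_pos) (simp, linarith)
      thus ?thesis using d(2)[of e] e by simp
    qed
    have sm: "summable (\<lambda>n. f (t n))" using r by (simp add: t_def)
    have "(\<lambda>n. f (t n)) \<longlonglongrightarrow> 0"
      using summable_LIMSEQ_zero[OF sm] .
    hence "\<forall>\<^sub>F n in sequentially. f (t n) < f e"
      using fe by (rule order_tendstoD)
    hence ev: "\<forall>\<^sub>F n in sequentially. t n < d"
    proof eventually_elim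
      case (elim n)
      show ?case
      proof (rule ccontr)
        assume "\<not> t n < d"
        hence "f e \<le> f (t n)" using mf e t0[of n] by (auto simp: mono_on_def)
        thus False using elim by simp
      qed
    qed
    have s1: "summable (\<lambda>n. (cmod (x n))\<^sup>2)"
    proof (rule summable_comparison_test_ev)
      show "summable (\<lambda>n. r\<^sup>2 * f (t n))" using sm by (rule summable_mult)
      show "\<forall>\<^sub>F n in sequentially. norm ((cmod (x n))\<^sup>2) \<le> r\<^sup>2 * f (t n)"
        using ev
      proof eventually_elim
        case (elim n)
        have "(t n)\<^sup>2 \<le> f (t n)"
          using d(2)[OF t0 elim] lnbig[of "t n"] elim t0[of n]
          by (cases "t n = 0") (auto simp: mult_le_cancel_left1)
        thus ?case by (auto simp: xt power_mult_distrib intro!: mult_left_mono)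
      qed
    qed
    have s2: "summable (\<lambda>n. (cmod (x n) * ln (cmod (x n)))\<^sup>2)"
    proof (rule summable_comparison_test_ev)
      show "summable (\<lambda>n. (r\<^sup>2 * (2 * ((ln r)\<^sup>2 + 1))) * f (t n))" using sm by (rule summable_mult)
      show "\<forall>\<^sub>F n in sequentially. norm ((cmod (x n) * ln (cmod (x n)))\<^sup>2)
              \<le> (r\<^sup>2 * (2 * ((ln r)\<^sup>2 + 1))) * f (t n)"
        using ev
      proof eventually_elim
        case (elim n)
        show ?case
        proof (cases "t n = 0")
          case True thus ?thesis by (simp add: xt f0)
        next
          case False
          hence tp: "t n > 0" using t0[of n] by simp
          have l: "(ln (t n))\<^sup>2 \<ge> 1" using lnbig tp elim by simp
          have "(ln (r * t n))\<^sup>2 = (ln r + ln (t n))\<^sup>2" using r tp by (simp add: ln_mult)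
          also have "\<dots> \<le> 2 * (ln r)\<^sup>2 + 2 * (ln (t n))\<^sup>2"
            using sum_squares_bound[of "ln r" "ln (t n)"] by (simp add: power2_sum)
          also have "\<dots> \<le> 2 * ((ln r)\<^sup>2 * (ln (t n))\<^sup>2) + 2 * (ln (t n))\<^sup>2"
            using mult_left_mono[OF l, of "(ln r)\<^sup>2"] by simp
          finally have "(ln (r * t n))\<^sup>2 \<le> 2 * ((ln r)\<^sup>2 + 1) * (ln (t n))\<^sup>2"
            by (simp add: algebra_simps)
          hence "(r * t n)\<^sup>2 * (ln (r * t n))\<^sup>2 \<le> (r * t n)\<^sup>2 * (2 * ((ln r)\<^sup>2 + 1) * (ln (t n))\<^sup>2)"
            by (rule mult_left_mono) simp
          thus ?thesis
            using d(2)[OF t0 elim] by (simp add: xt power_mult_distrib mult_ac)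
        qed
      qed
    qed
    show "x \<in> {x. summable (\<lambda>n. (cmod (x n))\<^sup>2) \<and> summable (\<lambda>n. (cmod (x n) * ln (cmod (x n)))\<^sup>2)}"
      using s1 s2 by simp
  next
    fix x assume "x \<in> {x. summable (\<lambda>n. (cmod (x n))\<^sup>2) \<and>
      summable (\<lambda>n. (cmod (x n) * ln (cmod (x n)))\<^sup>2)}"
    hence s: "summable (\<lambda>n. (cmod (x n))\<^sup>2)" "summable (\<lambda>n. (cmod (x n) * ln (cmod (x n)))\<^sup>2)"
      by auto
    have "(\<lambda>n. (cmod (x n))\<^sup>2) \<longlonglongrightarrow> 0" by (rule summable_LIMSEQ_zero[OF s(1)])
    hence "\<forall>\<^sub>F n in sequentially. (cmod (x n))\<^sup>2 < d\<^sup>2"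
      by (rule order_tendstoD) (use d in simp)
    hence ev: "\<forall>\<^sub>F n in sequentially. cmod (x n) < d"
      by eventually_elim (use d in \<open>auto intro: power_less_imp_less_base\<close>)
    have "summable (\<lambda>n. f (cmod (x n) / 1))"
    proof (rule summable_comparison_test_ev[OF _ s(2)])
      show "\<forall>\<^sub>F n in sequentially. norm (f (cmod (x n) / 1)) \<le> (cmod (x n) * ln (cmod (x n)))\<^sup>2"
        using ev by eventually_elim (simp add: d(2) power_mult_distrib)
    qed
    thus "x \<in> elems (orlicz_space f)"
      unfolding orlicz_space_def by (auto intro: exI[of _ 1])
  qed
qed

lemma orlicz_summable_all:
  assumes f: "orlicz_function f" "t2log2_near_0 f" and x: "x \<in> elems (orlicz_space f)" and e: "e > 0"
  shows "summable (\<lambda>n. f (cmod (x n) / e))"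
proof -
  obtain r where r: "r > 0" "summable (\<lambda>n. f (cmod (x n) / r))"
    using x by (auto simp: orlicz_space_def)
  define y where "y = (\<lambda>n. x n / of_real e)"
  have cy: "cmod (y n) = cmod (x n) / e" for n using e by (simp add: y_def norm_divide)
  have "(\<lambda>n. f (cmod (y n) / (r / e))) = (\<lambda>n. f (cmod (x n) / r))"
    using e r by (simp add: cy)
  hence "y \<in> elems (orlicz_space f)"
    using r e unfolding orlicz_space_def by (auto intro!: exI[of _ "r / e"])
  hence sy: "summable (\<lambda>n. (cmod (y n))\<^sup>2)" "summable (\<lambda>n. (cmod (y n) * ln (cmod (y n)))\<^sup>2)"
    using orlicz_space_elems[OF f] by auto
  obtain d where d: "d > 0" "\<And>t. 0 < t \<Longrightarrow> t < d \<Longrightarrow> f t = t\<^sup>2 * (ln t)\<^sup>2"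
    using f(2) unfolding t2log2_near_0_def by blast
  have f0: "f 0 = 0" using f(1) by (simp add: orlicz_function_def)
  have "(\<lambda>n. (cmod (y n))\<^sup>2) \<longlonglongrightarrow> 0" by (rule summable_LIMSEQ_zero[OF sy(1)])
  hence "\<forall>\<^sub>F n in sequentially. (cmod (y n))\<^sup>2 < d\<^sup>2"
    by (rule order_tendstoD) (use d in simp)
  hence ev: "\<forall>\<^sub>F n in sequentially. cmod (y n) < d"
    by eventually_elim (use d in \<open>auto intro: power_less_imp_less_base\<close>)
  have "\<forall>\<^sub>F n in sequentially. norm (f (cmod (y n))) \<le> (cmod (y n) * ln (cmod (y n)))\<^sup>2"
    using ev
  proof eventually_elim
    case (elim n)
    show ?case by (cases "y n = 0") (use elim in \<open>simp_all add: f0 d(2) power_mult_distrib\<close>)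
  qed
  hence "summable (\<lambda>n. f (cmod (y n)))"
    by (rule summable_comparison_test_ev[OF _ sy(2)])
  thus ?thesis by (simp add: cy)
qed

lemma orlicz_dual_represented:
  assumes f: "orlicz_function f" "t2log2_near_0 f"
    and \<phi>: "bounded_functional (orlicz_space f) \<phi>"
  shows "\<exists>!y. y \<in> elems (seq_dual (orlicz_space f)) \<and>
              (\<forall>x\<in>elems (orlicz_space f). (\<lambda>n. x n * y n) sums \<phi> x)"
proof -
  let ?X = "orlicz_space f"
  define E where "E = (\<lambda>(k::nat) n. if n = k then 1 else 0 :: complex)"
  define y where "y = (\<lambda>k. \<phi> (E k))"
  have f0: "f 0 = 0" and mf: "mono_on {0..} f"
    using f(1) by (auto simp: orlicz_function_def)
  have fnn: "f t \<ge> 0" if "t \<ge> 0" for t using mf f0 that by (metis atLeast_iff mono_onD order_refl)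
  have fin: "x \<in> elems ?X" if "\<And>n. n \<ge> N \<Longrightarrow> x n = 0" for x N
  proof -
    have "summable (\<lambda>n. f (cmod (x n) / 1))"
      by (rule summable_finite[of "{..<N}"]) (use that f0 in auto)
    thus ?thesis unfolding orlicz_space_def by (auto intro: exI[of _ 1])
  qed
  have EX: "E k \<in> elems ?X" for k by (rule fin[of "Suc k"]) (auto simp: E_def)
  have add: "\<And>x y. x \<in> elems ?X \<Longrightarrow> y \<in> elems ?X \<Longrightarrow> \<phi> (\<lambda>n. x n + y n) = \<phi> x + \<phi> y"
    and scale: "\<And>x c. x \<in> elems ?X \<Longrightarrow> \<phi> (\<lambda>n. c * x n) = c * \<phi> x"
    using \<phi> by (auto simp: bounded_functional_def)
  obtain C0 where C0: "\<And>x. x \<in> elems ?X \<Longrightarrow> cmod (\<phi> x) \<le> C0 * nrm ?X x"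
    using \<phi> unfolding bounded_functional_def by blast
  have part: "\<phi> (\<lambda>n. if n < N then x n else 0) = (\<Sum>k<N. x k * y k)" for x N
  proof (induction N)
    case 0
    have "\<phi> (\<lambda>n. 0 * E 0 n) = 0 * \<phi> (E 0)" by (rule scale[OF EX])
    thus ?case by simp
  next
    case (Suc N)
    have "\<phi> (\<lambda>n. if n < Suc N then x n else 0)
        = \<phi> (\<lambda>n. (if n < N then x n else 0) + x N * E N n)"
      by (rule arg_cong[of _ _ \<phi>]) (auto simp: E_def fun_eq_iff less_Suc_eq)
    also have "\<dots> = \<phi> (\<lambda>n. if n < N then x n else 0) + \<phi> (\<lambda>n. x N * E N n)"
    proof (rule add)
      show "(\<lambda>n. if n < N then x n else 0) \<in> elems ?X" by (rule fin[of N]) auto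
      show "(\<lambda>n. x N * E N n) \<in> elems ?X" by (rule fin[of "Suc N"]) (auto simp: E_def)
    qed
    also have "\<dots> = (\<Sum>k<N. x k * y k) + x N * y N" by (simp add: Suc scale[OF EX] y_def)
    finally show ?case by simp
  qed
  have rep: "(\<lambda>n. x n * y n) sums \<phi> x" if x: "x \<in> elems ?X" for x
    unfolding sums_def
  proof (rule LIMSEQ_I)
    fix e0 :: real assume e0: "e0 > 0"
    define e where "e = e0 / (2 * (\<bar>C0\<bar> + 1))"
    have e: "e > 0" using e0 by (simp add: e_def)
    have ce: "\<bar>C0\<bar> * e < e0"
    proof -
      have "\<bar>C0\<bar> * e \<le> (\<bar>C0\<bar> + 1) * e" using e by simp
      also have "\<dots> = e0 / 2" unfolding e_def by (simp add: field_simps add_nonneg_eq_0_iff)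
      finally show ?thesis using e0 by simp
    qed
    define g where "g = (\<lambda>n. f (cmod (x n) / e))"
    have sg: "summable g" unfolding g_def by (rule orlicz_summable_all[OF f x e])
    obtain N0 where N0: "\<And>N. N \<ge> N0 \<Longrightarrow> norm (\<Sum>i. g (i + N)) < 1"
      using suminf_exist_split[OF zero_less_one sg] by blast
    show "\<exists>N0. \<forall>N\<ge>N0. norm ((\<Sum>k<N. x k * y k) - \<phi> x) < e0"
    proof (intro exI allI impI)
      fix N assume N: "N \<ge> N0"
      define t where "t = (\<lambda>n. if n < N then 0 else x n)"
      define h where "h = (\<lambda>n. f (cmod (t n) / e))"
      have hg: "h (n + N) = g (n + N)" for n by (simp add: h_def g_def t_def)
      have sh: "summable h"
        using sg by (subst summable_iff_shift[of h N, symmetric]) (simp add: hg summable_iff_shift)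
      have "suminf h = (\<Sum>n. h (n + N)) + (\<Sum>n<N. h n)"
        by (rule suminf_split_initial_segment[OF sh])
      also have "(\<Sum>n<N. h n) = 0" by (simp add: h_def t_def f0)
      finally have h1: "suminf h \<le> 1" using N0[OF N] by (simp add: hg)
      define S where "S = {r. r > 0 \<and> summable (\<lambda>n. f (cmod (t n) / r)) \<and>
                              (\<Sum>n. f (cmod (t n) / r)) \<le> 1}"
      have eS: "e \<in> S" using e sh h1 by (simp add: S_def h_def)
      have nt: "nrm ?X t = Inf S" by (simp add: orlicz_space_def S_def)
      have "nrm ?X t \<le> e" unfolding nt
        by (rule cInf_lower[OF eS]) (auto simp: S_def intro!: bdd_belowI[of _ 0])
      moreover have "nrm ?X t \<ge> 0" unfolding nt
        by (rule cInf_greatest) (use eS in \<open>auto simp: S_def\<close>)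
      moreover have tX: "t \<in> elems ?X"
        using e sh unfolding orlicz_space_def h_def by auto
      ultimately have "cmod (\<phi> t) \<le> \<bar>C0\<bar> * e"
        using C0[OF tX] by (meson abs_ge_self abs_ge_zero mult_mono order_trans)
      moreover have "\<phi> x = (\<Sum>k<N. x k * y k) + \<phi> t"
      proof -
        have "\<phi> x = \<phi> (\<lambda>n. (if n < N then x n else 0) + t n)"
          by (rule arg_cong[of _ _ \<phi>]) (auto simp: t_def)
        also have "\<dots> = \<phi> (\<lambda>n. if n < N then x n else 0) + \<phi> t"
          by (rule add[OF _ tX], rule fin[of N]) auto
        finally show ?thesis by (simp add: part)
      qed
      ultimately show "norm ((\<Sum>k<N. x k * y k) - \<phi> x) < e0" using ce by simp
    qed
  qed
  show ?thesis
  proof (rule ex1I[of _ y])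
    show "y \<in> elems (seq_dual ?X) \<and> (\<forall>x\<in>elems ?X. (\<lambda>n. x n * y n) sums \<phi> x)"
      using rep \<phi> by (auto simp: seq_dual_def)
  next
    fix z assume z: "z \<in> elems (seq_dual ?X) \<and> (\<forall>x\<in>elems ?X. (\<lambda>n. x n * z n) sums \<phi> x)"
    show "z = y"
    proof
      fix k
      have "(\<lambda>n. E k n * z n) sums \<phi> (E k)" using z EX by blast
      moreover have "(\<lambda>n. E k n * z n) sums z k"
        using sums_If_finite_set[of "{k}" z] by (simp add: E_def if_distrib[of "\<lambda>u. u * _"] cong: if_cong)
      ultimately show "z k = y k" unfolding y_def using sums_unique2 by blast
    qed
  qed
qed

lemma orlicz_function_exists: "\<exists>f. orlicz_function f \<and> t2log2_near_0 f"
proof -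
  define a :: real where "a = exp (-3)"
  define g :: "real \<Rightarrow> real" where "g = (\<lambda>t. t\<^sup>2 * (ln t)\<^sup>2)"
  define g1 :: "real \<Rightarrow> real" where "g1 = (\<lambda>t. 2 * t * (ln t)\<^sup>2 + 2 * t * ln t)"
  define g2 :: "real \<Rightarrow> real" where "g2 = (\<lambda>t. 2 * (ln t)\<^sup>2 + 6 * ln t + 2)"
  define f where "f = (\<lambda>t. if t \<le> a then g t else g a + g1 a * (t - a))"
  have a: "a > 0" by (simp add: a_def)
  have lna: "ln t \<le> -3" if "0 < t" "t \<le> a" for t
    using that unfolding a_def by (metis exp_gt_zero ln_exp ln_le_cancel_iff)
  have D1: "(g has_real_derivative g1 t) (at t)" if "t > 0" for t
    unfolding g_def g1_def using that
    by (auto intro!: derivative_eq_intros simp: power2_eq_square field_simps)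
  have D2: "(g1 has_real_derivative g2 t) (at t)" if "t > 0" for t
    unfolding g1_def g2_def using that
    by (auto intro!: derivative_eq_intros simp: power2_eq_square field_simps)
  have g2nn: "g2 t \<ge> 0" if "t \<in> {0<..a}" for t
  proof -
    have "ln t * (ln t + 3) \<ge> 0" by (rule mult_nonpos_nonpos) (use lna[of t] that in \<open>simp_all del: ln_le_zero_iff\<close>)
    thus ?thesis by (simp add: g2_def power2_eq_square algebra_simps)
  qed
  have tang: "g1 z * (w - z) \<le> g w - g z" if "z \<in> {0<..a}" "w \<in> {0<..a}" for z w
    by (rule f''_imp_f'[of "{0<..a}" g g1 g2]) (use that D1 D2 g2nn in auto)
  have g1nn: "g1 t \<ge> 0" if "t \<in> {0<..a}" for t
  proof -
    have "ln t * (ln t + 1) \<ge> 0" by (rule mult_nonpos_nonpos) (use lna[of t] that in \<open>simp_all del: ln_le_zero_iff\<close>)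
    hence "2 * t * (ln t * (ln t + 1)) \<ge> 0" using that by simp
    thus ?thesis by (simp add: g1_def power2_eq_square algebra_simps)
  qed
  have g1a: "g1 a > 0" by (simp add: g1_def a_def)
  have g1mono: "g1 z \<le> g1 a" if "z \<in> {0<..a}" for z
  proof (rule DERIV_nonneg_imp_nondecreasing[of z a g1])
    fix t assume "z \<le> t" "t \<le> a"
    hence "t > 0" "t \<in> {0<..a}" using that by auto
    thus "\<exists>y. (g1 has_real_derivative y) (at t) \<and> 0 \<le> y" using D2 g2nn by blast
  qed (use that in auto)
  have tang0: "g z \<le> g1 z * z" if "z \<in> {0<..a}" for z
  proof -
    have "ln z * (ln z + 2) \<ge> 0" by (rule mult_nonpos_nonpos) (use lna[of z] that in \<open>simp_all del: ln_le_zero_iff\<close>)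
    hence "z\<^sup>2 * (ln z * (ln z + 2)) \<ge> 0" by simp
    thus ?thesis by (simp add: g_def g1_def power2_eq_square algebra_simps)
  qed
  have fa: "f t = g a + g1 a * (t - a)" if "t \<ge> a" for t using that by (auto simp: f_def)
  have fg: "f t = g t" if "t \<le> a" for t using that by (auto simp: f_def)
  have g0: "g 0 = 0" by (simp add: g_def)
  have gnn: "g t \<ge> 0" for t by (simp add: g_def)
  have fnn: "f t \<ge> 0" for t using gnn g1a by (auto simp: f_def)
  define m where "m = (\<lambda>z. if z = 0 then 0 else if z \<le> a then g1 z else g1 a)"
  have mnn: "m z \<ge> 0" if "z \<ge> 0" for z using that g1nn g1a by (auto simp: m_def)
  have supp: "f z + m z * (w - z) \<le> f w" if z: "z \<ge> 0" and w: "w \<ge> 0" for z w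
  proof -
    consider "z = 0" | "0 < z" "z \<le> a" | "z > a" using z by linarith
    thus ?thesis
    proof cases
      case 1 thus ?thesis using fnn a g0 by (simp add: m_def fg)
    next
      case 2
      consider "w = 0" | "0 < w" "w \<le> a" | "w > a" using w by linarith
      thus ?thesis
      proof cases
        case 1 thus ?thesis using tang0[of z] 2 a g0 by (simp add: m_def fg)
      next
        case 2 thus ?thesis using tang[of z w] \<open>0 < z\<close> \<open>z \<le> a\<close> by (simp add: m_def fg)
      next
        case 3
        have "g z + g1 z * (a - z) \<le> g a" using tang[of z a] 2 a by simp
        moreover have "g1 z * (w - a) \<le> g1 a * (w - a)"
          using g1mono[of z] 2 3 by (intro mult_right_mono) auto
        ultimately show ?thesis using 2 3 by (simp add: m_def fg fa algebra_simps)
      qed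
    next
      case 3
      consider "w = 0" | "0 < w" "w \<le> a" | "w > a" using w by linarith
      thus ?thesis
      proof cases
        case 1 thus ?thesis using tang0[of a] 3 a g0 by (simp add: m_def fg fa algebra_simps)
      next
        case 2 thus ?thesis using tang[of a w] 3 a by (simp add: m_def fg fa algebra_simps)
      next
        case 3 thus ?thesis using \<open>z > a\<close> a by (simp add: m_def fa algebra_simps)
      qed
    qed
  qed
  have cvx: "convex_on {0..} f"
  proof (rule convex_onI)
    fix u x w :: real
    assume u: "0 < u" "u < 1" and x: "x \<in> {0..}" and w: "w \<in> {0..}"
    define z where "z = (1 - u) * x + u * w"
    have z: "z \<ge> 0" using u x w by (auto simp: z_def)
    have "(1 - u) * (f z + m z * (x - z)) \<le> (1 - u) * f x"
      using supp[OF z, of x] u x by (intro mult_left_mono) auto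
    moreover have "u * (f z + m z * (w - z)) \<le> u * f w"
      using supp[OF z, of w] u w by (intro mult_left_mono) auto
    moreover have "(1 - u) * (f z + m z * (x - z)) + u * (f z + m z * (w - z)) = f z"
      by (simp add: z_def algebra_simps)
    ultimately show "f ((1 - u) *\<^sub>R x + u *\<^sub>R w) \<le> (1 - u) * f x + u * f w"
      by (simp add: z_def)
  qed simp
  have mono: "mono_on {0..} f"
  proof (rule mono_onI)
    fix z w :: real assume zw: "z \<in> {0..}" "w \<in> {0..}" "z \<le> w"
    have "m z * (w - z) \<ge> 0" using mnn[of z] zw by (intro mult_nonneg_nonneg) auto
    moreover have "f z + m z * (w - z) \<le> f w" by (rule supp) (use zw in auto)
    ultimately show "f z \<le> f w" by linarith
  qed
  have cont: "continuous_on {0..} f"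
  proof -
    have c1: "continuous_on {0..a} g"
      unfolding continuous_on_eq_continuous_within
    proof
      fix t assume t: "t \<in> {0..a}"
      show "continuous (at t within {0..a}) g"
      proof (cases "t = 0")
        case False
        hence "isCont g t" using D1[of t] t by (intro DERIV_isCont) auto
        thus ?thesis by (rule continuous_at_imp_continuous_at_within)
      next
        case True
        have "(g \<longlongrightarrow> 0) (at_right 0)" unfolding g_def by real_asymp
        hence "(g \<longlongrightarrow> 0) (at 0 within {0..a})"
          using a by (simp add: at_within_Icc_at_right)
        thus ?thesis using True g0 by (simp add: continuous_within)
      qed
    qed
    have "continuous_on ({0..a} \<union> {a..}) (\<lambda>t. if t \<le> a then g t else g a + g1 a * (t - a))"
      by (rule continuous_on_cases) (use c1 in \<open>auto intro!: continuous_intros\<close>)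
    moreover have "{0..a} \<union> {a..} = {0..}" using a by auto
    ultimately show ?thesis by (simp add: f_def)
  qed
  have lim: "filterlim f at_top at_top"
  proof -
    have "filterlim (\<lambda>t. g a + g1 a * (t - a)) at_top at_top" using g1a by real_asymp
    moreover have ev: "\<forall>\<^sub>F t in at_top. g a + g1 a * (t - a) = f t"
      using eventually_ge_at_top[of a] by eventually_elim (simp add: fa)
    ultimately show ?thesis using filterlim_cong[OF refl refl ev] by blast
  qed
  have "orlicz_function f" using cont mono cvx lim a g0 by (simp add: orlicz_function_def fg)
  moreover have "t2log2_near_0 f" unfolding t2log2_near_0_def
    using a by (intro exI[of _ a]) (auto simp: fg g_def)
  ultimately show ?thesis by blast
qed

end

theory Submission
  imports Defs "HOL-Complex_Analysis.Complex_Analysis"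
begin

text \<open>Since \<open>\<parallel>x\<parallel>\<^sub>\<infinity> \<le> \<parallel>x\<parallel>\<^sub>1\<close>, the sum space is isometrically \<open>\<ell>\<^sub>\<infinity>\<close>, and a uniformly bounded family of holomorphic
  coordinates is a holomorphic \<open>\<ell>\<^sub>\<infinity>\<close>-valued function; all derivatives are therefore coordinatewise.

  If \<open>F(1/2) = 0\<close>, then \<open>D = F / (z - 1/2)\<close> is again in the Calderon space and \<open>F''(1/2) / 2 = D'(1/2)\<close>;
  conversely \<open>F = (z - 1/2) exp ((z - 1/2)\<^sup>2) G\<close> vanishes at \<open>1/2\<close> and \<open>F''(1/2) / 2 = G'(1/2)\<close>.

  To see that \<open>F'(1/2)\<close> is in the dual, apply the maximum principle on the strip to
  \<open>H(z) = \<Sum> F\<^sub>n(z) x\<^sub>n \<bar>x\<^sub>n\<bar>\<^bsup>1-2z\<^esup>\<close>: both \<open>H(1/2)\<close> and \<open>H'(1/2) = \<Sum> F\<^sub>n'(1/2) x\<^sub>n - 2 \<Sum> F\<^sub>n(1/2) x\<^sub>n ln \<bar>x\<^sub>n\<bar>\<close> are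
  bounded, and the last sum is itself such an \<open>H(1/2)\<close>, for the sequence \<open>x ln \<bar>x\<bar> \<in> \<ell>\<^sub>2\<close>.

  For the converse, let \<open>y\<close> be in the dual with small norm and \<open>p\<^sub>n = \<bar>y\<^sub>n\<bar> / (- ln \<bar>y\<^sub>n\<bar>)\<close>. Testing against
  \<open>x\<^sub>n = p\<^sub>n / (- ln \<bar>y\<^sub>n\<bar>)\<close> shows \<open>p \<in> \<ell>\<^sub>2\<close>. With weights \<open>e\<^sub>n\<close> tending to \<open>0\<close> so slowly that
  \<open>\<Sum> p\<^sub>n\<^sup>2 / e\<^sub>n\<close> converges, \<open>y = F'(1/2)\<close> for
  \<open>F\<^sub>n(z) = - exp ((z - 1/2)\<^sup>2) y\<^sub>n / l\<^sub>n exp (- l\<^sub>n (z - 1/2))\<close>, \<open>l\<^sub>n = 2 ln (e\<^sub>n / p\<^sub>n)\<close>. The weights are needed because the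
  boundary values have to be continuous in norm, not just bounded.\<close>

section \<open>The sum space and coordinatewise holomorphy\<close>

abbreviation Sigma_space :: seq_space where
  "Sigma_space \<equiv> sum_space ell_infty ell_1"

lemma elems_ell_infty: "x \<in> elems ell_infty \<longleftrightarrow> bounded (range x)"
  by (simp add: ell_infty_def)

lemma elems_ell_1: "x \<in> elems ell_1 \<longleftrightarrow> summable (\<lambda>n. cmod (x n))"
  by (simp add: ell_1_def)

lemma bounded_range_iff: "bounded (range x) \<longleftrightarrow> (\<exists>B. \<forall>n. norm (x n) \<le> B)"
  by (auto simp: bounded_iff)

lemma bounded_rangeI: "(\<And>n. norm (x n) \<le> B) \<Longrightarrow> bounded (range x)"
  by (auto simp: bounded_iff)

lemma bdd_above_norm_range: "bounded (range x) \<Longrightarrow> bdd_above (range (\<lambda>n. norm (x n)))"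
  by (auto simp: bounded_iff bdd_above_def)

lemma nrm_ell_infty_le_iff:
  assumes "x \<in> elems ell_infty"
  shows "nrm ell_infty x \<le> e \<longleftrightarrow> (\<forall>n. cmod (x n) \<le> e)"
  using assms unfolding elems_ell_infty
  by (simp add: ell_infty_def cSUP_le_iff bdd_above_norm_range)

lemma norm_le_nrm_ell_infty: "x \<in> elems ell_infty \<Longrightarrow> cmod (x n) \<le> nrm ell_infty x"
  using nrm_ell_infty_le_iff[of x "nrm ell_infty x"] by blast

lemma nrm_ell_infty_nonneg: "x \<in> elems ell_infty \<Longrightarrow> 0 \<le> nrm ell_infty x"
  using norm_le_nrm_ell_infty[of x 0] norm_ge_zero order_trans by blast

lemma norm_le_nrm_ell_1: "x \<in> elems ell_1 \<Longrightarrow> cmod (x n) \<le> nrm ell_1 x"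
  using sum_le_suminf[of "\<lambda>n. cmod (x n)" "{n}"] by (simp add: ell_1_def)

lemma sum_le_nrm_ell_1: "x \<in> elems ell_1 \<Longrightarrow> (\<Sum>n<N. cmod (x n)) \<le> nrm ell_1 x"
  using sum_le_suminf[of "\<lambda>n. cmod (x n)" "{..<N}"] by (simp add: ell_1_def)

lemma nrm_ell_1_nonneg: "x \<in> elems ell_1 \<Longrightarrow> 0 \<le> nrm ell_1 x"
  using norm_le_nrm_ell_1[of x 0] norm_ge_zero order_trans by blast

lemma ell_1_subset_ell_infty: "x \<in> elems ell_1 \<Longrightarrow> x \<in> elems ell_infty"
  unfolding elems_ell_infty by (rule bounded_rangeI) (rule norm_le_nrm_ell_1)

lemma zero_in_ell_1: "(\<lambda>n. 0) \<in> elems ell_1"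
  by (simp add: elems_ell_1)

lemma nrm_ell_1_zero: "nrm ell_1 (\<lambda>n. 0) = 0"
  by (simp add: ell_1_def)

lemma elems_Sigma: "elems Sigma_space = elems ell_infty"
proof (intro set_eqI iffI)
  fix x assume "x \<in> elems Sigma_space"
  then obtain a b where "a \<in> elems ell_infty" "b \<in> elems ell_1" "x = (\<lambda>n. a n + b n)"
    by (auto simp: sum_space_def)
  thus "x \<in> elems ell_infty"
    using ell_1_subset_ell_infty[of b] bounded_plus_comp[of a UNIV b] by (simp add: elems_ell_infty)
next
  fix x assume "x \<in> elems ell_infty"
  thus "x \<in> elems Sigma_space"
    using zero_in_ell_1 unfolding sum_space_def
    by (simp, intro exI[of _ x] exI[of _ "\<lambda>n. 0"]) simp
qed

text \<open>The decomposition \<open>x = x + 0\<close> attains the infimum: each coordinate of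
  \<open>b\<close> is at most \<open>nrm ell_1 b\<close>, so no splitting \<open>a + b\<close> costs
  less than the sup norm.\<close>

lemma nrm_Sigma:
  assumes x: "x \<in> elems ell_infty"
  shows "nrm Sigma_space x = nrm ell_infty x"
proof -
  define S where "S = {nrm ell_infty a + nrm ell_1 b | a b.
    a \<in> elems ell_infty \<and> b \<in> elems ell_1 \<and> x = (\<lambda>n. a n + b n)}"
  have "nrm ell_infty x = nrm ell_infty x + nrm ell_1 (\<lambda>n. 0)" by (simp add: nrm_ell_1_zero)
  hence mem: "nrm ell_infty x \<in> S"
    using x zero_in_ell_1 unfolding S_def by (intro CollectI exI[of _ x] exI[of _ "\<lambda>n. 0"]) auto
  have lower: "nrm ell_infty x \<le> s" if "s \<in> S" for s
  proof -
    obtain a b where ab: "a \<in> elems ell_infty" "b \<in> elems ell_1" "x = (\<lambda>n. a n + b n)"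
      "s = nrm ell_infty a + nrm ell_1 b" using \<open>s \<in> S\<close> by (auto simp: S_def)
    show ?thesis
      unfolding nrm_ell_infty_le_iff[OF x] unfolding ab
      by (intro allI norm_triangle_mono norm_le_nrm_ell_infty norm_le_nrm_ell_1 ab)
  qed
  have "Inf S = nrm ell_infty x" using mem lower by (rule cInf_eq_minimum)
  thus ?thesis by (simp add: S_def sum_space_def)
qed

text \<open>Eventual boundedness keeps the differences in \<open>elems ell_infty\<close>; elsewhere
  the supremum carries no information about the coordinates.\<close>

lemma tends_in_ell_infty_iff:
  assumes "\<forall>\<^sub>F w in Fl. bounded (range (\<lambda>n. u w n - l n))"
  shows "tends_in ell_infty u l Fl \<longleftrightarrow> uniform_limit UNIV u l Fl"
proof
  assume L: "tends_in ell_infty u l Fl"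
  show "uniform_limit UNIV u l Fl"
  proof (rule uniform_limitI)
    fix e :: real assume "e > 0"
    hence "\<forall>\<^sub>F w in Fl. nrm ell_infty (\<lambda>n. u w n - l n) < e"
      using L unfolding tends_in_def by (auto dest: order_tendstoD)
    with assms show "\<forall>\<^sub>F w in Fl. \<forall>n\<in>UNIV. dist (u w n) (l n) < e"
    proof eventually_elim
      case (elim w)
      thus ?case
        using norm_le_nrm_ell_infty[of "\<lambda>n. u w n - l n"] le_less_trans
        by (auto simp: elems_ell_infty dist_norm)
    qed
  qed
next
  assume L: "uniform_limit UNIV u l Fl"
  show "tends_in ell_infty u l Fl"
    unfolding tends_in_def
  proof (rule tendstoI)
    fix e :: real assume "e > 0"
    hence "\<forall>\<^sub>F w in Fl. \<forall>n\<in>UNIV. dist (u w n) (l n) < e/2"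
      using L by (intro uniform_limitD) auto
    with assms show "\<forall>\<^sub>F w in Fl. dist (nrm ell_infty (\<lambda>n. u w n - l n)) 0 < e"
    proof eventually_elim
      case (elim w)
      have E: "(\<lambda>n. u w n - l n) \<in> elems ell_infty" using elim by (simp add: elems_ell_infty)
      have "nrm ell_infty (\<lambda>n. u w n - l n) \<le> e/2"
        unfolding nrm_ell_infty_le_iff[OF E] using elim by (auto simp: dist_norm less_imp_le)
      thus ?case using nrm_ell_infty_nonneg[OF E] \<open>e > 0\<close> by simp
    qed
  qed
qed

lemma tends_in_Sigma_iff:
  assumes "\<forall>\<^sub>F w in Fl. bounded (range (\<lambda>n. u w n - l n))"
  shows "tends_in Sigma_space u l Fl \<longleftrightarrow> uniform_limit UNIV u l Fl"
proof -
  have "\<forall>\<^sub>F w in Fl. nrm Sigma_space (\<lambda>n. u w n - l n) = nrm ell_infty (\<lambda>n. u w n - l n)"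
    using assms by eventually_elim (simp add: nrm_Sigma elems_ell_infty)
  hence "tends_in Sigma_space u l Fl \<longleftrightarrow> tends_in ell_infty u l Fl"
    unfolding tends_in_def by (rule tendsto_cong)
  thus ?thesis using tends_in_ell_infty_iff[OF assms] by simp
qed

lemma bounded_range_diff:
  fixes a b :: "'a \<Rightarrow> 'b::real_normed_vector"
  assumes "bounded (range a)" "bounded (range b)"
  shows "bounded (range (\<lambda>n. a n - b n))"
  using bounded_minus_comp[OF assms] .

lemma bounded_range_mult:
  fixes a :: "'a \<Rightarrow> complex"
  assumes "bounded (range a)"
  shows "bounded (range (\<lambda>n. c * a n))"
proof -
  obtain B where B: "\<And>n. norm (a n) \<le> B" using assms by (auto simp: bounded_iff)
  show ?thesis
    by (rule bounded_rangeI[of _ "norm c * B"]) (auto simp: norm_mult intro!: mult_left_mono B)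
qed

lemma has_seq_deriv_Sigma_iff:
  assumes "open U" "z \<in> U" and bd: "\<And>w. w \<in> U \<Longrightarrow> bounded (range (F w))"
  shows "has_seq_deriv Sigma_space F d z \<longleftrightarrow>
    bounded (range d) \<and> uniform_limit UNIV (\<lambda>w n. (F w n - F z n) / (w - z)) d (at z)"
proof (cases "bounded (range d)")
  case True
  have "\<forall>\<^sub>F w in at z. w \<in> U" using assms by (simp add: eventually_at_in_open')
  hence "\<forall>\<^sub>F w in at z. bounded (range (\<lambda>n. (F w n - F z n) / (w - z) - d n))"
  proof eventually_elim
    case (elim w)
    have "bounded (range (\<lambda>n. inverse (w - z) * (F w n - F z n)))"
      using bounded_range_mult[OF bounded_range_diff[OF bd[OF elim] bd[OF \<open>z \<in> U\<close>]]] .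
    hence "bounded (range (\<lambda>n. (F w n - F z n) / (w - z)))"
      by (simp add: divide_inverse mult.commute)
    thus ?case by (rule bounded_range_diff) fact
  qed
  from tends_in_Sigma_iff[OF this] show ?thesis
    by (simp add: has_seq_deriv_def elems_Sigma elems_ell_infty)
qed (simp add: has_seq_deriv_def elems_Sigma elems_ell_infty)

text \<open>Cauchy's inequality bounds the second derivatives of all coordinates by one constant
  near \<open>z\<close>, so the first-order Taylor remainder is uniform in \<open>n\<close>. This
  upgrades coordinatewise differentiability to differentiability in norm.\<close>

lemma holomorphic_uniform_difference_quotient:
  fixes F :: "complex \<Rightarrow> 'i \<Rightarrow> complex"
  assumes U: "open U" "z \<in> U" and hol: "\<And>n. (\<lambda>w. F w n) holomorphic_on U"
    and B: "\<And>w n. w \<in> U \<Longrightarrow> cmod (F w n) \<le> B"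
  shows "uniform_limit UNIV (\<lambda>w n. (F w n - F z n) / (w - z)) (\<lambda>n. deriv (\<lambda>w. F w n) z) (at z)"
    and "\<exists>C. \<forall>n. cmod (deriv (\<lambda>w. F w n) z) \<le> C"
proof -
  obtain r where r: "r > 0" "cball z r \<subseteq> U" using U open_contains_cball by blast
  \<comment> \<open>The radius is halved so that discs about points near \<open>z\<close> stay in
    \<open>U\<close>; \<open>k = 2\<close> serves the remainder and \<open>k = 1\<close> the
    derivative itself.\<close>
  have Cauchy: "cmod ((deriv ^^ k) (\<lambda>w. F w n) w) \<le> fact k * B / (r/2)^k"
    if w: "w \<in> ball z (r/2)" for w n k
  proof (rule Cauchy_inequality)
    have sub: "cball w (r/2) \<subseteq> U"
    proof
      fix x assume "x \<in> cball w (r/2)"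
      hence "dist z x \<le> r" using w dist_triangle[of z x w] by (simp add: dist_commute)
      thus "x \<in> U" using r by auto
    qed
    show "(\<lambda>w. F w n) holomorphic_on ball w (r/2)"
      using hol sub ball_subset_cball holomorphic_on_subset by (meson order_trans)
    show "continuous_on (cball w (r/2)) (\<lambda>w. F w n)"
      using hol sub holomorphic_on_subset holomorphic_on_imp_continuous_on by blast
    show "cmod (F x n) \<le> B" if "norm (w - x) = r/2" for x
      by (rule B) (use that sub in \<open>auto simp: dist_norm\<close>)
  qed (use r in simp)
  define C where "C = 2 * B / (r/2)\<^sup>2"
  have taylor: "cmod ((F w n - F z n) / (w - z) - deriv (\<lambda>w. F w n) z) \<le> C * norm (w - z)"
    if w: "w \<in> ball z (r/2)" "w \<noteq> z" for w n
  proof -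
    let ?g = "\<lambda>w. F w n"
    have sub: "ball z (r/2) \<subseteq> U" using r ball_subset_cball[of z "r/2"] by (auto simp: subset_iff)
    have "cmod ((deriv ^^ 0) ?g w - (\<Sum>i\<le>1. (deriv ^^ i) ?g z * (w - z) ^ i / fact i))
        \<le> C * cmod (w - z) ^ Suc 1 / fact 1"
    proof (rule complex_Taylor[of "ball z (r/2)"])
      fix i x assume "x \<in> ball z (r/2)"
      moreover have "(deriv ^^ i) ?g holomorphic_on ball z (r/2)"
        by (rule holomorphic_higher_deriv[OF holomorphic_on_subset[OF hol sub]]) simp
      ultimately show "((deriv ^^ i) ?g has_field_derivative (deriv ^^ Suc i) ?g x) (at x within ball z (r/2))"
        by (simp add: has_field_derivative_at_within holomorphic_derivI[of _ "ball z (r/2)"])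
    next
      fix x assume x: "x \<in> ball z (r/2)"
      show "cmod ((deriv ^^ Suc 1) ?g x) \<le> C"
        using Cauchy[OF x, of 2 n] by (simp add: C_def numeral_2_eq_2)
    qed (use w r in auto)
    hence "cmod (F w n - (F z n + deriv ?g z * (w - z))) \<le> C * norm (w - z) * norm (w - z)"
      by (simp add: power2_eq_square)
    moreover have "(F w n - F z n) / (w - z) - deriv ?g z = (F w n - (F z n + deriv ?g z * (w - z))) / (w - z)"
      using w by (simp add: field_simps)
    ultimately show ?thesis using w by (simp add: norm_divide divide_le_eq)
  qed
  show "uniform_limit UNIV (\<lambda>w n. (F w n - F z n) / (w - z)) (\<lambda>n. deriv (\<lambda>w. F w n) z) (at z)"
  proof (rule uniform_limitI)
    fix e :: real assume e: "e > 0"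
    have "((\<lambda>w. C * norm (w - z)) \<longlongrightarrow> C * norm (z - z)) (at z)" by (intro tendsto_intros)
    hence "\<forall>\<^sub>F w in at z. C * norm (w - z) < e" using e by (auto dest: order_tendstoD)
    moreover have "\<forall>\<^sub>F w in at z. w \<in> ball z (r/2) - {z}" using r by (intro eventually_at_in_open) auto
    ultimately show "\<forall>\<^sub>F w in at z. \<forall>n\<in>UNIV. dist ((F w n - F z n) / (w - z)) (deriv (\<lambda>w. F w n) z) < e"
    proof eventually_elim
      case (elim w)
      thus ?case using taylor[of w] by (auto simp: dist_norm intro: le_less_trans)
    qed
  qed
  show "\<exists>C. \<forall>n. cmod (deriv (\<lambda>w. F w n) z) \<le> C"
    using Cauchy[of z 1] r by auto
qed

text \<open>\<open>seq_deriv\<close> is a definite description, so uniqueness matters: a uniform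
  limit is a limit in each coordinate, and those are unique.\<close>

lemma seq_deriv_Sigma:
  assumes U: "open U" "z \<in> U" and hol: "\<And>n. (\<lambda>w. F w n) holomorphic_on U"
    and B: "\<And>w n. w \<in> U \<Longrightarrow> cmod (F w n) \<le> B"
  shows "has_seq_deriv Sigma_space F (\<lambda>n. deriv (\<lambda>w. F w n) z) z"
    and "seq_deriv Sigma_space F z = (\<lambda>n. deriv (\<lambda>w. F w n) z)"
proof -
  have D: "has_seq_deriv Sigma_space F d z \<longleftrightarrow> bounded (range d) \<and>
      uniform_limit UNIV (\<lambda>w n. (F w n - F z n) / (w - z)) d (at z)" for d
    using B by (intro has_seq_deriv_Sigma_iff[OF U] bounded_rangeI[of _ B])
  have L: "uniform_limit UNIV (\<lambda>w n. (F w n - F z n) / (w - z)) (\<lambda>n. deriv (\<lambda>w. F w n) z) (at z)"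
    "\<exists>C. \<forall>n. cmod (deriv (\<lambda>w. F w n) z) \<le> C"
    by (rule holomorphic_uniform_difference_quotient[where U = U and B = B]; use U hol B in simp)+
  show 1: "has_seq_deriv Sigma_space F (\<lambda>n. deriv (\<lambda>w. F w n) z) z"
    unfolding D bounded_range_iff by (intro conjI L)
  show "seq_deriv Sigma_space F z = (\<lambda>n. deriv (\<lambda>w. F w n) z)"
    unfolding seq_deriv_def
  proof (rule the_equality[where P = "\<lambda>d. has_seq_deriv Sigma_space F d z", OF 1])
    fix d assume "has_seq_deriv Sigma_space F d z"
    hence "uniform_limit UNIV (\<lambda>w n. (F w n - F z n) / (w - z)) d (at z)" unfolding D by simp
    thus "d = (\<lambda>n. deriv (\<lambda>w. F w n) z)"
      using L(1) by (intro ext tendsto_unique[OF trivial_limit_at]) (erule tendsto_uniform_limitI, simp)+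
  qed
qed

section \<open>The Calderon space of the couple\<close>

lemma open_open_strip: "open open_strip"
proof -
  have eq: "open_strip = {z. 0 < Re z} \<inter> {z. Re z < 1}" by (auto simp: open_strip_def)
  show ?thesis unfolding eq by (intro open_Int open_halfspace_Re_gt open_halfspace_Re_lt)
qed

lemma open_strip_subset: "open_strip \<subseteq> strip"
  by (auto simp: open_strip_def strip_def)

lemma half_in_open_strip: "1/2 \<in> open_strip"
  by (simp add: open_strip_def)

lemma half_in_strip: "1/2 \<in> strip"
  by (simp add: strip_def)

lemma ball_half_subset_open_strip: "ball (1/2) (1/2) \<subseteq> open_strip"
proof
  fix z :: complex assume "z \<in> ball (1/2) (1/2)"
  hence "cmod (1/2 - z) < 1/2" by (simp add: dist_norm)
  hence "\<bar>Re (1/2 - z)\<bar> < 1/2" using abs_Re_le_cmod le_less_trans by blast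
  hence "\<bar>1/2 - Re z\<bar> < 1/2" by simp
  thus "z \<in> open_strip" unfolding open_strip_def abs_less_iff mem_Collect_eq by linarith
qed

lemma cball_half_subset_open_strip: "cball (1/2) (1/4) \<subseteq> open_strip"
  using ball_half_subset_open_strip by (auto simp: subset_iff)

lemma Complex_line_in_strip: "Complex 0 t \<in> strip" "Complex 1 t \<in> strip"
  by (auto simp: strip_def)

text \<open>Carries continuity on the closed strip over to the two boundary lines.\<close>

lemma filterlim_Complex_line:
  assumes "x = 0 \<or> x = 1"
  shows "filterlim (Complex x) (at (Complex x t) within strip) (at t)"
proof -
  have "((\<lambda>s. Complex x s) \<longlongrightarrow> Complex x t) (at t)" by (intro tendsto_intros)
  moreover have "\<forall>\<^sub>F s in at t. Complex x s \<in> strip \<and> Complex x s \<noteq> Complex x t"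
    using assms unfolding eventually_at by (auto simp: strip_def intro: exI[of _ 1])
  ultimately show ?thesis by (simp add: filterlim_at)
qed

lemma uniform_limit_const_arg:
  assumes "(m \<longlongrightarrow> c) Fl"
  shows "uniform_limit UNIV (\<lambda>w n. m w) (\<lambda>n. c) Fl"
  by (rule uniform_limitI) (use tendstoD[OF assms] in auto)

text \<open>\<open>F w\<close> is \<open>F z\<close> plus \<open>w - z\<close> times the difference
  quotient, which converges uniformly to a bounded sequence.\<close>

lemma holomorphic_uniform_continuity:
  fixes F :: "complex \<Rightarrow> 'i \<Rightarrow> complex"
  assumes "open U" "z \<in> U" and hol: "\<And>n. (\<lambda>w. F w n) holomorphic_on U"
    and B: "\<And>w n. w \<in> U \<Longrightarrow> cmod (F w n) \<le> B"
  shows "uniform_limit UNIV F (F z) (at z)"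
proof -
  let ?d = "\<lambda>n. deriv (\<lambda>w. F w n) z"
  have L: "uniform_limit UNIV (\<lambda>w n. (F w n - F z n) / (w - z)) ?d (at z)"
    and C: "\<exists>C. \<forall>n. cmod (?d n) \<le> C"
    by (rule holomorphic_uniform_difference_quotient[where U = U and B = B]; use assms in simp)+
  have "((\<lambda>w. w - z) \<longlongrightarrow> z - z) (at z)" by (intro tendsto_intros)
  hence "uniform_limit UNIV (\<lambda>w n. w - z) (\<lambda>n. z - z) (at z)" by (rule uniform_limit_const_arg)
  hence "uniform_limit UNIV (\<lambda>w n. (w - z) * ((F w n - F z n) / (w - z))) (\<lambda>n. (z - z) * ?d n) (at z)"
    using C by (intro uniform_lim_mult L) (auto simp: bounded_range_iff)
  hence "uniform_limit UNIV (\<lambda>w n. (w - z) * ((F w n - F z n) / (w - z)) + F z n)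
      (\<lambda>n. (z - z) * ?d n + F z n) (at z)"
    by (intro uniform_limit_add uniform_limit_const)
  hence "uniform_limit UNIV (\<lambda>w n. (w - z) * ((F w n - F z n) / (w - z)) + F z n) (F z) (at z)"
    by simp
  moreover have "\<forall>\<^sub>F w in at z. \<forall>n\<in>UNIV. (w - z) * ((F w n - F z n) / (w - z)) + F z n = F w n"
    unfolding eventually_at by (auto intro: exI[of _ 1])
  ultimately show ?thesis by (subst (asm) uniform_limit_cong) auto
qed

abbreviation calderon_C :: "(complex \<Rightarrow> cseq) set" where
  "calderon_C \<equiv> calderon ell_infty ell_1"

abbreviation calderon_nrm :: "(complex \<Rightarrow> cseq) \<Rightarrow> real" where
  "calderon_nrm \<equiv> calderon_norm ell_infty ell_1"

text \<open>Membership in terms of coordinates. On the left line, continuity into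
  \<open>ell_infty\<close> is inherited from the strip, since the sum norm is the sup norm; only the
  decay remains. On the right line \<open>ell_1\<close> has a stronger norm, so
  \<open>vanishing_curve\<close> stays as it is.\<close>

lemma calderon_iff:
  "F \<in> calderon_C \<longleftrightarrow>
     (\<forall>z. z \<notin> strip \<longrightarrow> F z = (\<lambda>n. 0)) \<and>
     (\<exists>B. \<forall>z\<in>strip. \<forall>n. cmod (F z n) \<le> B) \<and>
     (\<forall>z\<in>strip. uniform_limit UNIV F (F z) (at z within strip)) \<and>
     (\<forall>n. (\<lambda>z. F z n) holomorphic_on open_strip) \<and>
     uniform_limit UNIV (\<lambda>t. F (Complex 0 t)) (\<lambda>n. 0) at_infinity \<and>
     vanishing_curve ell_1 (\<lambda>t. F (Complex 1 t))"
\<comment> \<open>Boundedness comes first: the translations of norms into coordinates below rely on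
  it.\<close>
proof (cases "\<exists>B. \<forall>z\<in>strip. \<forall>n. cmod (F z n) \<le> B")
  case False
  have False if F: "F \<in> calderon_C"
  proof -
    obtain B where "\<forall>z\<in>strip. F z \<in> elems Sigma_space \<and> nrm Sigma_space (F z) \<le> B"
      using F by (auto simp: calderon_def)
    hence "\<forall>z\<in>strip. \<forall>n. cmod (F z n) \<le> B"
      using nrm_Sigma nrm_ell_infty_le_iff elems_Sigma by metis
    thus False using False by blast
  qed
  thus ?thesis using False by blast
next
  case True
  then obtain B where B: "\<And>z n. z \<in> strip \<Longrightarrow> cmod (F z n) \<le> B" by blast
  have bd: "bounded (range (F z))" if "z \<in> strip" for z
    using B[OF that] by (rule bounded_rangeI)
  have bdd: "bounded (range (\<lambda>n. F w n - F z n))" if "w \<in> strip" "z \<in> strip" for w z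
    by (intro bounded_range_diff bd that)
  have 1: "\<forall>z\<in>strip. F z \<in> elems Sigma_space"
    using bd by (simp add: elems_Sigma elems_ell_infty)
  have 2: "\<exists>B. \<forall>z\<in>strip. nrm Sigma_space (F z) \<le> B"
    using B bd by (auto simp: nrm_Sigma elems_ell_infty nrm_ell_infty_le_iff)
  have 3: "tends_in Sigma_space F (F z) (at z within strip) \<longleftrightarrow>
      uniform_limit UNIV F (F z) (at z within strip)" if "z \<in> strip" for z
    by (rule tends_in_Sigma_iff) (use that bdd in \<open>auto simp: eventually_at_filter\<close>)
  have D: "has_seq_deriv Sigma_space F d z \<longleftrightarrow> bounded (range d) \<and>
      uniform_limit UNIV (\<lambda>w n. (F w n - F z n) / (w - z)) d (at z)" if "z \<in> open_strip" for d z
    by (rule has_seq_deriv_Sigma_iff[OF open_open_strip that]) (use bd open_strip_subset in auto)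
  have 4: "(\<forall>z\<in>open_strip. \<exists>d. has_seq_deriv Sigma_space F d z) \<longleftrightarrow>
      (\<forall>n. (\<lambda>z. F z n) holomorphic_on open_strip)"
  proof (intro iffI allI ballI)
    fix n assume A: "\<forall>z\<in>open_strip. \<exists>d. has_seq_deriv Sigma_space F d z"
    show "(\<lambda>z. F z n) holomorphic_on open_strip"
      unfolding holomorphic_on_open[OF open_open_strip]
    proof
      fix z assume z: "z \<in> open_strip"
      then obtain d where "uniform_limit UNIV (\<lambda>w n. (F w n - F z n) / (w - z)) d (at z)"
        using A D by blast
      hence "((\<lambda>w. (F w n - F z n) / (w - z)) \<longlongrightarrow> d n) (at z)"
        by (rule tendsto_uniform_limitI) simp
      thus "\<exists>f'. ((\<lambda>z. F z n) has_field_derivative f') (at z)"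
        by (auto simp: has_field_derivative_iff)
    qed
  next
    fix z assume "\<forall>n. (\<lambda>z. F z n) holomorphic_on open_strip" "z \<in> open_strip"
    hence "has_seq_deriv Sigma_space F (\<lambda>n. deriv (\<lambda>w. F w n) z) z"
      using B open_strip_subset by (intro seq_deriv_Sigma(1)[OF open_open_strip, where B = B]) auto
    thus "\<exists>d. has_seq_deriv Sigma_space F d z" by blast
  qed
  have 5: "vanishing_curve ell_infty (\<lambda>t. F (Complex 0 t)) \<longleftrightarrow>
      uniform_limit UNIV (\<lambda>t. F (Complex 0 t)) (\<lambda>n. 0) at_infinity"
    if A: "\<forall>z\<in>strip. uniform_limit UNIV F (F z) (at z within strip)"
  proof -
    have "tends_in ell_infty (\<lambda>t. F (Complex 0 t)) (F (Complex 0 t)) (at t)" for t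
    proof (subst tends_in_ell_infty_iff)
      show "uniform_limit UNIV (\<lambda>t. F (Complex 0 t)) (F (Complex 0 t)) (at t)"
        by (rule filterlim_compose[OF bspec[OF A] filterlim_Complex_line])
          (simp_all add: Complex_line_in_strip)
    qed (simp add: bdd Complex_line_in_strip)
    moreover have "tends_in ell_infty (\<lambda>t. F (Complex 0 t)) (\<lambda>n. 0) at_infinity \<longleftrightarrow>
        uniform_limit UNIV (\<lambda>t. F (Complex 0 t)) (\<lambda>n. 0) at_infinity"
      by (rule tends_in_ell_infty_iff) (simp add: bd Complex_line_in_strip)
    ultimately show ?thesis
      unfolding vanishing_curve_def by (simp add: elems_ell_infty bd Complex_line_in_strip)
  qed
  show ?thesis using True 1 2 3 4 5 unfolding calderon_def by blast
qed

lemma seq_deriv_calderon: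
  assumes F: "F \<in> calderon_C" and z: "z \<in> open_strip"
  shows "seq_deriv Sigma_space F z = (\<lambda>n. deriv (\<lambda>w. F w n) z)"
proof -
  obtain B where "\<forall>z\<in>strip. \<forall>n. cmod (F z n) \<le> B" "\<forall>n. (\<lambda>z. F z n) holomorphic_on open_strip"
    using F calderon_iff by blast
  thus ?thesis
    using open_strip_subset by (intro seq_deriv_Sigma(2)[OF open_open_strip z, where B = B]) auto
qed

section \<open>The operators \<open>Delta\<close> in coordinates\<close>

lemma Delta_0: "Delta X0 X1 0 F = F (1/2)"
  by (simp add: Delta_def)

lemma Delta_1:
  assumes "F \<in> calderon_C"
  shows "Delta ell_infty ell_1 1 F = (\<lambda>n. deriv (\<lambda>z. F z n) (1/2))"
  using seq_deriv_calderon[OF assms half_in_open_strip] by (simp add: Delta_def)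

text \<open>The coordinatewise derivatives are again uniformly bounded near \<open>1/2\<close> by
  Cauchy's inequality, so \<open>seq_deriv_Sigma\<close> applies to
  \<open>seq_deriv Sigma_space F\<close> as well.\<close>

lemma Delta_2:
  assumes F: "F \<in> calderon_C"
  shows "Delta ell_infty ell_1 2 F = (\<lambda>n. deriv (deriv (\<lambda>z. F z n)) (1/2) / 2)"
proof -
  obtain B where B: "\<And>z n. z \<in> strip \<Longrightarrow> cmod (F z n) \<le> B"
    and hol: "\<And>n. (\<lambda>z. F z n) holomorphic_on open_strip"
    using F calderon_iff by blast
  let ?G = "seq_deriv Sigma_space F"
  \<comment> \<open>Discs of radius \<open>1/4\<close> about points of \<open>?U\<close> stay in the
    disc of radius \<open>1/2\<close> about the midpoint, hence in the open strip.\<close>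
  let ?U = "ball (1/2) (1/4) :: complex set"
  have U: "?U \<subseteq> open_strip" using cball_half_subset_open_strip ball_subset_cball by blast
  have eq: "?G z n = deriv (\<lambda>w. F w n) z" if "z \<in> ?U" for z n
    using seq_deriv_calderon[OF F] that U by auto
  have "cmod (deriv (\<lambda>w. F w n) z) \<le> fact 1 * B / (1/4)^1" if z: "z \<in> ?U" for z n
  proof -
    have sub: "cball z (1/4) \<subseteq> open_strip"
    proof
      fix x assume "x \<in> cball z (1/4)"
      hence "dist (1/2) x < 1/2" using z dist_triangle[of "1/2" x z] by simp
      thus "x \<in> open_strip" using ball_half_subset_open_strip by auto
    qed
    have "cmod ((deriv ^^ 1) (\<lambda>w. F w n) z) \<le> fact 1 * B / (1/4)^1"
    proof (rule Cauchy_inequality)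
      show "(\<lambda>w. F w n) holomorphic_on ball z (1/4)"
        using hol sub ball_subset_cball holomorphic_on_subset by (meson order_trans)
      show "continuous_on (cball z (1/4)) (\<lambda>w. F w n)"
        using hol sub holomorphic_on_subset holomorphic_on_imp_continuous_on by blast
      show "cmod (F x n) \<le> B" if "norm (z - x) = 1/4" for x
        by (rule B, rule subsetD[OF open_strip_subset], rule subsetD[OF sub])
          (use that in \<open>simp add: dist_norm\<close>)
    qed simp
    thus ?thesis by simp
  qed
  hence "seq_deriv Sigma_space ?G (1/2) = (\<lambda>n. deriv (\<lambda>z. ?G z n) (1/2))"
  proof (intro seq_deriv_Sigma(2)[where U = ?U and B = "fact 1 * B / (1/4)^1"])
    fix n
    have "deriv (\<lambda>w. F w n) holomorphic_on ?U"
      using hol U by (intro holomorphic_deriv) (auto intro: holomorphic_on_subset)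
    thus "(\<lambda>w. ?G w n) holomorphic_on ?U"
      using eq by (subst holomorphic_cong[OF refl]) auto
  qed (simp_all only: eq, simp_all)
  \<comment> \<open>\<open>?G\<close> is identified with the coordinate derivatives only near
    \<open>1/2\<close>, which suffices for derivatives at that point.\<close>
  moreover have "deriv (\<lambda>z. ?G z n) (1/2) = deriv (deriv (\<lambda>w. F w n)) (1/2)" for n
  proof (rule deriv_cong_ev)
    have "\<forall>\<^sub>F z in nhds (1/2). z \<in> ?U" by (rule eventually_nhds_in_open) auto
    thus "\<forall>\<^sub>F z in nhds (1/2). ?G z n = deriv (\<lambda>w. F w n) z"
      by eventually_elim (rule eq)
  qed simp
  ultimately show ?thesis by (simp add: Delta_def numeral_2_eq_2)
qed

section \<open>Norms and vanishing curves in \<open>ell_1\<close>\<close>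

lemma ell_1_add:
  assumes "a \<in> elems ell_1" "b \<in> elems ell_1"
  shows "(\<lambda>n. a n + b n) \<in> elems ell_1"
    and "nrm ell_1 (\<lambda>n. a n + b n) \<le> nrm ell_1 a + nrm ell_1 b"
proof -
  have s: "summable (\<lambda>n. cmod (a n) + cmod (b n))"
    using assms by (intro summable_add) (simp_all add: elems_ell_1)
  show *: "(\<lambda>n. a n + b n) \<in> elems ell_1"
    unfolding elems_ell_1 by (rule summable_comparison_test'[OF s]) (simp add: norm_triangle_ineq)
  have "(\<Sum>n. cmod (a n + b n)) \<le> (\<Sum>n. cmod (a n) + cmod (b n))"
    using * by (intro suminf_le s) (simp_all add: norm_triangle_ineq elems_ell_1)
  also have "\<dots> = (\<Sum>n. cmod (a n)) + (\<Sum>n. cmod (b n))"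
    using assms by (intro suminf_add[symmetric]) (simp_all add: elems_ell_1)
  finally show "nrm ell_1 (\<lambda>n. a n + b n) \<le> nrm ell_1 a + nrm ell_1 b" by (simp add: ell_1_def)
qed

lemma ell_1_scale:
  assumes "a \<in> elems ell_1"
  shows "(\<lambda>n. c * a n) \<in> elems ell_1" and "nrm ell_1 (\<lambda>n. c * a n) = cmod c * nrm ell_1 a"
  using assms by (simp_all add: elems_ell_1 norm_mult summable_mult)
    (simp add: ell_1_def norm_mult suminf_mult)

lemma ell_1_diff:
  assumes "a \<in> elems ell_1" "b \<in> elems ell_1"
  shows "(\<lambda>n. a n - b n) \<in> elems ell_1"
  using ell_1_add(1)[OF assms(1) ell_1_scale(1)[OF assms(2), of "-1"]] by simp

text \<open>The bound on the strip is only a sup-norm bound. In \<open>ell_1\<close> the norm is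
  continuous along the curve by the reverse triangle inequality and small far out, so compactness
  bounds it; this makes the supremum in \<open>calderon_norm\<close> meaningful.\<close>

lemma vanishing_curve_ell_1_bounded:
  assumes u: "vanishing_curve ell_1 u"
  shows "bdd_above (range (\<lambda>t. nrm ell_1 (u t)))"
proof -
  define N where "N = (\<lambda>t. nrm ell_1 (u t))"
  have el: "u t \<in> elems ell_1" for t using u by (simp add: vanishing_curve_def)
  have diff: "\<bar>N s - N t\<bar> \<le> nrm ell_1 (\<lambda>n. u s n - u t n)" for s t
  proof -
    have d: "(\<lambda>n. u s n - u t n) \<in> elems ell_1" by (intro ell_1_diff el)
    have "N s \<le> nrm ell_1 (\<lambda>n. u s n - u t n) + N t"
      using ell_1_add(2)[OF d el[of t]] by (simp add: N_def)
    moreover have "N t \<le> nrm ell_1 (\<lambda>n. u s n - u t n) + N s"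
      using ell_1_add(2)[OF ell_1_scale(1)[OF d, of "-1"] el[of s]] ell_1_scale(2)[OF d, of "-1"]
      by (simp add: N_def)
    ultimately show ?thesis by simp
  qed
  have "isCont N t" for t
  proof -
    have "((\<lambda>s. N s - N t) \<longlongrightarrow> 0) (at t)"
    proof (rule Lim_null_comparison)
      show "\<forall>\<^sub>F s in at t. norm (N s - N t) \<le> nrm ell_1 (\<lambda>n. u s n - u t n)"
        unfolding real_norm_def by (intro always_eventually allI diff)
      show "((\<lambda>s. nrm ell_1 (\<lambda>n. u s n - u t n)) \<longlongrightarrow> 0) (at t)"
        using u by (simp add: vanishing_curve_def tends_in_def)
    qed
    thus ?thesis unfolding isCont_def by (rule LIM_zero_cancel)
  qed
  hence cont: "continuous_on UNIV N" by (simp add: continuous_on_eq_continuous_at)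
  have "(N \<longlongrightarrow> 0) at_infinity" using u by (simp add: vanishing_curve_def tends_in_def N_def)
  hence "\<forall>\<^sub>F t in at_infinity. N t < 1" by (rule order_tendstoD(2)) simp
  then obtain R where R: "\<And>t. norm t \<ge> R \<Longrightarrow> N t < 1" by (auto simp: eventually_at_infinity)
  have "bounded (N ` cball 0 R)"
    by (intro compact_imp_bounded compact_continuous_image continuous_on_subset[OF cont]) auto
  then obtain C where C: "\<And>t. norm t \<le> R \<Longrightarrow> norm (N t) \<le> C"
    by (fastforce simp: bounded_iff)
  have "N t \<le> max C 1" for t
  proof (cases "norm t \<le> R")
    case True thus ?thesis using C[OF True] by auto
  next
    case False thus ?thesis using R[of t] by auto
  qed
  thus ?thesis by (auto simp: bdd_above_def N_def)
qed

text \<open>The multiplier is given on a single line only, so that it may have a pole inside the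
  strip, as \<open>1 / (z - 1/2)\<close> does.\<close>

lemma vanishing_curve_ell_1_mult:
  assumes u: "vanishing_curve ell_1 u" and m: "\<And>t. isCont m t" and K: "\<And>t. cmod (m t) \<le> K"
  shows "vanishing_curve ell_1 (\<lambda>t n. m t * u t n)"
proof -
  have el: "u t \<in> elems ell_1" for t using u by (simp add: vanishing_curve_def)
  have el': "(\<lambda>n. m t * u t n) \<in> elems ell_1" for t by (intro ell_1_scale el)
  have "tends_in ell_1 (\<lambda>t n. m t * u t n) (\<lambda>n. m t * u t n) (at t)" for t
    unfolding tends_in_def
  proof (rule Lim_null_comparison)
    let ?h = "\<lambda>s. cmod (m s) * nrm ell_1 (\<lambda>n. u s n - u t n) + cmod (m s - m t) * nrm ell_1 (u t)"
    have bound: "norm (nrm ell_1 (\<lambda>n. m s * u s n - m t * u t n)) \<le> ?h s" for s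
    proof -
      have d: "(\<lambda>n. u s n - u t n) \<in> elems ell_1" by (intro ell_1_diff el)
      have "nrm ell_1 (\<lambda>n. m s * u s n - m t * u t n)
          = nrm ell_1 (\<lambda>n. m s * (u s n - u t n) + (m s - m t) * u t n)"
        by (rule arg_cong[where f = "nrm ell_1"]) (simp add: fun_eq_iff algebra_simps)
      also have "\<dots> \<le> nrm ell_1 (\<lambda>n. m s * (u s n - u t n)) + nrm ell_1 (\<lambda>n. (m s - m t) * u t n)"
        by (intro ell_1_add ell_1_scale d el)
      also have "\<dots> = ?h s"
        using ell_1_scale(2)[OF d] ell_1_scale(2)[OF el] by simp
      finally show ?thesis using nrm_ell_1_nonneg[OF ell_1_diff[OF el' el']] by simp
    qed
    show "\<forall>\<^sub>F s in at t. norm (nrm ell_1 (\<lambda>n. m s * u s n - m t * u t n)) \<le> ?h s"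
      using bound by simp
    have "(?h \<longlongrightarrow> cmod (m t) * 0 + cmod (m t - m t) * nrm ell_1 (u t)) (at t)"
      using u m[of t] unfolding vanishing_curve_def tends_in_def isCont_def by (intro tendsto_intros) auto
    thus "(?h \<longlongrightarrow> 0) (at t)" by simp
  qed
  moreover have "tends_in ell_1 (\<lambda>t n. m t * u t n) (\<lambda>n. 0) at_infinity"
    unfolding tends_in_def
  proof (rule Lim_null_comparison)
    have "norm (nrm ell_1 (\<lambda>n. m t * u t n - 0)) \<le> K * nrm ell_1 (u t)" for t
      using ell_1_scale(2)[OF el, of "m t" t] nrm_ell_1_nonneg[OF el[of t]] K[of t]
      by (simp add: mult_right_mono)
    thus "\<forall>\<^sub>F t in at_infinity. norm (nrm ell_1 (\<lambda>n. m t * u t n - 0)) \<le> K * nrm ell_1 (u t)" by simp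
    have "((\<lambda>t. nrm ell_1 (u t)) \<longlongrightarrow> 0) at_infinity"
      using u by (simp add: vanishing_curve_def tends_in_def)
    thus "((\<lambda>t. K * nrm ell_1 (u t)) \<longlongrightarrow> 0) at_infinity"
      using tendsto_mult_right_zero by blast
  qed
  ultimately show ?thesis using el' by (simp add: vanishing_curve_def)
qed

section \<open>Boundary norms and bounded multipliers\<close>

lemma calderon_line_elems:
  assumes "F \<in> calderon_C"
  shows "F (Complex 0 t) \<in> elems ell_infty" "F (Complex 1 t) \<in> elems ell_1"
  using assms by (simp_all add: calderon_def vanishing_curve_def)

lemma nrm_line_le_calderon_nrm:
  assumes F: "F \<in> calderon_C"
  shows "nrm ell_infty (F (Complex 0 t)) \<le> calderon_nrm F"
    and "nrm ell_1 (F (Complex 1 t)) \<le> calderon_nrm F"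
proof -
  obtain B where B: "\<And>z n. z \<in> strip \<Longrightarrow> cmod (F z n) \<le> B" using F calderon_iff by blast
  have "bdd_above (range (\<lambda>t. nrm ell_infty (F (Complex 0 t))))"
    using B[OF Complex_line_in_strip(1)] calderon_line_elems(1)[OF F]
    by (intro bdd_aboveI[of _ B]) (auto simp: nrm_ell_infty_le_iff)
  thus "nrm ell_infty (F (Complex 0 t)) \<le> calderon_nrm F"
    unfolding calderon_norm_def by (intro max.coboundedI1 cSUP_upper) auto
  have "vanishing_curve ell_1 (\<lambda>t. F (Complex 1 t))" using F by (simp add: calderon_def)
  from vanishing_curve_ell_1_bounded[OF this] show "nrm ell_1 (F (Complex 1 t)) \<le> calderon_nrm F"
    unfolding calderon_norm_def by (intro max.coboundedI2 cSUP_upper) auto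
qed

lemma calderon_nrm_le:
  assumes F: "F \<in> calderon_C" and "\<And>t n. cmod (F (Complex 0 t) n) \<le> A"
    and "\<And>t. nrm ell_1 (F (Complex 1 t)) \<le> A"
  shows "calderon_nrm F \<le> A"
  unfolding calderon_norm_def using assms calderon_line_elems[OF F]
  by (intro max.boundedI cSUP_least) (auto simp: nrm_ell_infty_le_iff)

lemma calderon_nrm_nonneg: "F \<in> calderon_C \<Longrightarrow> 0 \<le> calderon_nrm F"
  using nrm_line_le_calderon_nrm(1)[of F 0] nrm_ell_infty_nonneg[OF calderon_line_elems(1)[of F 0]]
  by simp

text \<open>Serves the factor \<open>(z - 1/2) * gauss z\<close> and constant factors.\<close>

lemma calderon_mult:
  assumes F: "F \<in> calderon_C" and m: "continuous_on strip m" "m holomorphic_on open_strip"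
    and K: "\<And>z. z \<in> strip \<Longrightarrow> cmod (m z) \<le> K"
  shows "(\<lambda>z n. m z * F z n) \<in> calderon_C"
    and "calderon_nrm (\<lambda>z n. m z * F z n) \<le> K * calderon_nrm F"
proof -
  obtain B where B: "\<And>z n. z \<in> strip \<Longrightarrow> cmod (F z n) \<le> B" using F calderon_iff by blast
  note Fp = F[unfolded calderon_iff]
  have K0: "K \<ge> 0" using K[OF half_in_strip] norm_ge_zero order_trans by blast
  have "vanishing_curve ell_1 (\<lambda>t n. m (Complex 1 t) * F (Complex 1 t) n)"
  proof (rule vanishing_curve_ell_1_mult)
    show "vanishing_curve ell_1 (\<lambda>t. F (Complex 1 t))" using Fp by blast
    show "cmod (m (Complex 1 t)) \<le> K" for t by (intro K Complex_line_in_strip)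
    show "isCont (\<lambda>t. m (Complex 1 t)) t" for t
      unfolding isCont_def
      by (rule filterlim_compose[OF _ filterlim_Complex_line])
        (use m(1) Complex_line_in_strip in \<open>auto simp: continuous_on_def\<close>)
  qed
  moreover have "uniform_limit UNIV (\<lambda>t n. m (Complex 0 t) * F (Complex 0 t) n) (\<lambda>n. 0) at_infinity"
  proof (rule uniform_limit_null_comparison)
    show "\<forall>\<^sub>F t in at_infinity. \<forall>n\<in>UNIV.
        norm (m (Complex 0 t) * F (Complex 0 t) n) \<le> K * norm (F (Complex 0 t) n)"
      using K[OF Complex_line_in_strip(1)] by (auto simp: norm_mult intro!: mult_right_mono always_eventually)
    have "uniform_limit UNIV (\<lambda>t. F (Complex 0 t)) (\<lambda>n. 0) at_infinity" using Fp by blast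
    from uniform_limit_norm[OF this]
    have "uniform_limit UNIV (\<lambda>t n. K * norm (F (Complex 0 t) n)) (\<lambda>n. K * norm (0::complex)) at_infinity"
      by (rule bounded_linear.uniform_limit[OF bounded_linear_mult_right])
    thus "uniform_limit UNIV (\<lambda>t n. K * norm (F (Complex 0 t) n)) (\<lambda>n. 0) at_infinity" by simp
  qed
  moreover have "uniform_limit UNIV (\<lambda>z n. m z * F z n) (\<lambda>n. m z * F z n) (at z within strip)"
    if z: "z \<in> strip" for z
  proof (rule uniform_lim_mult)
    show "uniform_limit UNIV (\<lambda>z n. m z) (\<lambda>n. m z) (at z within strip)"
      using m(1) z by (intro uniform_limit_const_arg) (simp add: continuous_on_def)
    show "uniform_limit UNIV F (F z) (at z within strip)" using Fp z by blast
    show "bounded (range (F z))" using B[OF z] by (rule bounded_rangeI)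
  qed auto
  moreover have "\<forall>z\<in>strip. \<forall>n. cmod (m z * F z n) \<le> K * B"
    using K B K0 by (auto simp: norm_mult intro!: mult_mono)
  ultimately show mF: "(\<lambda>z n. m z * F z n) \<in> calderon_C"
    unfolding calderon_iff using Fp m(2) by (intro conjI) (auto intro!: holomorphic_on_mult)
  show "calderon_nrm (\<lambda>z n. m z * F z n) \<le> K * calderon_nrm F"
  proof (rule calderon_nrm_le[OF mF])
    fix t n
    have "cmod (F (Complex 0 t) n) \<le> calderon_nrm F"
      using norm_le_nrm_ell_infty[OF calderon_line_elems(1)[OF F]] nrm_line_le_calderon_nrm(1)[OF F]
      by (rule order_trans)
    thus "cmod (m (Complex 0 t) * F (Complex 0 t) n) \<le> K * calderon_nrm F"
      using K[OF Complex_line_in_strip(1)] K0 by (auto simp: norm_mult intro!: mult_mono)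
  next
    fix t
    show "nrm ell_1 (\<lambda>n. m (Complex 1 t) * F (Complex 1 t) n) \<le> K * calderon_nrm F"
      using nrm_line_le_calderon_nrm(2)[OF F, of t] K[OF Complex_line_in_strip(2)] K0
        nrm_ell_1_nonneg[OF calderon_line_elems(2)[OF F, of t]]
      by (auto simp: ell_1_scale[OF calderon_line_elems(2)[OF F]] intro!: mult_mono)
  qed
qed

section \<open>Dividing and multiplying by a function with a simple zero\<close>

text \<open>Equations \<open>z = 1/2\<close> should keep this shape instead of becoming
  \<open>z * 2 = 1\<close>, as they decide the cases of \<open>divided\<close>.\<close>

declare eq_divide_eq_numeral1(1) [simp del]

lemma norm_line_minus_half:
  "1/2 \<le> cmod (Complex 0 t - 1/2)" "1/2 \<le> cmod (Complex 1 t - 1/2)"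
  using abs_Re_le_cmod[of "Complex 0 t - 1/2"] abs_Re_le_cmod[of "Complex 1 t - 1/2"] by simp_all

text \<open>The value at \<open>1/2\<close> removes the singularity when \<open>F\<close> vanishes
  there. Off the strip the quotient stays \<open>0\<close> for \<open>F\<close> in the Calderon
  space.\<close>

definition divided :: "(complex \<Rightarrow> cseq) \<Rightarrow> complex \<Rightarrow> cseq" where
  "divided F z n = (if z = 1/2 then deriv (\<lambda>z. F z n) (1/2) else F z n / (z - 1/2))"

lemma divided_off_half:
  assumes "z \<noteq> 1/2"
  shows "divided F z = (\<lambda>n. inverse (z - 1/2) * F z n)"
proof
  fix n
  have "divided F z n = F z n / (z - 1/2)" using assms by (simp add: divided_def)
  also have "\<dots> = inverse (z - 1/2) * F z n" by (rule divide_inverse_commute)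
  finally show "divided F z n = inverse (z - 1/2) * F z n" .
qed

lemma divided_line:
  assumes "x = 0 \<or> x = 1"
  shows "divided F (Complex x t) = (\<lambda>n. inverse (Complex x t - 1/2) * F (Complex x t) n)"
proof -
  have "Complex x t \<noteq> 1/2" using assms by (auto simp: complex_eq_iff)
  thus ?thesis by (rule divided_off_half)
qed

lemma divided_holomorphic:
  assumes "F \<in> calderon_C" "F (1/2) = (\<lambda>n. 0)"
  shows "(\<lambda>z. divided F z n) holomorphic_on open_strip"
proof -
  have "(\<lambda>z. F z n) holomorphic_on open_strip" using assms(1) calderon_iff by blast
  from pole_lemma_open[OF this open_open_strip, of "1/2"] show ?thesis
    by (simp add: divided_def assms(2) cong: if_cong)
qed

text \<open>Outside the disc of radius \<open>1/4\<close> about the midpoint the divisor costs a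
  factor \<open>4\<close>; the maximum modulus principle carries this bound into the disc. The norm
  only sees the boundary lines, at distance at least \<open>1/2\<close> from the midpoint, whence
  the factor \<open>2\<close>.\<close>

lemma divided_in_calderon:
  assumes F: "F \<in> calderon_C" and F0: "F (1/2) = (\<lambda>n. 0)"
  shows "divided F \<in> calderon_C" and "calderon_nrm (divided F) \<le> 2 * calderon_nrm F"
proof -
  obtain B where B: "\<And>z n. z \<in> strip \<Longrightarrow> cmod (F z n) \<le> B" using F calderon_iff by blast
  note Fp = F[unfolded calderon_iff]
  note hol = divided_holomorphic[OF F F0]
  have B0: "B \<ge> 0" using B[OF half_in_strip] norm_ge_zero order_trans by blast
  have far: "cmod (divided F z n) \<le> 4 * B" if "z \<in> strip" "cmod (z - 1/2) \<ge> 1/4" for z n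
  proof -
    have "cmod (F z n) / cmod (z - 1/2) \<le> B / (1/4)"
      using that B B0 by (intro frac_le) auto
    moreover have "z \<noteq> 1/2" using that by auto
    ultimately show ?thesis by (simp add: divided_def norm_divide)
  qed
  have bound: "cmod (divided F z n) \<le> 4 * B" if z: "z \<in> strip" for z n
  proof (cases "cmod (z - 1/2) \<ge> 1/4")
    case True thus ?thesis using far z by blast
  next
    case False
    show ?thesis
    proof (rule maximum_modulus_frontier[of "\<lambda>z. divided F z n" "cball (1/2) (1/4)"])
      show "(\<lambda>z. divided F z n) holomorphic_on interior (cball (1/2) (1/4))"
        using hol cball_half_subset_open_strip interior_subset
        by (blast intro: holomorphic_on_subset)
      show "continuous_on (closure (cball (1/2) (1/4))) (\<lambda>z. divided F z n)"
        using holomorphic_on_imp_continuous_on[OF holomorphic_on_subset[OF hol cball_half_subset_open_strip]]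
        by simp
      show "z \<in> cball (1/2) (1/4)" using False by (simp add: dist_norm norm_minus_commute)
      fix w :: complex assume "w \<in> frontier (cball (1/2) (1/4))"
      hence w: "cmod (w - 1/2) = 1/4" by (simp add: frontier_cball dist_norm norm_minus_commute)
      hence "w \<in> cball (1/2) (1/4)" by (simp add: dist_norm norm_minus_commute)
      hence "w \<in> strip" using cball_half_subset_open_strip open_strip_subset by blast
      thus "cmod (divided F w n) \<le> 4 * B" using far w by simp
    qed simp
  qed
  \<comment> \<open>At the midpoint continuity comes from bounded holomorphy; elsewhere
    \<open>divided F\<close> is \<open>F\<close> times a scalar function that is continuous
    there.\<close>
  have cont: "uniform_limit UNIV (divided F) (divided F z) (at z within strip)" if z: "z \<in> strip" for z
  proof (cases "z = 1/2")
    case True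
    have "uniform_limit UNIV (divided F) (divided F z) (at z)"
      by (rule holomorphic_uniform_continuity[OF open_open_strip, where B = "4 * B"])
        (use True half_in_open_strip hol bound open_strip_subset in auto)
    thus ?thesis by (rule filterlim_mono) (auto simp: at_le)
  next
    case False
    have "uniform_limit UNIV (\<lambda>w n. inverse (w - 1/2) * F w n) (\<lambda>n. inverse (z - 1/2) * F z n) (at z within strip)"
    proof (rule uniform_lim_mult)
      show "uniform_limit UNIV (\<lambda>w n. inverse (w - 1/2)) (\<lambda>n. inverse (z - 1/2)) (at z within strip)"
        using False by (intro uniform_limit_const_arg tendsto_intros) auto
      show "uniform_limit UNIV F (F z) (at z within strip)" using Fp z by blast
      show "bounded (range (F z))" using B[OF z] by (rule bounded_rangeI)
      show "bounded (range (\<lambda>n. inverse (z - 1/2)))" by (rule bounded_rangeI) (rule order_refl)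
    qed
    moreover have "\<forall>\<^sub>F w in at z within strip. \<forall>n\<in>UNIV. inverse (w - 1/2) * F w n = divided F w n"
      using eventually_neq_at_within[of "1/2" z strip]
      by eventually_elim (simp add: divided_off_half)
    ultimately have "uniform_limit UNIV (divided F) (\<lambda>n. inverse (z - 1/2) * F z n) (at z within strip)"
      by (subst (asm) uniform_limit_cong) auto
    moreover have "(\<lambda>n. inverse (z - 1/2) * F z n) = divided F z"
      using False by (simp add: divided_off_half)
    ultimately show ?thesis by simp
  qed
  have inv: "cmod (inverse (Complex 0 t - 1/2)) \<le> 2" "cmod (inverse (Complex 1 t - 1/2)) \<le> 2" for t
    using norm_line_minus_half[of t] le_imp_inverse_le[of "1/2"] by (auto simp: norm_inverse)
  have v0: "uniform_limit UNIV (\<lambda>t. divided F (Complex 0 t)) (\<lambda>n. 0) at_infinity"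
  proof (rule uniform_limit_null_comparison)
    show "\<forall>\<^sub>F t in at_infinity. \<forall>n\<in>UNIV.
        norm (divided F (Complex 0 t) n) \<le> 2 * norm (F (Complex 0 t) n)"
      using inv(1) by (auto simp: divided_line norm_mult intro!: mult_right_mono always_eventually)
    have "uniform_limit UNIV (\<lambda>t. F (Complex 0 t)) (\<lambda>n. 0) at_infinity" using Fp by blast
    from uniform_limit_norm[OF this]
    have "uniform_limit UNIV (\<lambda>t n. 2 * norm (F (Complex 0 t) n)) (\<lambda>n. 2 * norm (0::complex)) at_infinity"
      by (rule bounded_linear.uniform_limit[OF bounded_linear_mult_right])
    thus "uniform_limit UNIV (\<lambda>t n. 2 * norm (F (Complex 0 t) n)) (\<lambda>n. 0) at_infinity" by simp
  qed
  have v1: "vanishing_curve ell_1 (\<lambda>t. divided F (Complex 1 t))"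
    unfolding divided_line[of 1, simplified]
  proof (rule vanishing_curve_ell_1_mult)
    show "vanishing_curve ell_1 (\<lambda>t. F (Complex 1 t))" using Fp by blast
    show "isCont (\<lambda>t. inverse (Complex 1 t - 1/2)) t" for t
    proof -
      have "Complex 1 t - 1/2 \<noteq> 0" by (auto simp: complex_eq_iff)
      thus ?thesis unfolding isCont_def by (intro tendsto_intros)
    qed
  qed (use inv in auto)
  have "\<forall>z. z \<notin> strip \<longrightarrow> divided F z = (\<lambda>n. 0)"
    using Fp half_in_strip by (auto simp: divided_def fun_eq_iff)
  thus D: "divided F \<in> calderon_C"
    unfolding calderon_iff using bound cont hol v0 v1 by blast
  show "calderon_nrm (divided F) \<le> 2 * calderon_nrm F"
  proof (rule calderon_nrm_le[OF D])
    fix t n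
    have "cmod (F (Complex 0 t) n) \<le> calderon_nrm F"
      using norm_le_nrm_ell_infty[OF calderon_line_elems(1)[OF F]] nrm_line_le_calderon_nrm(1)[OF F]
      by (rule order_trans)
    thus "cmod (divided F (Complex 0 t) n) \<le> 2 * calderon_nrm F"
      using inv(1)[of t] by (simp add: divided_line norm_mult mult_mono)
  next
    fix t
    have "nrm ell_1 (divided F (Complex 1 t)) = cmod (inverse (Complex 1 t - 1/2)) * nrm ell_1 (F (Complex 1 t))"
      by (simp add: divided_line ell_1_scale(2)[OF calderon_line_elems(2)[OF F]])
    also have "\<dots> \<le> 2 * calderon_nrm F"
      by (intro mult_mono inv nrm_line_le_calderon_nrm F nrm_ell_1_nonneg calderon_line_elems) simp
    finally show "nrm ell_1 (divided F (Complex 1 t)) \<le> 2 * calderon_nrm F" .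
  qed
qed

text \<open>The first derivative is \<open>g z + (z - a) * deriv g z\<close>, and both summands
  contribute \<open>deriv g a\<close> to its derivative at \<open>a\<close>. The resulting
  \<open>2\<close> cancels the denominator in \<open>Delta_2\<close>.\<close>

lemma deriv2_linear_factor:
  assumes "open U" "a \<in> U" "g holomorphic_on U"
  shows "deriv (deriv (\<lambda>z. (z - a) * g z)) a = 2 * deriv g a"
proof -
  have D: "((\<lambda>z. (z - a) * g z) has_field_derivative g z + (z - a) * deriv g z) (at z)" if "z \<in> U" for z
    using holomorphic_derivI[OF assms(3,1) that] by (auto intro!: derivative_eq_intros)
  have "\<forall>\<^sub>F z in nhds a. z \<in> U" using assms by (intro eventually_nhds_in_open)
  hence "\<forall>\<^sub>F z in nhds a. deriv (\<lambda>z. (z - a) * g z) z = g z + (z - a) * deriv g z"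
    by eventually_elim (rule DERIV_imp_deriv[OF D])
  hence "deriv (deriv (\<lambda>z. (z - a) * g z)) a = deriv (\<lambda>z. g z + (z - a) * deriv g z) a"
    by (rule deriv_cong_ev) simp
  also have "\<dots> = 2 * deriv g a"
  proof (rule DERIV_imp_deriv)
    have "deriv g holomorphic_on U" using assms by (intro holomorphic_deriv)
    from holomorphic_derivI[OF this assms(1,2)] holomorphic_derivI[OF assms(3,1,2)]
    show "((\<lambda>z. g z + (z - a) * deriv g z) has_field_derivative 2 * deriv g a) (at a)"
      by (auto intro!: derivative_eq_intros)
  qed
  finally show ?thesis .
qed

lemma Delta_1_divided:
  assumes F: "F \<in> calderon_C" and F0: "F (1/2) = (\<lambda>n. 0)"
  shows "Delta ell_infty ell_1 1 (divided F) = Delta ell_infty ell_1 2 F"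
proof
  fix n
  have "(\<lambda>z. F z n) = (\<lambda>z. (z - 1/2) * divided F z n)"
    by (auto simp: divided_def F0)
  hence "deriv (deriv (\<lambda>z. F z n)) (1/2) = 2 * deriv (\<lambda>z. divided F z n) (1/2)"
    using deriv2_linear_factor[OF open_open_strip half_in_open_strip divided_holomorphic[OF F F0]]
    by simp
  thus "Delta ell_infty ell_1 1 (divided F) n = Delta ell_infty ell_1 2 F n"
    unfolding Delta_1[OF divided_in_calderon(1)[OF F F0]] Delta_2[OF F] by simp
qed

text \<open>Value \<open>1\<close> and derivative \<open>0\<close> at the midpoint leave first-order
  data there unchanged, while the decay along vertical lines makes products with bounded functions
  vanish at infinity and absorbs polynomial growth.\<close>

definition gauss :: "complex \<Rightarrow> complex" where
  "gauss z = exp ((z - 1/2)\<^sup>2)"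

lemma gauss_half [simp]: "gauss (1/2) = 1"
  by (simp add: gauss_def)

lemma gauss_holomorphic: "gauss holomorphic_on A"
  unfolding gauss_def by (intro holomorphic_intros)

lemma gauss_has_derivative_0: "(gauss has_field_derivative 0) (at (1/2))"
  unfolding gauss_def by (auto intro!: derivative_eq_intros)

text \<open>On the strip the real part of \<open>(z - 1/2)^2\<close> is at most
  \<open>1/4 - (Im z)^2\<close>, and \<open>exp (1/4)\<close> is below \<open>2\<close>.\<close>

lemma norm_gauss_le:
  assumes "z \<in> strip"
  shows "cmod (gauss z) \<le> 2 * exp (- (Im z)\<^sup>2)"
proof -
  have "\<bar>Re z - 1/2\<bar> \<le> 1/2" using assms unfolding strip_def abs_le_iff by auto
  hence "(Re z - 1/2)\<^sup>2 \<le> (1/2)\<^sup>2" using abs_le_square_iff[of "Re z - 1/2" "1/2"] by simp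
  hence "Re ((z - 1/2)\<^sup>2) \<le> 1/4 - (Im z)\<^sup>2" by (simp add: power2_eq_square)
  hence "cmod (gauss z) \<le> exp (1/4 - (Im z)\<^sup>2)" by (simp add: gauss_def)
  also have "\<dots> = exp (1/4) * exp (- (Im z)\<^sup>2)" by (simp flip: exp_add)
  also have "\<dots> \<le> 2 * exp (- (Im z)\<^sup>2)"
    using exp_bound[of "1/4"] by (intro mult_right_mono) (auto simp: power2_eq_square)
  finally show ?thesis .
qed

lemma norm_gauss_le_2: "z \<in> strip \<Longrightarrow> cmod (gauss z) \<le> 2"
  using norm_gauss_le[of z] exp_le_one_iff[of "- (Im z)\<^sup>2"] by (smt (verit) zero_le_power2)

text \<open>The decay absorbs the linear growth:
  \<open>cmod (z - 1/2) \<le> 1 + v^2 \<le> exp (v^2)\<close>.\<close>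

lemma norm_linear_gauss_le_2:
  assumes z: "z \<in> strip"
  shows "cmod ((z - 1/2) * gauss z) \<le> 2"
proof -
  define v where "v = Im z"
  have "\<bar>Re z - 1/2\<bar> \<le> 1/2" using z unfolding strip_def abs_le_iff by auto
  hence "(Re z - 1/2)\<^sup>2 \<le> (1/2)\<^sup>2" using abs_le_square_iff[of "Re z - 1/2" "1/2"] by simp
  moreover have "(cmod (z - 1/2))\<^sup>2 = (Re z - 1/2)\<^sup>2 + v\<^sup>2" by (simp add: cmod_power2 v_def)
  moreover have "(1 + v\<^sup>2)\<^sup>2 = 1 + 2 * v\<^sup>2 + (v\<^sup>2)\<^sup>2" by (simp add: power2_sum)
  moreover have "(1/2 :: real)\<^sup>2 \<le> 1" by (simp add: power2_eq_square)
  ultimately have "(cmod (z - 1/2))\<^sup>2 \<le> (1 + v\<^sup>2)\<^sup>2"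
    using zero_le_power2[of v] zero_le_power2[of "v\<^sup>2"] by linarith
  hence "cmod (z - 1/2) \<le> 1 + v\<^sup>2" by (rule power2_le_imp_le) simp
  also have "\<dots> \<le> exp (v\<^sup>2)" by (rule exp_ge_add_one_self)
  finally have "cmod (z - 1/2) * cmod (gauss z) \<le> exp (v\<^sup>2) * (2 * exp (- v\<^sup>2))"
    using norm_gauss_le[OF z] by (intro mult_mono) (auto simp: v_def)
  also have "\<dots> = 2" by (simp flip: exp_add)
  finally show ?thesis by (simp add: norm_mult)
qed

lemma Delta_2_linear_gauss:
  assumes G: "G \<in> calderon_C"
  defines "F \<equiv> \<lambda>z n. ((z - 1/2) * gauss z) * G z n"
  shows "F \<in> ker_Delta ell_infty ell_1 0" "calderon_nrm F \<le> 2 * calderon_nrm G"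
    "Delta ell_infty ell_1 2 F = Delta ell_infty ell_1 1 G"
proof -
  have hol: "(\<lambda>z. (z - 1/2) * gauss z) holomorphic_on A" for A
    by (intro holomorphic_intros gauss_holomorphic)
  note M = calderon_mult[OF G holomorphic_on_imp_continuous_on[OF hol] hol norm_linear_gauss_le_2]
  have FC: "F \<in> calderon_C" unfolding F_def by (rule M)
  show "calderon_nrm F \<le> 2 * calderon_nrm G" unfolding F_def by (rule M)
  show "F \<in> ker_Delta ell_infty ell_1 0" using FC by (simp add: ker_Delta_def Delta_0 F_def)
  have holG: "(\<lambda>z. G z n) holomorphic_on open_strip" for n using G calderon_iff by blast
  have "deriv (deriv (\<lambda>z. F z n)) (1/2) = 2 * deriv (\<lambda>z. G z n) (1/2)" for n
  proof -
    \<comment> \<open>The Gaussian is grouped with \<open>G\<close>, so that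
      \<open>deriv2_linear_factor\<close> applies; its zero derivative at the midpoint then removes
      it.\<close>
    have "deriv (deriv (\<lambda>z. (z - 1/2) * (gauss z * G z n))) (1/2) = 2 * deriv (\<lambda>z. gauss z * G z n) (1/2)"
      by (intro deriv2_linear_factor[OF open_open_strip half_in_open_strip] holomorphic_on_mult
          gauss_holomorphic holG)
    also have "deriv (\<lambda>z. gauss z * G z n) (1/2) = deriv (\<lambda>z. G z n) (1/2)"
      using DERIV_mult[OF gauss_has_derivative_0 holomorphic_derivI[OF holG open_open_strip half_in_open_strip]]
      by (intro DERIV_imp_deriv) simp
    finally show ?thesis by (simp add: F_def mult.assoc)
  qed
  thus "Delta ell_infty ell_1 2 F = Delta ell_infty ell_1 1 G"
    unfolding Delta_1[OF G] Delta_2[OF FC] by simp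
qed

text \<open>If each representative can be replaced at cost \<open>C\<close> by one for the other
  operator, the quotient norms compare with the same \<open>C\<close>. Nonnegativity of the Calderon
  norm bounds the infimum from below.\<close>

lemma Delta_image_mono:
  assumes "K \<subseteq> calderon_C" "C > 0" "x \<in> elems (Delta_image ell_infty ell_1 j K)"
    and L: "L \<subseteq> calderon_C"
    and step: "\<And>F. F \<in> K \<Longrightarrow> \<exists>G\<in>L. Delta ell_infty ell_1 k G = Delta ell_infty ell_1 j F \<and>
      calderon_nrm G \<le> C * calderon_nrm F"
  shows "x \<in> elems (Delta_image ell_infty ell_1 k L)"
    and "nrm (Delta_image ell_infty ell_1 k L) x \<le> C * nrm (Delta_image ell_infty ell_1 j K) x"
proof -
  obtain F0 where F0: "F0 \<in> K" "Delta ell_infty ell_1 j F0 = x"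
    using assms(3) by (auto simp: Delta_image_def)
  show "x \<in> elems (Delta_image ell_infty ell_1 k L)"
    using step[OF F0(1)] F0(2) by (force simp: Delta_image_def)
  define N where "N = (\<lambda>i M. {calderon_nrm F | F. F \<in> M \<and> Delta ell_infty ell_1 i F = x})"
  have "Inf (N k L) / C \<le> Inf (N j K)"
  proof (rule cInf_greatest)
    show "N j K \<noteq> {}" using F0 by (auto simp: N_def)
    fix a assume "a \<in> N j K"
    then obtain F where F: "F \<in> K" "Delta ell_infty ell_1 j F = x" "a = calderon_nrm F"
      by (auto simp: N_def)
    then obtain G where G: "G \<in> L" "Delta ell_infty ell_1 k G = x" "calderon_nrm G \<le> C * a"
      using step by metis
    have "bdd_below (N k L)"
      using L calderon_nrm_nonneg by (intro bdd_belowI[of _ 0]) (auto simp: N_def)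
    moreover have "calderon_nrm G \<in> N k L" using G by (auto simp: N_def)
    ultimately have "Inf (N k L) \<le> C * a" using G(3) cInf_lower order_trans by blast
    thus "Inf (N k L) / C \<le> a" using \<open>C > 0\<close> by (simp add: field_simps)
  qed
  thus "nrm (Delta_image ell_infty ell_1 k L) x \<le> C * nrm (Delta_image ell_infty ell_1 j K) x"
    using \<open>C > 0\<close> by (simp add: Delta_image_def N_def field_simps)
qed

lemma same_spaceI:
  assumes "c > 0" "C > 0"
    and "\<And>x. x \<in> elems X \<Longrightarrow> x \<in> elems Y \<and> nrm Y x \<le> C * nrm X x"
    and "\<And>x. x \<in> elems Y \<Longrightarrow> x \<in> elems X \<and> nrm X x \<le> c * nrm Y x"
  shows "same_space X Y"
  unfolding same_space_def
proof
  show "elems X = elems Y" using assms(3,4) by blast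
  have "1/c * nrm X x \<le> nrm Y x \<and> nrm Y x \<le> C * nrm X x" if "x \<in> elems X" for x
  proof -
    have "nrm X x \<le> c * nrm Y x" using assms(3,4) that by blast
    thus ?thesis using assms(1,3) that by (simp add: field_simps)
  qed
  moreover have "1/c > 0" using \<open>c > 0\<close> by simp
  ultimately show "\<exists>c>0. \<exists>C>0. \<forall>x\<in>elems X. c * nrm X x \<le> nrm Y x \<and> nrm Y x \<le> C * nrm X x"
    using \<open>C > 0\<close> by blast
qed

lemma same_space_Delta_2_Delta_1:
  "same_space (Delta_image ell_infty ell_1 2 (ker_Delta ell_infty ell_1 0))
     (Delta_image ell_infty ell_1 1 calderon_C)"
proof -
  have ker: "ker_Delta ell_infty ell_1 0 \<subseteq> calderon_C" by (auto simp: ker_Delta_def)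
  have 1: "\<exists>G\<in>calderon_C. Delta ell_infty ell_1 1 G = Delta ell_infty ell_1 2 F \<and>
      calderon_nrm G \<le> 2 * calderon_nrm F" if "F \<in> ker_Delta ell_infty ell_1 0" for F
  proof -
    have F: "F \<in> calderon_C" "F (1/2) = (\<lambda>n. 0)" using that by (auto simp: ker_Delta_def Delta_0)
    show ?thesis
      by (rule bexI[of _ "divided F"]) (use divided_in_calderon[OF F] Delta_1_divided[OF F] in auto)
  qed
  have 2: "\<exists>F\<in>ker_Delta ell_infty ell_1 0. Delta ell_infty ell_1 2 F = Delta ell_infty ell_1 1 G \<and>
      calderon_nrm F \<le> 2 * calderon_nrm G" if "G \<in> calderon_C" for G
    using Delta_2_linear_gauss[OF that] by blast
  show ?thesis
  proof (rule same_spaceI[where c = 2 and C = 2])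
    fix x assume "x \<in> elems (Delta_image ell_infty ell_1 2 (ker_Delta ell_infty ell_1 0))"
    from Delta_image_mono[OF ker _ this order_refl 1]
    show "x \<in> elems (Delta_image ell_infty ell_1 1 calderon_C) \<and>
      nrm (Delta_image ell_infty ell_1 1 calderon_C) x
        \<le> 2 * nrm (Delta_image ell_infty ell_1 2 (ker_Delta ell_infty ell_1 0)) x" by simp
  next
    fix x assume "x \<in> elems (Delta_image ell_infty ell_1 1 calderon_C)"
    from Delta_image_mono[OF order_refl _ this ker 2]
    show "x \<in> elems (Delta_image ell_infty ell_1 2 (ker_Delta ell_infty ell_1 0)) \<and>
      nrm (Delta_image ell_infty ell_1 2 (ker_Delta ell_infty ell_1 0)) x
        \<le> 2 * nrm (Delta_image ell_infty ell_1 1 calderon_C) x" by simp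
  qed simp_all
qed

section \<open>Derivatives at the midpoint lie in the dual\<close>

text \<open>A Phragmen-Lindelof argument: the factor \<open>exp (e * (z^2 - 1))\<close> has modulus
  at most \<open>1\<close> on the strip and decays vertically, so on a tall rectangle only the
  vertical sides matter for the maximum modulus principle. Then \<open>e\<close> tends to
  \<open>0\<close>.\<close>

lemma strip_maximum_principle:
  assumes cont: "continuous_on strip H" and hol: "H holomorphic_on open_strip"
    and B: "\<And>z. z \<in> strip \<Longrightarrow> cmod (H z) \<le> B"
    and A0: "\<And>t. cmod (H (Complex 0 t)) \<le> A" and A1: "\<And>t. cmod (H (Complex 1 t)) \<le> A"
    and z: "z \<in> strip"
  shows "cmod (H z) \<le> A"
proof -
  define E where "E = (\<lambda>e z. exp (of_real e * (z\<^sup>2 - 1)) :: complex)"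
  have normE: "cmod (E e w) \<le> exp (- e * (Im w)\<^sup>2)" if "w \<in> strip" "e > 0" for e w
  proof -
    have "(Re w)\<^sup>2 \<le> 1\<^sup>2" using that by (intro power_mono) (auto simp: strip_def)
    hence "e * ((Re w)\<^sup>2 - (Im w)\<^sup>2 - 1) \<le> e * (- (Im w)\<^sup>2)" using that by (intro mult_left_mono) auto
    thus ?thesis by (simp add: E_def power2_eq_square[of w] power2_eq_square[of "Re w"] power2_eq_square[of "Im w"])
  qed
  have A: "A \<ge> 0" using A0[of 0] norm_ge_zero order_trans by blast
  \<comment> \<open>The slack \<open>e\<close> keeps the right-hand side positive even for
    \<open>A = 0\<close>, so a large \<open>R\<close> pushes the horizontal sides below it.\<close>
  have main: "cmod (H z) * cmod (E e z) \<le> A + e" if e: "e > 0" for e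
  proof -
    have "((\<lambda>R. B * exp (- e * R\<^sup>2)) \<longlongrightarrow> 0) at_top" using e by real_asymp
    hence "\<forall>\<^sub>F R in at_top. B * exp (- e * R\<^sup>2) < A + e" by (rule order_tendstoD(2)) (use A e in simp)
    moreover have "\<forall>\<^sub>F R in at_top. R > \<bar>Im z\<bar>" by (rule eventually_gt_at_top)
    ultimately have "\<forall>\<^sub>F R in at_top. B * exp (- e * R\<^sup>2) < A + e \<and> R > \<bar>Im z\<bar>" by (rule eventually_conj)
    then obtain R where R: "B * exp (- e * R\<^sup>2) < A + e" "R > \<bar>Im z\<bar>"
      using eventually_happens[of _ "at_top :: real filter"] by auto
    define S where "S = cbox (Complex 0 (-R)) (Complex 1 R)"
    have S: "w \<in> S \<longleftrightarrow> w \<in> strip \<and> \<bar>Im w\<bar> \<le> R" for w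
      by (auto simp: S_def in_cbox_complex_iff strip_def)
    have "interior S \<subseteq> open_strip" by (auto simp: S_def interior_cbox in_box_complex_iff open_strip_def)
    have "cmod (H z * E e z) \<le> A + e"
    proof (rule maximum_modulus_frontier[of "\<lambda>z. H z * E e z" S])
      show "(\<lambda>z. H z * E e z) holomorphic_on interior S"
        unfolding E_def by (intro holomorphic_intros holomorphic_on_subset[OF hol]) fact
      show "continuous_on (closure S) (\<lambda>z. H z * E e z)"
        unfolding E_def S_def closure_cbox
        by (intro continuous_intros continuous_on_subset[OF cont]) (use S S_def in auto)
      show "bounded S" by (simp add: S_def)
      show "z \<in> S" using z R by (simp add: S)
      fix w assume w: "w \<in> frontier S"
      hence wS: "w \<in> S" and "w \<notin> box (Complex 0 (-R)) (Complex 1 R)"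
        by (auto simp: frontier_def S_def interior_cbox)
      hence cases: "Re w = 0 \<or> Re w = 1 \<or> \<bar>Im w\<bar> = R"
        by (auto simp: S strip_def in_box_complex_iff)
      have ws: "w \<in> strip" using wS S by blast
      have E1: "cmod (E e w) \<le> 1" using normE[OF ws e] e by (rule_tac order_trans) auto
      show "cmod (H w * E e w) \<le> A + e"
      proof (cases "\<bar>Im w\<bar> = R")
        case True
        hence "(Im w)\<^sup>2 = R\<^sup>2" using power2_abs by metis
        hence "cmod (H w * E e w) \<le> B * exp (- e * R\<^sup>2)"
          unfolding norm_mult using B[OF ws] normE[OF ws e] norm_ge_zero order_trans[OF norm_ge_zero B[OF ws]]
          by (intro mult_mono) auto
        thus ?thesis using R by simp
      next
        case False
        hence "w = Complex 0 (Im w) \<or> w = Complex 1 (Im w)" using cases by (auto simp: complex_eq_iff)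
        hence "cmod (H w) \<le> A" using A0[of "Im w"] A1[of "Im w"] by metis
        hence "cmod (H w * E e w) \<le> A * 1"
          unfolding norm_mult using E1 A by (intro mult_mono) auto
        thus ?thesis using e by simp
      qed
    qed
    thus ?thesis by (simp add: norm_mult)
  qed
  have "((\<lambda>e. cmod (H z) * cmod (E e z)) \<longlongrightarrow> cmod (H z) * cmod (E 0 z)) (at_right 0)"
    unfolding E_def by (intro tendsto_intros)
  moreover have "((\<lambda>e. A + e) \<longlongrightarrow> A + 0) (at_right 0)" by (intro tendsto_intros)
  moreover have "\<forall>\<^sub>F e in at_right 0. cmod (H z) * cmod (E e z) \<le> A + e"
    using main by (auto simp: eventually_at_right_less eventually_at_filter)
  ultimately have "cmod (H z) * cmod (E 0 z) \<le> A + 0"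
    by (intro tendsto_le[of "at_right (0::real)"]) auto
  thus ?thesis by (simp add: E_def)
qed

text \<open>The weights \<open>g\<close> are an analytic family with \<open>g = x\<close> at \<open>1/2\<close>, of modulus \<open>\<bar>x\<bar>\<^sup>2\<close> on the left
  boundary line and \<open>1\<close> on the right one; so \<open>\<Sum>n. F z n * g z n\<close> is bounded on both lines.\<close>

lemma calderon_pairing_bounds:
  assumes F: "F \<in> calderon_C" and K: "K \<ge> 1" and x: "(\<Sum>n<M. (cmod (x n))\<^sup>2) \<le> K"
  shows "cmod (\<Sum>n<M. F (1/2) n * x n) \<le> K * calderon_nrm F"
    and "cmod (\<Sum>n<M. deriv (\<lambda>z. F z n) (1/2) * x n - 2 * (F (1/2) n * (x n * ln (cmod (x n)))))
      \<le> 4 * (K * calderon_nrm F)"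
proof -
  define A where "A = calderon_nrm F"
  have A0: "A \<ge> 0" using calderon_nrm_nonneg[OF F] by (simp add: A_def)
  obtain B where B: "\<And>z n. z \<in> strip \<Longrightarrow> cmod (F z n) \<le> B" using F calderon_iff by blast
  note Fp = F[unfolded calderon_iff]
  have hol: "(\<lambda>z. F z n) holomorphic_on open_strip" for n using Fp by blast
  define l where "l = (\<lambda>n. ln (cmod (x n)))"
  \<comment> \<open>This is \<open>x |x|^(1 - 2z)\<close> in exponential form. Where
    \<open>x n = 0\<close> the leading factor makes it \<open>0\<close>, so \<open>g1\<close> below
    is only an inequality.\<close>
  define g where "g = (\<lambda>z n. x n * exp ((1 - 2 * z) * of_real (l n)))"
  define H where "H = (\<lambda>z. \<Sum>n<M. F z n * g z n)"
  have normg: "cmod (g z n) = cmod (x n) * exp ((1 - 2 * Re z) * l n)" for z n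
    by (simp add: g_def norm_mult)
  have g0: "cmod (g (Complex 0 t) n) = (cmod (x n))\<^sup>2" for t n
    by (cases "x n = 0") (auto simp: normg l_def power2_eq_square)
  have g1: "cmod (g (Complex 1 t) n) \<le> 1" for t n
    by (cases "x n = 0") (auto simp: normg l_def exp_minus)
  have cont: "continuous_on strip H"
    unfolding H_def g_def
  proof (intro continuous_intros)
    fix n
    show "continuous_on strip (\<lambda>z. F z n)"
      unfolding continuous_on_def using Fp by (auto intro: tendsto_uniform_limitI)
  qed
  have holH: "H holomorphic_on open_strip"
    unfolding H_def g_def by (intro holomorphic_intros hol)
  \<comment> \<open>This bound depends on \<open>x\<close> and \<open>M\<close>; it only supplies
    the boundedness that the maximum principle presupposes.\<close>
  have bd: "cmod (H z) \<le> (\<Sum>n<M. B * (cmod (x n) * exp \<bar>l n\<bar>))" if z: "z \<in> strip" for z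
    unfolding H_def
  proof (rule sum_norm_le)
    fix n
    have "\<bar>1 - 2 * Re z\<bar> \<le> 1" using z by (auto simp: strip_def abs_le_iff)
    hence "\<bar>(1 - 2 * Re z) * l n\<bar> \<le> 1 * \<bar>l n\<bar>" unfolding abs_mult by (intro mult_right_mono) auto
    hence "cmod (g z n) \<le> cmod (x n) * exp \<bar>l n\<bar>"
      unfolding normg by (intro mult_left_mono) auto
    thus "cmod (F z n * g z n) \<le> B * (cmod (x n) * exp \<bar>l n\<bar>)"
      unfolding norm_mult using B[OF z] order_trans[OF norm_ge_zero B[OF z]]
      by (intro mult_mono) auto
  qed
  have line0: "cmod (H (Complex 0 t)) \<le> K * A" for t
  proof -
    have "cmod (H (Complex 0 t)) \<le> (\<Sum>n<M. A * (cmod (x n))\<^sup>2)"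
      unfolding H_def
    proof (rule sum_norm_le)
      fix n
      have "cmod (F (Complex 0 t) n) \<le> A"
        using norm_le_nrm_ell_infty[OF calderon_line_elems(1)[OF F]] nrm_line_le_calderon_nrm(1)[OF F]
        unfolding A_def by (rule order_trans)
      thus "cmod (F (Complex 0 t) n * g (Complex 0 t) n) \<le> A * (cmod (x n))\<^sup>2"
        by (simp add: norm_mult g0 mult_right_mono)
    qed
    also have "\<dots> \<le> A * K" unfolding sum_distrib_left[symmetric] by (intro mult_left_mono x A0)
    finally show ?thesis by (simp add: mult.commute)
  qed
  have line1: "cmod (H (Complex 1 t)) \<le> K * A" for t
  proof -
    have "cmod (H (Complex 1 t)) \<le> (\<Sum>n<M. cmod (F (Complex 1 t) n))"
      unfolding H_def
    proof (rule sum_norm_le)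
      fix n
      show "cmod (F (Complex 1 t) n * g (Complex 1 t) n) \<le> cmod (F (Complex 1 t) n)"
        using mult_left_mono[OF g1, of "cmod (F (Complex 1 t) n)"] by (simp add: norm_mult)
    qed
    also have "\<dots> \<le> nrm ell_1 (F (Complex 1 t))"
      by (rule sum_le_nrm_ell_1[OF calderon_line_elems(2)[OF F]])
    also have "\<dots> \<le> A" unfolding A_def by (rule nrm_line_le_calderon_nrm[OF F])
    \<comment> \<open>\<open>K \<ge> 1\<close> brings the right line under the bound of the left
      one.\<close>
    also have "\<dots> \<le> K * A" using mult_right_mono[OF K A0] by simp
    finally show ?thesis .
  qed
  have Hle: "cmod (H z) \<le> K * A" if "z \<in> strip" for z
    by (rule strip_maximum_principle[OF cont holH bd line0 line1 that])
  have ghalf: "g (1/2) n = x n" for n by (simp add: g_def)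
  show "cmod (\<Sum>n<M. F (1/2) n * x n) \<le> K * calderon_nrm F"
    using Hle[OF half_in_strip] by (simp add: H_def ghalf A_def)
  \<comment> \<open>The circle of radius \<open>1/4\<close> about the midpoint gives the factor
    \<open>4\<close>.\<close>
  have "cmod ((deriv ^^ 1) H (1/2)) \<le> fact 1 * (K * A) / (1/4)^1"
  proof (rule Cauchy_inequality)
    show "H holomorphic_on ball (1/2) (1/4)"
      using holH cball_half_subset_open_strip ball_subset_cball by (blast intro: holomorphic_on_subset)
    show "continuous_on (cball (1/2) (1/4)) H"
      using cont cball_half_subset_open_strip open_strip_subset by (blast intro: continuous_on_subset)
    fix w :: complex assume "cmod (1/2 - w) = 1/4"
    hence "w \<in> cball (1/2) (1/4)" by (simp add: dist_norm)
    thus "cmod (H w) \<le> K * A"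
      using Hle cball_half_subset_open_strip open_strip_subset by blast
  qed simp
  moreover have "(H has_field_derivative
      (\<Sum>n<M. deriv (\<lambda>z. F z n) (1/2) * x n - 2 * (F (1/2) n * (x n * of_real (l n))))) (at (1/2))"
    unfolding H_def
  proof (rule DERIV_sum)
    fix n
    have "((\<lambda>z. g z n) has_field_derivative x n * (- 2 * of_real (l n))) (at (1/2))"
      unfolding g_def by (auto intro!: derivative_eq_intros)
    from DERIV_mult[OF holomorphic_derivI[OF hol open_open_strip half_in_open_strip, of n] this]
    show "((\<lambda>z. F z n * g z n) has_field_derivative
        deriv (\<lambda>z. F z n) (1/2) * x n - 2 * (F (1/2) n * (x n * of_real (l n)))) (at (1/2))"
      by (simp add: ghalf algebra_simps)
  qed
  ultimately show "cmod (\<Sum>n<M. deriv (\<lambda>z. F z n) (1/2) * x n - 2 * (F (1/2) n * (x n * ln (cmod (x n)))))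
      \<le> 4 * (K * calderon_nrm F)"
    by (simp add: DERIV_imp_deriv l_def A_def)
qed

lemma cnj_sgn_mult_self: "cnj (sgn w) * w = of_real (cmod w)"
  using complex_norm_square[of w]
  by (cases "w = 0") (auto simp: sgn_div_norm scaleR_conv_of_real power2_eq_square field_simps)

text \<open>Rotating the phases of \<open>x\<close> makes every term of the pairing nonnegative
  without changing moduli. The logarithmic term is itself a pairing with \<open>F (1/2)\<close>, for
  the sequence \<open>x ln |x|\<close>; the constants add up to \<open>4 + 2 = 6\<close>.\<close>

lemma sum_deriv_half_le:
  assumes F: "F \<in> calderon_C" and K: "K \<ge> 1" and x: "(\<Sum>n<M. (cmod (x n))\<^sup>2) \<le> K"
    and xl: "(\<Sum>n<M. (cmod (x n) * ln (cmod (x n)))\<^sup>2) \<le> K"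
  shows "(\<Sum>n<M. cmod (x n * deriv (\<lambda>z. F z n) (1/2))) \<le> 6 * K * calderon_nrm F"
proof -
  define y where "y = (\<lambda>n. deriv (\<lambda>z. F z n) (1/2))"
  \<comment> \<open>The value \<open>1\<close> where \<open>y n = 0\<close> keeps
    \<open>cmod (x' n) = cmod (x n)\<close> in every coordinate.\<close>
  define c where "c = (\<lambda>n. if y n = 0 then 1 else cnj (sgn (y n)))"
  define x' where "x' = (\<lambda>n. of_real (cmod (x n)) * c n)"
  have c: "cmod (c n) = 1" for n by (simp add: c_def norm_sgn)
  have nx': "cmod (x' n) = cmod (x n)" for n by (simp add: x'_def norm_mult c)
  have yx: "y n * x' n = of_real (cmod (x n * y n))" for n
    using cnj_sgn_mult_self[of "y n"] by (simp add: x'_def c_def norm_mult mult_ac)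
  define a where "a = (\<lambda>n. y n * x' n - 2 * (F (1/2) n * (x' n * ln (cmod (x' n)))))"
  define b where "b = (\<lambda>n. F (1/2) n * (x' n * ln (cmod (x' n))))"
  have "(\<Sum>n<M. cmod (x n * y n)) = cmod (\<Sum>n<M. y n * x' n)"
    by (simp add: yx sum_nonneg flip: of_real_sum)
  also have "(\<Sum>n<M. y n * x' n) = (\<Sum>n<M. a n) + 2 * (\<Sum>n<M. b n)"
    by (simp add: a_def b_def sum_subtractf sum_distrib_left)
  also have "cmod \<dots> \<le> cmod (\<Sum>n<M. a n) + 2 * cmod (\<Sum>n<M. b n)"
    using norm_triangle_ineq[of "\<Sum>n<M. a n" "2 * (\<Sum>n<M. b n)"] by (simp add: norm_mult)
  also have "cmod (\<Sum>n<M. a n) \<le> 4 * (K * calderon_nrm F)"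
    unfolding a_def y_def by (rule calderon_pairing_bounds(2)[OF F K]) (simp add: nx' x)
  also have "cmod (\<Sum>n<M. b n) \<le> K * calderon_nrm F"
    unfolding b_def by (rule calderon_pairing_bounds(1)[OF F K]) (use xl in \<open>simp add: norm_mult nx' power_mult_distrib\<close>)
  finally show ?thesis by (simp add: y_def)
qed

section \<open>Modulars, Luxemburg norms and the dual pairing\<close>

lemma orlicz_function_nonneg: "orlicz_function f \<Longrightarrow> t \<ge> 0 \<Longrightarrow> f t \<ge> 0"
  unfolding orlicz_function_def by (metis atLeast_iff mono_onD order_refl)

lemma orlicz_function_divide_le:
  assumes f: "orlicz_function f" and "t \<ge> 0" "r \<ge> 1"
  shows "f (t / r) \<le> f t / r"
proof -
  have "f ((1 - 1/r) *\<^sub>R 0 + (1/r) *\<^sub>R t) \<le> (1 - 1/r) * f 0 + (1/r) * f t"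
    using assms by (intro convex_onD[of "{0..}"]) (auto simp: orlicz_function_def)
  thus ?thesis using f by (simp add: orlicz_function_def)
qed

text \<open>By convexity and \<open>f 0 = 0\<close>, dividing the sequence by
  \<open>r \<ge> 1\<close> divides the modular by at least \<open>r\<close>.\<close>

lemma orlicz_modular_divide:
  assumes f: "orlicz_function f" and "r \<ge> 1"
    and s: "summable (\<lambda>n. f (cmod (x n)))" "(\<Sum>n. f (cmod (x n))) \<le> r"
  shows "summable (\<lambda>n. f (cmod (x n) / r))" "(\<Sum>n. f (cmod (x n) / r)) \<le> 1"
proof -
  have le: "f (cmod (x n) / r) \<le> f (cmod (x n)) / r" for n
    by (rule orlicz_function_divide_le[OF f norm_ge_zero \<open>r \<ge> 1\<close>])
  have sd: "summable (\<lambda>n. f (cmod (x n)) / r)" using s(1) by (rule summable_divide)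
  show s': "summable (\<lambda>n. f (cmod (x n) / r))"
    by (rule summable_comparison_test'[OF sd])
      (use le orlicz_function_nonneg[OF f] \<open>r \<ge> 1\<close> in auto)
  have "(\<Sum>n. f (cmod (x n) / r)) \<le> (\<Sum>n. f (cmod (x n)) / r)"
    by (rule suminf_le[OF le s' sd])
  also have "\<dots> = (\<Sum>n. f (cmod (x n))) / r" by (rule suminf_divide[OF s(1)])
  also have "\<dots> \<le> 1" using s(2) \<open>r \<ge> 1\<close> by simp
  finally show "(\<Sum>n. f (cmod (x n) / r)) \<le> 1" .
qed

lemma nrm_orlicz_le:
  assumes "r > 0" "summable (\<lambda>n. f (cmod (x n) / r))" "(\<Sum>n. f (cmod (x n) / r)) \<le> 1"
  shows "x \<in> elems (orlicz_space f)" "nrm (orlicz_space f) x \<le> r"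
proof -
  show "x \<in> elems (orlicz_space f)" using assms by (auto simp: orlicz_space_def)
  show "nrm (orlicz_space f) x \<le> r"
    unfolding orlicz_space_def seq_space.simps
    by (rule cInf_lower) (use assms in \<open>auto intro!: bdd_belowI[of _ 0]\<close>)
qed

text \<open>Makes the infimum in the Luxemburg norm range over a nonempty set.\<close>

lemma orlicz_modular_le_1_exists:
  assumes f: "orlicz_function f" and x: "x \<in> elems (orlicz_space f)"
  shows "\<exists>r>0. summable (\<lambda>n. f (cmod (x n) / r)) \<and> (\<Sum>n. f (cmod (x n) / r)) \<le> 1"
proof -
  obtain r where r: "r > 0" "summable (\<lambda>n. f (cmod (x n) / r))"
    using x by (auto simp: orlicz_space_def)
  define R where "R = max 1 (\<Sum>n. f (cmod (x n) / r))"
  have nx: "cmod (x n / of_real r) = cmod (x n) / r" for n using r by (simp add: norm_divide)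
  have "summable (\<lambda>n. f (cmod (x n / of_real r) / R))" "(\<Sum>n. f (cmod (x n / of_real r) / R)) \<le> 1"
    by (rule orlicz_modular_divide[OF f]; use r in \<open>simp add: nx R_def\<close>)+
  moreover have "(\<lambda>n. f (cmod (x n / of_real r) / R)) = (\<lambda>n. f (cmod (x n) / (r * R)))" by (simp add: nx)
  moreover have "r * R > 0" using r by (simp add: R_def)
  ultimately show ?thesis by (intro exI[of _ "r * R"]) simp
qed

lemma nrm_orlicz_nonneg:
  assumes "orlicz_function f" "x \<in> elems (orlicz_space f)"
  shows "0 \<le> nrm (orlicz_space f) x"
  unfolding orlicz_space_def seq_space.simps
  by (rule cInf_greatest) (use orlicz_modular_le_1_exists[OF assms] in auto)

text \<open>A test for duality by finite absolute sums over the modular unit ball, so that no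
  convergence has to be known beforehand. Scaling by admissible \<open>r\<close> and passing to
  their infimum gives the bound by the norm.\<close>

lemma in_seq_dual_orlicz:
  assumes f: "orlicz_function f"
    and C: "\<And>x M. summable (\<lambda>n. f (cmod (x n))) \<Longrightarrow> (\<Sum>n. f (cmod (x n))) \<le> 1 \<Longrightarrow>
      (\<Sum>n<M. cmod (x n * y n)) \<le> C"
  shows "y \<in> elems (seq_dual (orlicz_space f))" "nrm (seq_dual (orlicz_space f)) y \<le> C"
proof -
  let ?X = "orlicz_space f"
  have f0: "f 0 = 0" using f by (simp add: orlicz_function_def)
  have C0: "C \<ge> 0" using C[of "\<lambda>n. 0" 0] by (simp add: f0)
  have part: "(\<Sum>n<M. cmod (x n * y n)) \<le> C * r"
    if r: "r > 0" "summable (\<lambda>n. f (cmod (x n) / r))" "(\<Sum>n. f (cmod (x n) / r)) \<le> 1" for x r M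
  proof -
    have nx: "cmod (x n / of_real r) = cmod (x n) / r" for n using r by (simp add: norm_divide)
    have "(\<Sum>n<M. cmod ((x n / of_real r) * y n)) \<le> C" by (rule C) (simp_all add: nx r)
    hence "(\<Sum>n<M. cmod (x n * y n)) / r \<le> C"
      using r by (simp add: norm_mult norm_divide sum_divide_distrib)
    thus ?thesis using r by (simp add: field_simps)
  qed
  have summable_norm_prod: "summable (\<lambda>n. cmod (x n * y n))" if x: "x \<in> elems ?X" for x
  proof -
    obtain r where r: "r > 0" "summable (\<lambda>n. f (cmod (x n) / r))" "(\<Sum>n. f (cmod (x n) / r)) \<le> 1"
      using orlicz_modular_le_1_exists[OF f x] by blast
    show ?thesis by (rule bounded_imp_summable[of _ "C * r"])
      (use part[OF r, of "Suc _"] in \<open>auto simp: lessThan_Suc_atMost\<close>)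
  qed
  have bound: "cmod (\<Sum>n. x n * y n) \<le> C * nrm ?X x" if x: "x \<in> elems ?X" for x
  proof -
    define S where "S = {r. r > 0 \<and> summable (\<lambda>n. f (cmod (x n) / r)) \<and>
                                   (\<Sum>n. f (cmod (x n) / r)) \<le> 1}"
    have S: "S \<noteq> {}" using orlicz_modular_le_1_exists[OF f x] by (auto simp: S_def)
    have le: "cmod (\<Sum>n. x n * y n) \<le> C * r" if "r \<in> S" for r
    proof -
      have "cmod (\<Sum>n. x n * y n) \<le> (\<Sum>n. cmod (x n * y n))"
        by (rule summable_norm[OF summable_norm_prod[OF x]])
      also have "\<dots> \<le> C * r"
        by (rule suminf_le_const[OF summable_norm_prod[OF x]]) (use part that in \<open>auto simp: S_def\<close>)
      finally show ?thesis .
    qed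
    have "cmod (\<Sum>n. x n * y n) \<le> C * Inf S"
    proof (cases "C = 0")
      case True thus ?thesis using le S by auto
    next
      case False
      hence "C > 0" using C0 by simp
      hence "cmod (\<Sum>n. x n * y n) / C \<le> Inf S"
        using le by (intro cInf_greatest[OF S]) (simp add: field_simps)
      thus ?thesis using \<open>C > 0\<close> by (simp add: field_simps)
    qed
    thus ?thesis by (simp add: orlicz_space_def S_def)
  qed
  have "bounded_functional ?X (\<lambda>x. \<Sum>n. x n * y n)"
    unfolding bounded_functional_def
  proof (intro conjI ballI allI exI[of _ C])
    fix x z assume x: "x \<in> elems ?X" and z: "z \<in> elems ?X"
    show "(\<Sum>n. (x n + z n) * y n) = (\<Sum>n. x n * y n) + (\<Sum>n. z n * y n)"
      using suminf_add[OF summable_norm_cancel[OF summable_norm_prod[OF x]]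
          summable_norm_cancel[OF summable_norm_prod[OF z]]] by (simp add: algebra_simps)
  next
    fix x c assume x: "x \<in> elems ?X"
    show "(\<Sum>n. c * x n * y n) = c * (\<Sum>n. x n * y n)"
      using suminf_mult[OF summable_norm_cancel[OF summable_norm_prod[OF x]], of c]
      by (simp add: mult.assoc)
  qed (rule bound)
  moreover have "\<forall>x\<in>elems ?X. (\<lambda>n. x n * y n) sums (\<Sum>n. x n * y n)"
    using summable_norm_cancel[OF summable_norm_prod] by (simp add: summable_sums)
  ultimately show "y \<in> elems (seq_dual ?X)" unfolding seq_dual_def by auto
  have zero: "(\<lambda>n. 0) \<in> elems ?X" "nrm ?X (\<lambda>n. 0) \<le> 1"
    by (rule nrm_orlicz_le[of 1]; simp add: f0)+
  show "nrm (seq_dual ?X) y \<le> C"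
    unfolding seq_dual_def seq_space.simps
  proof (rule cSUP_least)
    show "{x \<in> elems ?X. nrm ?X x \<le> 1} \<noteq> {}" using zero by blast
    fix x assume x: "x \<in> {x \<in> elems ?X. nrm ?X x \<le> 1}"
    hence "cmod (\<Sum>n. x n * y n) \<le> C * nrm ?X x" using bound by blast
    also have "\<dots> \<le> C * 1" using x C0 by (intro mult_left_mono) auto
    finally show "cmod (\<Sum>n. x n * y n) \<le> C" by simp
  qed
qed

text \<open>The functional witnessing membership is bounded, which makes the supremum in the dual
  norm meaningful. The estimate uses an admissible \<open>r\<close> rather than the norm of
  \<open>x\<close>, so that test sequences need only a modular bound.\<close>

lemma seq_dual_orlicz_pairing:
  assumes f: "orlicz_function f" and y: "y \<in> elems (seq_dual (orlicz_space f))"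
    and r: "r > 0" "summable (\<lambda>n. f (cmod (x n) / r))" "(\<Sum>n. f (cmod (x n) / r)) \<le> 1"
  shows "cmod (\<Sum>n. x n * y n) \<le> nrm (seq_dual (orlicz_space f)) y * r"
proof -
  let ?X = "orlicz_space f"
  obtain \<phi> where \<phi>: "bounded_functional ?X \<phi>" "\<And>x. x \<in> elems ?X \<Longrightarrow> (\<lambda>n. x n * y n) sums \<phi> x"
    using y by (auto simp: seq_dual_def)
  obtain C where C: "\<And>x. x \<in> elems ?X \<Longrightarrow> cmod (\<phi> x) \<le> C * nrm ?X x"
    using \<phi>(1) unfolding bounded_functional_def by blast
  let ?B = "{x \<in> elems ?X. nrm ?X x \<le> 1}"
  have bdd: "bdd_above ((\<lambda>x. cmod (\<Sum>n. x n * y n)) ` ?B)"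
  proof (rule bdd_aboveI2)
    fix x assume x: "x \<in> ?B"
    hence "C * nrm ?X x \<le> \<bar>C\<bar> * 1"
      using nrm_orlicz_nonneg[OF f, of x] by (intro mult_mono) auto
    moreover have "(\<Sum>n. x n * y n) = \<phi> x" using sums_unique[OF \<phi>(2), of x] x by simp
    ultimately show "cmod (\<Sum>n. x n * y n) \<le> \<bar>C\<bar>" using C[of x] x by auto
  qed
  define z where "z = (\<lambda>n. x n / of_real r)"
  have nz: "cmod (z n) / 1 = cmod (x n) / r" for n using r by (simp add: z_def norm_divide)
  have z: "z \<in> elems ?X" "nrm ?X z \<le> 1"
    by (rule nrm_orlicz_le[of 1 f z]; use r in \<open>simp only: nz\<close>; simp)+
  have "cmod (\<Sum>n. z n * y n) \<le> nrm (seq_dual ?X) y"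
    unfolding seq_dual_def seq_space.simps by (rule cSUP_upper[OF _ bdd]) (use z in simp)
  moreover have "(\<Sum>n. x n * y n) = of_real r * (\<Sum>n. z n * y n)"
    using suminf_mult[OF sums_summable[OF \<phi>(2)[OF z(1)]], of "of_real r"] r by (simp add: z_def mult.assoc[symmetric])
  ultimately show ?thesis using r by (simp add: norm_mult mult.commute)
qed

text \<open>The formula for \<open>f\<close> holds only near \<open>0\<close>. Up to
  \<open>d\<close> it gives both bounds because \<open>(ln t)^2 \<ge> 1\<close>; above
  \<open>d\<close>, the condition \<open>f t \<le> 1\<close> confines \<open>t\<close> to
  \<open>[d, R]\<close>, where both squares are at most \<open>Q\<close> and \<open>f\<close> is at
  least \<open>f d\<close>.\<close>

lemma t2log2_modular_bound:
  assumes f: "orlicz_function f" "t2log2_near_0 f"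
  obtains K where "K \<ge> 1"
    "\<And>t. t \<ge> 0 \<Longrightarrow> f t \<le> 1 \<Longrightarrow> t\<^sup>2 \<le> K * f t \<and> (t * ln t)\<^sup>2 \<le> K * f t"
proof -
  obtain d0 where d0: "d0 > 0" "\<And>t. 0 < t \<Longrightarrow> t < d0 \<Longrightarrow> f t = t\<^sup>2 * (ln t)\<^sup>2"
    using f(2) unfolding t2log2_near_0_def by blast
  \<comment> \<open>Halving places \<open>d\<close> itself below both thresholds, so that the
    formula also gives \<open>f d > 0\<close>.\<close>
  define d where "d = min d0 (exp (-1)) / 2"
  have d: "d > 0" "d < d0" "d < exp (-1)" using d0 exp_gt_zero[of "-1::real"]
    unfolding d_def by (auto simp only: min_def split: if_splits)
  have f0: "f 0 = 0" and mf: "mono_on {0..} f" using f by (auto simp: orlicz_function_def)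
  have small: "f t = t\<^sup>2 * (ln t)\<^sup>2 \<and> (ln t)\<^sup>2 \<ge> 1" if "0 < t" "t \<le> d" for t
  proof -
    have "t < exp (-1)" using that d by linarith
    hence "ln t < -1" using that by (metis exp_gt_zero ln_exp ln_less_cancel_iff)
    thus ?thesis using that d d0 abs_le_square_iff[of 1 "ln t"] by auto
  qed
  have "d\<^sup>2 * (ln d)\<^sup>2 > 0"
    using small[of d] d by (intro mult_pos_pos) (simp, linarith)
  hence fd: "f d > 0" using small[of d] d by simp
  have "filterlim f at_top at_top" using f(1) by (simp add: orlicz_function_def)
  hence "\<forall>\<^sub>F t in at_top. f t > 1" by (simp add: filterlim_at_top_dense)
  then obtain R where R: "\<And>t. t \<ge> R \<Longrightarrow> f t > 1" by (auto simp: eventually_at_top_linorder)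
  \<comment> \<open>\<open>R^2 + 1\<close> bounds \<open>|t ln t|\<close>, by
    \<open>ln s \<le> s - 1\<close> at \<open>s = t\<close> and at \<open>s = 1/t\<close>. In
    \<open>K\<close>, the summand \<open>Q / f d\<close> covers the middle range and
    \<open>1\<close> the small one.\<close>
  define Q where "Q = (R\<^sup>2 + 1)\<^sup>2"
  define K where "K = Q / f d + 1"
  have K1: "K \<ge> 1" using fd by (simp add: K_def Q_def)
  show ?thesis
  proof (rule that[OF K1])
    fix t :: real assume t: "t \<ge> 0" "f t \<le> 1"
    have ft: "f t \<ge> 0" using orlicz_function_nonneg[OF f(1) t(1)] .
    consider "t = 0" | "0 < t" "t \<le> d" | "t > d" using t by linarith
    thus "t\<^sup>2 \<le> K * f t \<and> (t * ln t)\<^sup>2 \<le> K * f t"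
    proof cases
      case 1 thus ?thesis by (simp add: f0)
    next
      case 2
      have "1 * f t \<le> K * f t" by (intro mult_right_mono K1 ft)
      moreover have "t\<^sup>2 * 1 \<le> t\<^sup>2 * (ln t)\<^sup>2" using small[OF 2] by (intro mult_left_mono) auto
      ultimately show ?thesis using small[OF 2] by (simp add: power_mult_distrib)
    next
      case 3
      have tR: "t \<le> R" using R[of t] t by fastforce
      have t0: "t > 0" using 3 d by simp
      have tt: "t\<^sup>2 \<le> R\<^sup>2" using tR t by (intro power_mono) auto
      have "t * ln t \<le> t * (t - 1)" using ln_le_minus_one[OF t0] t0 by (intro mult_left_mono) auto
      hence up: "t * ln t \<le> R\<^sup>2 + 1" using tt t0 by (simp add: power2_eq_square algebra_simps)
      have "t * ln (1 / t) \<le> t * (1 / t - 1)" using ln_le_minus_one[of "1/t"] t0 by (intro mult_left_mono) auto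
      hence "- (t * ln t) \<le> 1" using t0 by (simp add: ln_div algebra_simps)
      hence "\<bar>t * ln t\<bar> \<le> R\<^sup>2 + 1" using up by (smt (verit) zero_le_power2)
      hence b2: "(t * ln t)\<^sup>2 \<le> Q" unfolding Q_def by (metis abs_ge_zero power2_abs power_mono)
      have "R\<^sup>2 \<le> Q" unfolding Q_def by (simp add: power2_sum power2_eq_square[of "R\<^sup>2"])
      hence b1: "t\<^sup>2 \<le> Q" using tt by simp
      have "f d \<le> f t" using mf 3 d t by (auto simp: mono_on_def)
      hence "Q * 1 \<le> Q * (f t / f d)" using fd by (intro mult_left_mono) (auto simp: Q_def)
      also have "\<dots> \<le> K * f t" using ft by (simp add: K_def algebra_simps)
      finally show ?thesis using b1 b2 by simp
    qed
  qed
qed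

lemma Delta_1_in_seq_dual:
  assumes f: "orlicz_function f" "t2log2_near_0 f"
  obtains C where "C > 0" "\<And>F. F \<in> calderon_C \<Longrightarrow>
    Delta ell_infty ell_1 1 F \<in> elems (seq_dual (orlicz_space f)) \<and>
    nrm (seq_dual (orlicz_space f)) (Delta ell_infty ell_1 1 F) \<le> C * calderon_nrm F"
proof -
  obtain K where K: "K \<ge> 1"
    "\<And>t. t \<ge> 0 \<Longrightarrow> f t \<le> 1 \<Longrightarrow> t\<^sup>2 \<le> K * f t \<and> (t * ln t)\<^sup>2 \<le> K * f t"
    using t2log2_modular_bound[OF f] by metis
  show ?thesis
  proof (rule that[of "6 * K"])
    fix F assume F: "F \<in> calderon_C"
    let ?y = "\<lambda>n. deriv (\<lambda>z. F z n) (1/2)"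
    have "(\<Sum>n<M. cmod (x n * ?y n)) \<le> 6 * K * calderon_nrm F"
      if s: "summable (\<lambda>n. f (cmod (x n)))" "(\<Sum>n. f (cmod (x n))) \<le> 1" for x M
    proof (rule sum_deriv_half_le[OF F K(1)])
      have part: "(\<Sum>n\<in>I. f (cmod (x n))) \<le> 1" if "finite I" for I
        using sum_le_suminf[OF s(1) that] orlicz_function_nonneg[OF f(1)] s(2) by fastforce
      \<comment> \<open>The terms are nonnegative, so a modular of at most \<open>1\<close> bounds
        each of them by \<open>1\<close>, as \<open>K(2)\<close> demands.\<close>
      have 1: "f (cmod (x n)) \<le> 1" for n using part[of "{n}"] by simp
      have *: "(\<Sum>n<M. K * f (cmod (x n))) \<le> K"
        unfolding sum_distrib_left[symmetric] using part[of "{..<M}"] K(1)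
        by (simp add: mult_left_le)
      show "(\<Sum>n<M. (cmod (x n))\<^sup>2) \<le> K"
        by (rule order_trans[OF sum_mono *]) (use K(2) 1 in simp)
      show "(\<Sum>n<M. (cmod (x n) * ln (cmod (x n)))\<^sup>2) \<le> K"
        by (rule order_trans[OF sum_mono *]) (use K(2) 1 in simp)
    qed
    from in_seq_dual_orlicz[OF f(1) this]
    show "Delta ell_infty ell_1 1 F \<in> elems (seq_dual (orlicz_space f)) \<and>
      nrm (seq_dual (orlicz_space f)) (Delta ell_infty ell_1 1 F) \<le> 6 * K * calderon_nrm F"
      unfolding Delta_1[OF F] by blast
  qed (use K in simp)
qed

section \<open>Dual elements are derivatives at the midpoint\<close>

text \<open>With tail sums \<open>r\<close>, the series of \<open>m n / sqrt (r n)\<close> is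
  dominated by a telescoping one. The fourth root of \<open>r\<close> is at least the square root
  since \<open>r \<le> 1\<close>, and it also gives \<open>m n \<le> e n ^ 4\<close>, which for
  \<open>m = p^2\<close> reads \<open>p \<le> e^2\<close>.\<close>

lemma vanishing_weights:
  fixes m :: "nat \<Rightarrow> real"
  assumes m: "\<And>n. m n \<ge> 0" "summable m" "suminf m \<le> 1"
  shows "\<exists>e. (\<forall>n. 0 \<le> e n \<and> e n \<le> 1 \<and> m n \<le> e n ^ 4) \<and> e \<longlonglongrightarrow> 0 \<and>
    summable (\<lambda>n. m n / e n) \<and> (\<Sum>n. m n / e n) \<le> 2"
proof -
  define r where "r = (\<lambda>n. \<Sum>k. m (k + n))"
  have sm: "summable (\<lambda>k. m (k + n))" for n using m(2) by (simp add: summable_iff_shift)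
  have r0: "r n \<ge> 0" for n unfolding r_def by (intro suminf_nonneg sm m)
  have rS: "r n = m n + r (Suc n)" for n
    using suminf_split_head[OF sm[of n]] by (simp add: r_def)
  have r1: "r n \<le> 1" for n
  proof (induction n)
    case 0 thus ?case using m(3) by (simp add: r_def)
  next
    case (Suc n) thus ?case using rS[of n] m(1)[of n] by linarith
  qed
  have "r = (\<lambda>n. suminf m - sum m {..<n})"
  proof
    fix n
    show "r n = suminf m - sum m {..<n}"
      using suminf_split_initial_segment[OF m(2), of n] by (simp add: r_def)
  qed
  moreover have "(\<lambda>n. suminf m - sum m {..<n}) \<longlonglongrightarrow> suminf m - suminf m"
    by (intro tendsto_intros summable_LIMSEQ m)
  ultimately have rlim: "r \<longlonglongrightarrow> 0" by simp
  define e where "e = (\<lambda>n. sqrt (sqrt (r n)))"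
  have e0: "0 \<le> e n" for n using r0 by (simp add: e_def)
  have e1: "e n \<le> 1" for n using r1 by (simp add: e_def)
  have e2: "(e n)\<^sup>2 = sqrt (r n)" for n using r0 by (simp add: e_def)
  have "e n ^ 4 = ((e n)\<^sup>2)\<^sup>2" for n by simp
  hence e4: "e n ^ 4 = r n" for n using r0 by (simp only: e2 real_sqrt_pow2)
  \<comment> \<open>For the square roots \<open>a\<close>, \<open>b\<close> of consecutive tails,
    \<open>a^2 - b^2 \<le> 2 * a * (a - b)\<close>. Where a tail is \<open>0\<close>, the quotient
    \<open>0 / 0\<close> counts as \<open>0\<close>.\<close>
  have step: "m n / e n \<le> 2 * sqrt (r n) - 2 * sqrt (r (Suc n))" for n
  proof (cases "r n = 0")
    case True
    hence "m n = 0" "r (Suc n) = 0" using rS[of n] m(1)[of n] r0[of "Suc n"] by linarith+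
    thus ?thesis using True by simp
  next
    case False
    define a b where "a = sqrt (r n)" and "b = sqrt (r (Suc n))"
    have a: "a > 0" using False r0[of n] by (simp add: a_def less_le)
    have b: "0 \<le> b" "b \<le> a" using rS[of n] m(1)[of n] r0 by (auto simp: a_def b_def)
    have mab: "m n = (a - b) * (a + b)"
    proof -
      have "a\<^sup>2 = r n" "b\<^sup>2 = r (Suc n)" using r0 by (simp_all add: a_def b_def)
      thus ?thesis using rS[of n] by (simp add: algebra_simps power2_eq_square)
    qed
    have "e n * e n \<le> e n * 1" using e0 e1 by (intro mult_left_mono)
    hence ae: "a \<le> e n" using e2[of n] by (simp add: a_def power2_eq_square)
    hence "m n / e n \<le> m n / a" using a m(1) by (intro divide_left_mono) auto
    also have "\<dots> \<le> 2 * (a - b)"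
    proof -
      have "(a - b) * (a + b) \<le> (a - b) * (2 * a)" using b by (intro mult_left_mono) auto
      thus ?thesis unfolding mab pos_divide_le_eq[OF a] by (simp only: mult_ac)
    qed
    finally show ?thesis by (simp add: a_def b_def)
  qed
  have part: "(\<Sum>n<N. m n / e n) \<le> 2" for N
  proof -
    have "(\<Sum>n<N. m n / e n) \<le> (\<Sum>n<N. 2 * sqrt (r n) - 2 * sqrt (r (Suc n)))"
      by (rule sum_mono) (rule step)
    also have "\<dots> = 2 * sqrt (r 0) - 2 * sqrt (r N)" by (rule sum_lessThan_telescope')
    also have "\<dots> \<le> 2" using r0[of N] r1[of 0] real_sqrt_le_1_iff[of "r 0"] real_sqrt_ge_zero[of "r N"] by linarith
    finally show ?thesis .
  qed
  have nn: "0 \<le> m n / e n" for n using m(1) e0 by simp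
  have sme: "summable (\<lambda>n. m n / e n)"
    by (rule bounded_imp_summable[of _ 2]) (use part[of "Suc _"] nn in \<open>auto simp: lessThan_Suc_atMost\<close>)
  have "m n \<le> e n ^ 4" for n using rS[of n] r0[of "Suc n"] by (simp add: e4)
  moreover have "e \<longlonglongrightarrow> 0"
  proof -
    have "e \<longlonglongrightarrow> sqrt (sqrt 0)" unfolding e_def by (intro tendsto_intros rlim)
    thus ?thesis by simp
  qed
  moreover have "(\<Sum>n. m n / e n) \<le> 2" by (rule suminf_le_const[OF sme part])
  ultimately show ?thesis using e0 e1 sme by blast
qed

text \<open>Beyond some \<open>N\<close> the null sequence \<open>c\<close> controls both sides, and
  the finitely many remaining coordinates converge jointly.\<close>

lemma uniform_limit_dominated:
  fixes u :: "'a \<Rightarrow> nat \<Rightarrow> 'b::real_normed_vector"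
  assumes lim: "\<And>n. ((\<lambda>w. u w n) \<longlongrightarrow> l n) Fl" and c: "c \<longlonglongrightarrow> 0"
    and dom: "\<And>n. norm (l n) \<le> c n" "\<forall>\<^sub>F w in Fl. \<forall>n. norm (u w n) \<le> c n"
  shows "uniform_limit UNIV u l Fl"
proof (rule uniform_limitI)
  fix e :: real assume e: "e > 0"
  hence "\<forall>\<^sub>F n in sequentially. c n < e/2" using c by (intro order_tendstoD) auto
  then obtain N where N: "\<And>n. n \<ge> N \<Longrightarrow> c n < e/2" by (auto simp: eventually_sequentially)
  have "\<forall>\<^sub>F w in Fl. \<forall>n\<in>{..<N}. dist (u w n) (l n) < e"
    using tendstoD[OF lim e] by (intro eventually_ball_finite) auto
  with dom(2) show "\<forall>\<^sub>F w in Fl. \<forall>n\<in>UNIV. dist (u w n) (l n) < e"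
  proof eventually_elim
    case (elim w)
    have "dist (u w n) (l n) < e" for n
    proof (cases "n < N")
      case False
      have "dist (u w n) (l n) \<le> norm (u w n) + norm (l n)" by (simp add: dist_norm norm_triangle_ineq4)
      also have "\<dots> \<le> c n + c n" using elim dom(1) by (intro add_mono) auto
      finally show ?thesis using N[of n] False by simp
    qed (use elim in auto)
    thus ?case by blast
  qed
qed

text \<open>Tannery's theorem, with \<open>b n + b n\<close> dominating the differences.\<close>

lemma tends_in_ell_1_dominated:
  assumes lim: "\<And>n. ((\<lambda>w. u w n) \<longlongrightarrow> l n) Fl" and b: "summable b" and nt: "Fl \<noteq> bot"
    and dom: "\<And>n. cmod (l n) \<le> b n" "\<And>w n. cmod (u w n) \<le> b n"
  shows "tends_in ell_1 u l Fl"
proof -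
  have "(\<forall>\<^sub>F w in Fl. summable (\<lambda>n. norm (cmod (u w n - l n)))) \<and> summable (\<lambda>n::nat. norm (0::real)) \<and>
      ((\<lambda>w. \<Sum>n. cmod (u w n - l n)) \<longlongrightarrow> (\<Sum>n. 0)) Fl"
  proof (rule tannerys_theorem)
    show "((\<lambda>w. cmod (u w n - l n)) \<longlongrightarrow> 0) Fl" for n
      using tendsto_norm_zero[OF LIM_zero[OF lim]] by simp
    have "norm (cmod (u w n - l n)) \<le> b n + b n" for w n
      unfolding real_norm_def abs_norm_cancel by (rule norm_triangle_le_diff) (intro add_mono dom)
    thus "\<forall>\<^sub>F (n, w) in at_top \<times>\<^sub>F Fl. norm (cmod (u w n - l n)) \<le> b n + b n"
      by (intro always_eventually) (simp only: split_paired_all prod.case, simp)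
    show "summable (\<lambda>n. b n + b n)" using b by (intro summable_add)
  qed fact
  thus ?thesis by (simp add: tends_in_def ell_1_def)
qed

lemma gauss_decay_at_infinity: "((\<lambda>t::real. 2 * exp (- t\<^sup>2)) \<longlongrightarrow> 0) at_infinity"
  unfolding at_infinity_eq_at_top_bot by (intro filterlim_sup) real_asymp+

text \<open>Apart from the Gaussian, coordinate \<open>n\<close> has modulus
  \<open>cmod (a n) * exp (l n / 2)\<close> on the left line and
  \<open>cmod (a n) * exp (- l n / 2)\<close> on the right one; its derivative at the midpoint is
  \<open>- l n * a n\<close>.\<close>

definition exponential_family :: "(nat \<Rightarrow> complex) \<Rightarrow> (nat \<Rightarrow> real) \<Rightarrow> complex \<Rightarrow> cseq" where
  "exponential_family a l z n =
    (if z \<in> strip then gauss z * (a n * exp (- of_real (l n) * (z - 1/2))) else 0)"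

text \<open>The null sequence \<open>e\<close> dominates the coordinates up to a constant and so
  gives continuity in the sup norm; the summable \<open>b\<close> does the same for
  \<open>ell_1\<close> on the right line. The bound \<open>4\<close> is \<open>2\<close> from the
  Gaussian times \<open>suminf b \<le> 2\<close>.\<close>

lemma exponential_family_in_calderon:
  assumes l: "\<And>n. l n \<ge> 0" and e: "e \<longlonglongrightarrow> 0" "\<And>n. e n \<le> 1" and b: "summable b" "suminf b \<le> 2"
    and ae: "\<And>n. cmod (a n) * exp (l n / 2) \<le> e n" and ab: "\<And>n. cmod (a n) * exp (- l n / 2) \<le> b n"
  defines "F \<equiv> exponential_family a l"
  shows "F \<in> calderon_C" "calderon_nrm F \<le> 4" "Delta ell_infty ell_1 1 F = (\<lambda>n. - of_real (l n) * a n)"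
proof -
  have cmodF: "cmod (F z n) = cmod (gauss z) * (cmod (a n) * exp (- l n * (Re z - 1/2)))" if "z \<in> strip" for z n
    using that by (simp add: F_def exponential_family_def norm_mult)
  have e0: "0 \<le> e n" for n using order_trans[OF _ ae[of n]] by simp
  have b0: "0 \<le> b n" for n using order_trans[OF _ ab[of n]] by simp
  \<comment> \<open>For \<open>l n \<ge> 0\<close> the exponential is largest on the left line, so
    \<open>e n\<close> works on the whole strip.\<close>
  have bound: "cmod (F z n) \<le> cmod (gauss z) * e n" if z: "z \<in> strip" for z n
  proof -
    have "l n * (1/2 - Re z) \<le> l n * (1/2)" using z l by (intro mult_left_mono) (auto simp: strip_def)
    hence "cmod (a n) * exp (- l n * (Re z - 1/2)) \<le> cmod (a n) * exp (l n / 2)"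
      by (intro mult_left_mono) (auto simp: algebra_simps)
    also have "\<dots> \<le> e n" by (rule ae)
    finally show ?thesis unfolding cmodF[OF z] by (rule mult_left_mono) simp
  qed
  have bound1: "cmod (F (Complex 1 t) n) \<le> cmod (gauss (Complex 1 t)) * b n" for t n
    unfolding cmodF[OF Complex_line_in_strip(2)] using ab[of n] by (intro mult_left_mono) auto
  have e2: "cmod (F z n) \<le> 2 * e n" if "z \<in> strip" for z n
    using bound[OF that, of n] mult_right_mono[OF norm_gauss_le_2[OF that] e0[of n]] by linarith
  have b2: "cmod (F (Complex 1 t) n) \<le> 2 * b n" for t n
    using bound1[of t n] mult_right_mono[OF norm_gauss_le_2[OF Complex_line_in_strip(2)] b0[of n]]
    by (meson order_trans)
  have decay: "cmod (gauss (Complex x t)) \<le> 2 * exp (- t\<^sup>2)" if "x = 0 \<or> x = 1" for x t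
    using norm_gauss_le[of "Complex x t"] that by (auto simp: strip_def)
  have hol': "(\<lambda>z. gauss z * (a n * exp (- of_real (l n) * (z - 1/2)))) holomorphic_on A" for n A
    by (intro holomorphic_intros gauss_holomorphic)
  have hol: "(\<lambda>z. F z n) holomorphic_on open_strip" for n
    by (rule holomorphic_transform[OF hol'[of n]])
      (use open_strip_subset in \<open>auto simp: F_def exponential_family_def\<close>)
  have cont: "continuous_on strip (\<lambda>z. F z n)" for n
    using holomorphic_on_imp_continuous_on[OF hol'[of n]]
    by (rule continuous_on_eq) (simp add: F_def exponential_family_def)
  have ulim: "uniform_limit UNIV F (F z) (at z within strip)" if z: "z \<in> strip" for z
  proof (rule uniform_limit_dominated)
    show "((\<lambda>w. F w n) \<longlongrightarrow> F z n) (at z within strip)" for n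
      using cont z by (auto simp: continuous_on_def)
    show "(\<lambda>n. 2 * e n) \<longlonglongrightarrow> 0" using tendsto_mult_right_zero[OF e(1)] by simp
    show "norm (F z n) \<le> 2 * e n" for n by (rule e2[OF z])
    show "\<forall>\<^sub>F w in at z within strip. \<forall>n. norm (F w n) \<le> 2 * e n"
      using e2 by (auto simp: eventually_at_filter)
  qed
  have v0: "uniform_limit UNIV (\<lambda>t. F (Complex 0 t)) (\<lambda>n. 0) at_infinity"
  proof (rule uniform_limit_null_comparison)
    show "uniform_limit UNIV (\<lambda>(t::real) n. 2 * exp (- t\<^sup>2)) (\<lambda>n. 0) at_infinity"
      by (rule uniform_limit_const_arg[OF gauss_decay_at_infinity])
    have "norm (F (Complex 0 t) n) \<le> 2 * exp (- t\<^sup>2)" for t n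
    proof -
      have "cmod (gauss (Complex 0 t)) * e n \<le> 2 * exp (- t\<^sup>2) * 1"
        using decay e0 e(2) by (intro mult_mono) auto
      thus ?thesis using bound[OF Complex_line_in_strip(1), of t n] by simp
    qed
    thus "\<forall>\<^sub>F t in at_infinity. \<forall>n\<in>UNIV. norm (F (Complex 0 t) n) \<le> 2 * exp (- t\<^sup>2)" by simp
  qed
  have el: "F (Complex 1 t) \<in> elems ell_1" for t
    unfolding elems_ell_1 by (rule summable_comparison_test'[OF summable_mult[OF b(1)]]) (use b2 in simp)
  have nrm1: "nrm ell_1 (F (Complex 1 t)) \<le> cmod (gauss (Complex 1 t)) * suminf b" for t
  proof -
    have "(\<Sum>n. cmod (F (Complex 1 t) n)) \<le> (\<Sum>n. cmod (gauss (Complex 1 t)) * b n)"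
      using el by (intro suminf_le bound1 summable_mult b) (simp add: elems_ell_1)
    thus ?thesis by (simp add: ell_1_def suminf_mult[OF b(1)])
  qed
  have sb0: "0 \<le> suminf b" by (rule suminf_nonneg[OF b(1) b0])
  have v1: "vanishing_curve ell_1 (\<lambda>t. F (Complex 1 t))"
    unfolding vanishing_curve_def
  proof (intro conjI allI el)
    fix t
    show "tends_in ell_1 (\<lambda>t. F (Complex 1 t)) (F (Complex 1 t)) (at t)"
    proof (rule tends_in_ell_1_dominated[where b = "\<lambda>n. 2 * b n"])
      fix n
      have "((\<lambda>z. F z n) \<longlongrightarrow> F (Complex 1 t) n) (at (Complex 1 t) within strip)"
        using cont Complex_line_in_strip(2) by (auto simp: continuous_on_def)
      thus "((\<lambda>w. F (Complex 1 w) n) \<longlongrightarrow> F (Complex 1 t) n) (at t)"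
        by (rule filterlim_compose) (simp add: filterlim_Complex_line)
    qed (use b2 summable_mult[OF b(1)] in auto)
  next
    show "tends_in ell_1 (\<lambda>t. F (Complex 1 t)) (\<lambda>n. 0) at_infinity"
      unfolding tends_in_def
    proof (rule Lim_null_comparison)
      have "norm (nrm ell_1 (\<lambda>n. F (Complex 1 t) n - 0)) \<le> (2 * exp (- t\<^sup>2)) * suminf b" for t
        using nrm1[of t] mult_right_mono[OF decay[of 1 t] sb0] nrm_ell_1_nonneg[OF el[of t]] by simp
      thus "\<forall>\<^sub>F t in at_infinity. norm (nrm ell_1 (\<lambda>n. F (Complex 1 t) n - 0)) \<le> (2 * exp (- t\<^sup>2)) * suminf b"
        by simp
      show "((\<lambda>t. (2 * exp (- t\<^sup>2)) * suminf b) \<longlongrightarrow> 0) at_infinity"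
        using tendsto_mult_left_zero[OF gauss_decay_at_infinity] by simp
    qed
  qed
  have "cmod (F z n) \<le> 2" if "z \<in> strip" for z n using e2[OF that, of n] e(2)[of n] by linarith
  thus FC: "F \<in> calderon_C"
    unfolding calderon_iff using ulim hol v0 v1
    by (intro conjI) (auto simp: F_def exponential_family_def fun_eq_iff)
  show "calderon_nrm F \<le> 4"
  proof (rule calderon_nrm_le[OF FC])
    show "cmod (F (Complex 0 t) n) \<le> 4" for t n
      using e2[OF Complex_line_in_strip(1), of t n] e(2)[of n] by linarith
    show "nrm ell_1 (F (Complex 1 t)) \<le> 4" for t
      using nrm1[of t] mult_mono[OF norm_gauss_le_2[OF Complex_line_in_strip(2)[of t]] b(2) _ sb0] by simp
  qed
  have "deriv (\<lambda>z. F z n) (1/2) = - of_real (l n) * a n" for n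
  proof -
    have "((\<lambda>z. a n * exp (- of_real (l n) * (z - 1/2))) has_field_derivative - of_real (l n) * a n) (at (1/2))"
      by (auto intro!: derivative_eq_intros)
    from DERIV_mult[OF gauss_has_derivative_0 this]
    have "((\<lambda>z. gauss z * (a n * exp (- of_real (l n) * (z - 1/2)))) has_field_derivative
        - of_real (l n) * a n) (at (1/2))" by simp
    hence "((\<lambda>z. F z n) has_field_derivative - of_real (l n) * a n) (at (1/2))"
      by (rule has_field_derivative_transform_within_open[OF _ open_open_strip half_in_open_strip])
        (use open_strip_subset in \<open>auto simp: F_def exponential_family_def\<close>)
    thus ?thesis by (rule DERIV_imp_deriv)
  qed
  thus "Delta ell_infty ell_1 1 F = (\<lambda>n. - of_real (l n) * a n)"
    unfolding Delta_1[OF FC] by simp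
qed

text \<open>Up to constants \<open>profile t\<^sup>2\<close> is the Young conjugate of \<open>t\<^sup>2 (ln t)\<^sup>2\<close> near \<open>0\<close>. At \<open>0\<close> it is \<open>0\<close>
  because \<open>ln 0 = 0\<close> and \<open>0 / 0 = 0\<close>.\<close>

definition profile :: "complex \<Rightarrow> real" where
  "profile w = cmod w / (- ln (cmod w))"

lemma profile_zero [simp]: "profile 0 = 0"
  by (simp add: profile_def)

lemma small_log:
  fixes t :: real
  assumes "0 < t" "t \<le> exp (-1)"
  shows "- ln t \<ge> 1"
  using assms ln_le_cancel_iff[of t "exp (-1)"] by simp

text \<open>Where \<open>y n\<close> is nonzero, the choice of \<open>l\<close> makes
  \<open>exp (l n / 2) = e n / p n\<close>, so a coefficient of modulus at most \<open>p n\<close>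
  gets the weights \<open>e n\<close> and \<open>p n ^ 2 / e n\<close> on the two lines. Since
  \<open>p n \<le> e n ^ 2\<close>, one has
  \<open>l n \<ge> - ln (p n) \<ge> - ln (cmod (y n))\<close>, whence
  \<open>cmod (a n) \<le> p n\<close>.\<close>

lemma Delta_1_surjective:
  fixes y :: cseq
  assumes y: "\<And>n. cmod (y n) \<le> exp (-1)"
    and s: "summable (\<lambda>n. (profile (y n))\<^sup>2)" "(\<Sum>n. (profile (y n))\<^sup>2) \<le> 1"
  shows "\<exists>F\<in>calderon_C. Delta ell_infty ell_1 1 F = y \<and> calderon_nrm F \<le> 4"
proof -
  define p where "p = (\<lambda>n. profile (y n))"
  have "\<exists>e. (\<forall>n. 0 \<le> e n \<and> e n \<le> 1 \<and> (p n)\<^sup>2 \<le> e n ^ 4) \<and> e \<longlonglongrightarrow> 0 \<and>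
      summable (\<lambda>n. (p n)\<^sup>2 / e n) \<and> (\<Sum>n. (p n)\<^sup>2 / e n) \<le> 2"
    by (rule vanishing_weights) (use s in \<open>simp_all add: p_def\<close>)
  then obtain e where e: "\<forall>n. 0 \<le> e n \<and> e n \<le> 1 \<and> (p n)\<^sup>2 \<le> e n ^ 4" "e \<longlonglongrightarrow> 0"
    "summable (\<lambda>n. (p n)\<^sup>2 / e n)" "(\<Sum>n. (p n)\<^sup>2 / e n) \<le> 2"
    by (elim exE conjE)
  have e0: "0 \<le> e n" and e1: "e n \<le> 1" and e4: "(p n)\<^sup>2 \<le> e n ^ 4" for n using e(1) by simp_all
  define l where "l = (\<lambda>n. 2 * ln (e n / p n))"
  define a where "a = (\<lambda>n. - y n / of_real (l n))"
  have facts: "l n \<ge> 0 \<and> cmod (a n) * exp (l n / 2) \<le> e n \<and> cmod (a n) * exp (- l n / 2) \<le> (p n)\<^sup>2 / e n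
      \<and> - of_real (l n) * a n = y n" for n
  proof (cases "y n = 0")
    \<comment> \<open>Here \<open>p n = 0\<close>, and the conventions \<open>e n / 0 = 0\<close>
      and \<open>ln 0 = 0\<close> give \<open>l n = 0\<close>.\<close>
    case True
    hence "p n = 0" "a n = 0" by (simp_all add: p_def a_def)
    thus ?thesis using e0[of n] True by (simp add: l_def)
  next
    case False
    define t L where "t = cmod (y n)" and "L = - ln t"
    have t: "t > 0" "t \<le> exp (-1)" using False y by (simp_all add: t_def)
    have L: "L \<ge> 1" using small_log[OF t] by (simp add: L_def)
    have pn: "p n = t / L" by (simp add: p_def profile_def t_def L_def)
    have p0: "p n > 0" using t L by (simp add: pn)
    have en0: "e n > 0"
    proof (rule ccontr)
      assume "\<not> e n > 0"
      hence "e n = 0" using e0[of n] by simp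
      thus False using e4[of n] p0 by simp
    qed
    have "(p n)\<^sup>2 \<le> ((e n)\<^sup>2)\<^sup>2" using e4[of n] by simp
    hence "p n \<le> (e n)\<^sup>2" by (rule power2_le_imp_le) simp
    hence "ln (p n) \<le> ln ((e n)\<^sup>2)" using p0 en0 by simp
    also have "\<dots> = 2 * ln (e n)" using en0 by (simp add: ln_realpow)
    finally have "l n \<ge> - ln (p n)" using p0 en0 by (simp add: l_def ln_div)
    moreover have "ln (p n) = - L - ln L" using t L by (simp add: pn ln_div) (simp add: L_def)
    moreover have "ln L \<ge> 0" using L by simp
    ultimately have lL: "l n \<ge> L" by linarith
    have ex: "exp (l n / 2) = e n / p n" "exp (- l n / 2) = p n / e n"
      using p0 en0 by (simp_all add: l_def exp_minus)
    have "t / l n \<le> t / L" using lL L t by (intro divide_left_mono) auto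
    hence an: "cmod (a n) \<le> p n" using lL L by (simp add: a_def norm_divide t_def pn)
    have "cmod (a n) * (e n / p n) \<le> p n * (e n / p n)"
      using an p0 en0 by (intro mult_right_mono) auto
    moreover have "cmod (a n) * (p n / e n) \<le> p n * (p n / e n)"
      using an p0 en0 by (intro mult_right_mono) auto
    ultimately show ?thesis
      unfolding ex using lL L p0 by (simp add: a_def power2_eq_square)
  qed
  define F where "F = exponential_family a l"
  have "F \<in> calderon_C" "calderon_nrm F \<le> 4" "Delta ell_infty ell_1 1 F = (\<lambda>n. - of_real (l n) * a n)"
    unfolding F_def
    by (rule exponential_family_in_calderon[where e = e and b = "\<lambda>n. (p n)\<^sup>2 / e n"]; use facts e e1 in blast)+
  moreover have "(\<lambda>n. - of_real (l n) * a n) = y" using facts by blast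
  ultimately show ?thesis by auto
qed

text \<open>With \<open>t = cmod w\<close> and \<open>L = - ln t\<close>, the argument of
  \<open>f\<close> is \<open>X = t / L^2\<close>, and \<open>- ln X = L + 2 * ln L\<close> lies
  between \<open>0\<close> and \<open>3 * L\<close>. The factor \<open>9\<close> is the square of
  \<open>3\<close>.\<close>

lemma orlicz_profile_bound:
  assumes f: "t2log2_near_0 f"
  obtains \<tau> where "0 < \<tau>" "\<tau> \<le> exp (-1)"
    "\<And>w. w \<noteq> 0 \<Longrightarrow> cmod w \<le> \<tau> \<Longrightarrow> f (profile w / (- ln (cmod w))) \<le> 9 * (profile w)\<^sup>2"
proof -
  obtain d where d: "d > 0" "\<And>t. 0 < t \<Longrightarrow> t < d \<Longrightarrow> f t = t\<^sup>2 * (ln t)\<^sup>2"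
    using f unfolding t2log2_near_0_def by blast
  \<comment> \<open>Up to \<open>exp (-1)\<close> one has \<open>L \<ge> 1\<close>, hence
    \<open>X \<le> t\<close>; half of \<open>d\<close> keeps \<open>t\<close> strictly in the range
    of the formula for \<open>f\<close>.\<close>
  define \<tau> where "\<tau> = min (d/2) (exp (-1))"
  show ?thesis
  proof (rule that[of \<tau>])
    show "0 < \<tau>" "\<tau> \<le> exp (-1)" using d by (auto simp: \<tau>_def)
    fix w :: complex assume w: "w \<noteq> 0" "cmod w \<le> \<tau>"
    define t L where "t = cmod w" and "L = - ln t"
    have t: "t > 0" "t \<le> exp (-1)" "t < d" using w d by (auto simp: t_def \<tau>_def)
    have L: "L \<ge> 1" using small_log[OF t(1,2)] by (simp add: L_def)
    define X where "X = t / L\<^sup>2"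
    have X0: "X > 0" using t L by (simp add: X_def)
    have "t * 1 \<le> t * L\<^sup>2" using t L by (intro mult_left_mono) auto
    hence Xt: "X \<le> t" using L by (simp add: X_def divide_le_eq)
    have "ln X = ln t - 2 * ln L" using t L by (simp add: X_def ln_div ln_realpow)
    hence "ln X = - (L + 2 * ln L)" by (simp add: L_def)
    moreover have "ln L \<ge> 0" "ln L \<le> L" using L ln_le_minus_one[of L] by auto
    ultimately have "\<bar>ln X\<bar> \<le> 3 * L" by linarith
    hence "(ln X)\<^sup>2 \<le> (3 * L)\<^sup>2" by (metis abs_ge_zero power2_abs power_mono)
    hence "X\<^sup>2 * (ln X)\<^sup>2 \<le> X\<^sup>2 * (3 * L)\<^sup>2" by (rule mult_left_mono) simp
    also have "\<dots> = 9 * (t / L)\<^sup>2" using L by (simp add: X_def power2_eq_square)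
    finally have "f X \<le> 9 * (t / L)\<^sup>2" using d(2)[OF X0] Xt t by simp
    thus "f (profile w / (- ln (cmod w))) \<le> 9 * (profile w)\<^sup>2"
      by (simp add: profile_def X_def power2_eq_square flip: t_def L_def)
  qed
qed

text \<open>The test sequence is \<open>t0\<close> times a unit vector, whose modular
  \<open>f t0\<close> is at most \<open>1\<close> because \<open>t0 * (- ln t0) \<le> 1\<close>. The
  estimate also shows that the dual norm is nonnegative and vanishes only at
  \<open>0\<close>.\<close>

lemma seq_dual_orlicz_coordinate:
  assumes f: "orlicz_function f" "t2log2_near_0 f"
  shows "\<exists>t0>0. \<forall>y\<in>elems (seq_dual (orlicz_space f)). \<forall>k.
    t0 * cmod (y k) \<le> nrm (seq_dual (orlicz_space f)) y"
proof -
  obtain d where d: "d > 0" "\<And>t. 0 < t \<Longrightarrow> t < d \<Longrightarrow> f t = t\<^sup>2 * (ln t)\<^sup>2"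
    using f unfolding t2log2_near_0_def by blast
  have f0: "f 0 = 0" using f(1) by (simp add: orlicz_function_def)
  define t0 where "t0 = min (d/2) (1/2)"
  have t0: "0 < t0" "t0 < d" "t0 < 1" using d by (auto simp: t0_def)
  have "t0 * ln (1 / t0) \<le> t0 * (1 / t0 - 1)"
    using ln_le_minus_one[of "1/t0"] t0 by (intro mult_left_mono) auto
  hence "t0 * (- ln t0) \<le> 1" using t0 by (simp add: ln_div algebra_simps)
  moreover have "0 \<le> t0 * (- ln t0)" using t0 by (intro mult_nonneg_nonneg) auto
  ultimately have "(t0 * (- ln t0))\<^sup>2 \<le> 1\<^sup>2" by (rule power_mono)
  hence ft0: "f t0 \<le> 1" using d(2)[OF t0(1,2)] by (simp add: power_mult_distrib)
  show ?thesis
  proof (intro exI[of _ t0] conjI t0 ballI allI)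
    fix y and k :: nat assume y: "y \<in> elems (seq_dual (orlicz_space f))"
    define x where "x = (\<lambda>n. if n = k then complex_of_real t0 else 0)"
    have "(\<lambda>n. f (cmod (x n) / 1)) = (\<lambda>n. if n \<in> {k} then f t0 else 0)"
      using t0 by (auto simp: x_def f0)
    hence sums: "(\<lambda>n. f (cmod (x n) / 1)) sums f t0"
      using sums_If_finite_set[of "{k}" "\<lambda>n. f t0"] by simp
    have "cmod (\<Sum>n. x n * y n) \<le> nrm (seq_dual (orlicz_space f)) y * 1"
      by (rule seq_dual_orlicz_pairing[OF f(1) y])
        (use sums ft0 in \<open>auto simp: sums_iff\<close>)
    moreover have "(\<Sum>n. x n * y n) = (\<Sum>n\<in>{k}. x n * y n)"
      by (rule suminf_finite) (auto simp: x_def)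
    ultimately show "t0 * cmod (y k) \<le> nrm (seq_dual (orlicz_space f)) y"
      using t0 by (simp add: x_def norm_mult)
  qed
qed

text \<open>Testing the first \<open>N\<close> coordinates of \<open>y\<close> against the profile
  divided by \<open>- ln |y|\<close> yields \<open>S \<le> \<eta> * max 1 (9 * S)\<close> for the
  partial sum \<open>S\<close>. A small \<open>\<eta>\<close> absorbs the right-hand side and leaves
  a bound independent of \<open>N\<close>.\<close>

lemma seq_dual_orlicz_profile:
  assumes f: "orlicz_function f" "t2log2_near_0 f"
  shows "\<exists>\<eta>>0. \<forall>y\<in>elems (seq_dual (orlicz_space f)). nrm (seq_dual (orlicz_space f)) y \<le> \<eta> \<longrightarrow>
    (\<forall>n. cmod (y n) \<le> exp (-1)) \<and> summable (\<lambda>n. (profile (y n))\<^sup>2) \<and> (\<Sum>n. (profile (y n))\<^sup>2) \<le> 1"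
proof -
  obtain \<tau> where \<tau>: "0 < \<tau>" "\<tau> \<le> exp (-1)"
    "\<And>w. w \<noteq> 0 \<Longrightarrow> cmod w \<le> \<tau> \<Longrightarrow> f (profile w / (- ln (cmod w))) \<le> 9 * (profile w)\<^sup>2"
    using orlicz_profile_bound[OF f(2)] by blast
  obtain t0 where t0: "t0 > 0" "\<forall>y\<in>elems (seq_dual (orlicz_space f)). \<forall>k.
      t0 * cmod (y k) \<le> nrm (seq_dual (orlicz_space f)) y"
    using seq_dual_orlicz_coordinate[OF f] by (elim exE conjE)
  have f0: "f 0 = 0" using f(1) by (simp add: orlicz_function_def)
  \<comment> \<open>With \<open>1/18\<close> the alternative \<open>9 * S\<close> contributes only
    \<open>S / 2\<close>; \<open>t0 * \<tau>\<close> keeps every coordinate at most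
    \<open>\<tau>\<close>.\<close>
  define \<eta> where "\<eta> = min (1/18) (t0 * \<tau>)"
  show ?thesis
  proof (intro exI[of _ \<eta>] conjI[of "\<eta> > 0"] ballI impI)
    show "\<eta> > 0" using t0 \<tau> by (simp add: \<eta>_def)
    fix y assume y: "y \<in> elems (seq_dual (orlicz_space f))" "nrm (seq_dual (orlicz_space f)) y \<le> \<eta>"
    have y\<tau>: "cmod (y n) \<le> \<tau>" for n
    proof -
      have "t0 * cmod (y n) \<le> t0 * \<tau>" using bspec[OF t0(2) y(1), THEN spec, of n] y(2) by (simp add: \<eta>_def)
      thus ?thesis using t0(1) by simp
    qed
    have part: "(\<Sum>n<N. (profile (y n))\<^sup>2) \<le> 1" for N
    proof -
      define S where "S = (\<Sum>n<N. (profile (y n))\<^sup>2)"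
      define L where "L = (\<lambda>n. - ln (cmod (y n)))"
      \<comment> \<open>Cutting off at \<open>N\<close> keeps all sums finite while the summability
        of the squared profiles is still open.\<close>
      define x where "x = (\<lambda>n. if n < N then cnj (sgn (y n)) * of_real (profile (y n) / L n) else 0)"
      have L0: "L n \<ge> 1" if "y n \<noteq> 0" for n
        unfolding L_def using y\<tau>[of n] \<tau>(2) that by (intro small_log) auto
      have fx: "f (cmod (x n)) \<le> 9 * (profile (y n))\<^sup>2" if "n < N" for n
      proof (cases "y n = 0")
        case True thus ?thesis by (simp add: x_def f0)
      next
        case False
        have "profile (y n) = cmod (y n) / L n" by (simp only: profile_def L_def)
        hence "profile (y n) / L n \<ge> 0" using L0[OF False] by simp
        hence "cmod (x n) = profile (y n) / L n"
          using False that by (simp add: x_def norm_mult norm_sgn del: of_real_divide abs_divide)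
        thus ?thesis using \<tau>(3)[OF False y\<tau>] by (simp add: L_def)
      qed
      have xN: "x n = 0" if "n \<notin> {..<N}" for n using that by (simp add: x_def)
      have fxN: "f (cmod (x n)) = 0" if "n \<notin> {..<N}" for n using xN[OF that] by (simp add: f0)
      define A where "A = max 1 (9 * S)"
      have sf: "summable (\<lambda>n. f (cmod (x n)))" by (rule summable_finite[of "{..<N}"]) (use fxN in auto)
      have "(\<Sum>n. f (cmod (x n))) = (\<Sum>n<N. f (cmod (x n)))" by (rule suminf_finite) (use fxN in auto)
      also have "\<dots> \<le> 9 * S" unfolding S_def sum_distrib_left by (rule sum_mono) (use fx in simp)
      also have "\<dots> \<le> A" by (simp add: A_def)
      finally have fA: "(\<Sum>n. f (cmod (x n))) \<le> A" .
      have A1: "A \<ge> 1" by (simp add: A_def)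
      have pair: "cmod (\<Sum>n. x n * y n) \<le> nrm (seq_dual (orlicz_space f)) y * A"
        by (rule seq_dual_orlicz_pairing[OF f(1) y(1) _ orlicz_modular_divide[OF f(1) A1 sf fA]])
          (use A1 in simp)
      have "(\<Sum>n. x n * y n) = (\<Sum>n<N. x n * y n)" by (rule suminf_finite) (use xN in auto)
      also have "\<dots> = (\<Sum>n<N. of_real ((profile (y n))\<^sup>2))"
      proof (rule sum.cong)
        fix n assume "n \<in> {..<N}"
        from cnj_sgn_mult_self[of "y n"] have "x n * y n = of_real (cmod (y n) * (profile (y n) / L n))"
          using \<open>n \<in> {..<N}\<close> by (simp add: x_def mult_ac)
        also have "cmod (y n) * (profile (y n) / L n) = (profile (y n))\<^sup>2"
          by (simp add: profile_def L_def power2_eq_square)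
        finally show "x n * y n = of_real ((profile (y n))\<^sup>2)" .
      qed simp
      also have "\<dots> = of_real S" by (simp add: S_def)
      finally have eq: "(\<Sum>n. x n * y n) = of_real S" .
      have "S \<ge> 0" by (simp add: S_def sum_nonneg)
      hence "cmod (\<Sum>n. x n * y n) = S" unfolding eq by simp
      hence "S \<le> nrm (seq_dual (orlicz_space f)) y * A" using pair by simp
      also have "\<dots> \<le> 1/18 * A" using y(2) A1 by (intro mult_right_mono) (auto simp: \<eta>_def)
      \<comment> \<open>If \<open>9 * S > 1\<close>, the inequality says
        \<open>S \<le> S / 2\<close>, which is impossible; otherwise
        \<open>S \<le> 1/18\<close>.\<close>
      finally show ?thesis by (auto simp: A_def S_def max_def split: if_splits)
    qed
    have sm: "summable (\<lambda>n. (profile (y n))\<^sup>2)"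
      by (rule bounded_imp_summable[of _ 1]) (use part[of "Suc _"] in \<open>auto simp: lessThan_Suc_atMost\<close>)
    show "(\<forall>n. cmod (y n) \<le> exp (-1)) \<and> summable (\<lambda>n. (profile (y n))\<^sup>2) \<and> (\<Sum>n. (profile (y n))\<^sup>2) \<le> 1"
      using y\<tau> \<tau>(2) sm suminf_le_const[OF sm part] by (meson order_trans)
  qed
qed

section \<open>Scaling to small dual norm\<close>

lemma calderon_scale:
  assumes F: "F \<in> calderon_C"
  shows "(\<lambda>z n. c * F z n) \<in> calderon_C" "calderon_nrm (\<lambda>z n. c * F z n) \<le> cmod c * calderon_nrm F"
    "Delta ell_infty ell_1 1 (\<lambda>z n. c * F z n) = (\<lambda>n. c * Delta ell_infty ell_1 1 F n)"
proof -
  show cF: "(\<lambda>z n. c * F z n) \<in> calderon_C" "calderon_nrm (\<lambda>z n. c * F z n) \<le> cmod c * calderon_nrm F"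
    by (rule calderon_mult[OF F, of "\<lambda>z. c" "cmod c"]; simp)+
  have "(\<lambda>z. F z n) field_differentiable at (1/2)" for n
    using F calderon_iff half_in_open_strip open_open_strip holomorphic_on_imp_differentiable_at by blast
  thus "Delta ell_infty ell_1 1 (\<lambda>z n. c * F z n) = (\<lambda>n. c * Delta ell_infty ell_1 1 F n)"
    unfolding Delta_1[OF F] Delta_1[OF cF(1)] by (simp add: deriv_cmult)
qed

text \<open>Test sequences may be cut off and rotated against the phases of \<open>y\<close> without
  raising their modular, so the dual norm of \<open>y\<close> bounds absolute sums and
  \<open>in_seq_dual_orlicz\<close> applies.\<close>

lemma seq_dual_orlicz_scale:
  assumes f: "orlicz_function f" and y: "y \<in> elems (seq_dual (orlicz_space f))"
  shows "(\<lambda>n. c * y n) \<in> elems (seq_dual (orlicz_space f))"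
    "nrm (seq_dual (orlicz_space f)) (\<lambda>n. c * y n) \<le> cmod c * nrm (seq_dual (orlicz_space f)) y"
proof -
  have "(\<Sum>n<M. cmod (x n * (c * y n))) \<le> cmod c * nrm (seq_dual (orlicz_space f)) y"
    if s: "summable (\<lambda>n. f (cmod (x n)))" "(\<Sum>n. f (cmod (x n))) \<le> 1" for x M
  proof -
    have f0: "f 0 = 0" using f by (simp add: orlicz_function_def)
    define u where "u = (\<lambda>n. if n < M \<and> y n \<noteq> 0 then of_real (cmod (x n)) * cnj (sgn (y n)) else 0)"
    have fu: "f (cmod (u n)) \<le> f (cmod (x n))" "0 \<le> f (cmod (u n))" for n
      using orlicz_function_nonneg[OF f] by (auto simp: u_def norm_mult norm_sgn f0)
    have su: "summable (\<lambda>n. f (cmod (u n) / 1))"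
      by (rule summable_comparison_test'[OF s(1)]) (use fu in simp)
    have "(\<Sum>n. f (cmod (u n) / 1)) \<le> (\<Sum>n. f (cmod (x n)))"
      using fu(1) su s(1) by (intro suminf_le) auto
    hence "cmod (\<Sum>n. u n * y n) \<le> nrm (seq_dual (orlicz_space f)) y * 1"
      using s(2) by (intro seq_dual_orlicz_pairing[OF f y _ su]) auto
    moreover have "(\<Sum>n. u n * y n) = (\<Sum>n<M. u n * y n)"
      by (rule suminf_finite) (auto simp: u_def)
    moreover have "u n * y n = of_real (cmod (x n * y n))" if "n < M" for n
    proof -
      show ?thesis using that by (simp add: u_def norm_mult mult.assoc cnj_sgn_mult_self)
    qed
    ultimately have "cmod (\<Sum>n<M. of_real (cmod (x n * y n)) :: complex) \<le> nrm (seq_dual (orlicz_space f)) y"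
      by simp
    hence "(\<Sum>n<M. cmod (x n * y n)) \<le> nrm (seq_dual (orlicz_space f)) y"
      by (simp add: sum_nonneg flip: of_real_sum)
    from mult_left_mono[OF this norm_ge_zero[of c]] show ?thesis
      by (simp add: sum_distrib_left norm_mult mult_ac)
  qed
  from in_seq_dual_orlicz[OF f this]
  show "(\<lambda>n. c * y n) \<in> elems (seq_dual (orlicz_space f))"
    "nrm (seq_dual (orlicz_space f)) (\<lambda>n. c * y n) \<le> cmod c * nrm (seq_dual (orlicz_space f)) y" by auto
qed

text \<open>Scaling to dual norm at most \<open>\<eta>\<close> reduces the claim to
  \<open>Delta_1_surjective\<close>, whose bound \<open>4\<close> becomes
  \<open>4 / \<eta>\<close>.\<close>

lemma seq_dual_in_Delta_1:
  assumes f: "orlicz_function f" "t2log2_near_0 f"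
  obtains C where "C > 0" "\<And>y. y \<in> elems (seq_dual (orlicz_space f)) \<Longrightarrow>
    \<exists>F\<in>calderon_C. Delta ell_infty ell_1 1 F = y \<and>
      calderon_nrm F \<le> C * nrm (seq_dual (orlicz_space f)) y"
proof -
  obtain \<eta> where \<eta>: "\<eta> > 0" "\<forall>y\<in>elems (seq_dual (orlicz_space f)). nrm (seq_dual (orlicz_space f)) y \<le> \<eta> \<longrightarrow>
    (\<forall>n. cmod (y n) \<le> exp (-1)) \<and> summable (\<lambda>n. (profile (y n))\<^sup>2) \<and> (\<Sum>n. (profile (y n))\<^sup>2) \<le> 1"
    using seq_dual_orlicz_profile[OF f] by (elim exE conjE)
  obtain t0 where t0: "t0 > 0" "\<forall>y\<in>elems (seq_dual (orlicz_space f)). \<forall>k.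
      t0 * cmod (y k) \<le> nrm (seq_dual (orlicz_space f)) y"
    using seq_dual_orlicz_coordinate[OF f] by (elim exE conjE)
  show ?thesis
  proof (rule that[of "4 / \<eta>"])
    fix y assume y: "y \<in> elems (seq_dual (orlicz_space f))"
    define N where "N = nrm (seq_dual (orlicz_space f)) y"
    have small: "\<exists>F\<in>calderon_C. Delta ell_infty ell_1 1 F = u \<and> calderon_nrm F \<le> 4"
      if "u \<in> elems (seq_dual (orlicz_space f))" "nrm (seq_dual (orlicz_space f)) u \<le> \<eta>" for u
      using bspec[OF \<eta>(2) that(1)] that(2) by (intro Delta_1_surjective) auto
    have N0: "N \<ge> 0" 
      using mult_nonneg_nonneg[OF less_imp_le[OF t0(1)] norm_ge_zero[of "y 0"]] bspec[OF t0(2) y, THEN spec, of 0]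
      unfolding N_def by (rule order_trans)
    show "\<exists>F\<in>calderon_C. Delta ell_infty ell_1 1 F = y \<and> calderon_nrm F \<le> 4 / \<eta> * N"
    proof (cases "N = 0")
      \<comment> \<open>A sequence of dual norm \<open>0\<close> cannot be rescaled to norm
        \<open>\<eta>\<close>, but it is \<open>0\<close> in every coordinate, and the zero multiple
        of any \<open>F\<close> represents it.\<close>
      case True
      have "t0 * cmod (y k) \<le> 0" for k using bspec[OF t0(2) y] True by (simp add: N_def)
      hence y0: "y = (\<lambda>n. 0)" using t0(1) by (auto simp: mult_le_0_iff fun_eq_iff)
      obtain F where F: "F \<in> calderon_C" using small[OF y] True \<eta>(1) by (auto simp: N_def)
      show ?thesis
        by (rule bexI[of _ "\<lambda>z n. 0 * F z n"]) (use calderon_scale[OF F, of 0] y0 True in simp_all)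
    next
      case False
      hence N: "N > 0" using N0 by simp
      define c where "c = complex_of_real (\<eta> / N)"
      have cc: "cmod c = \<eta> / N" "c \<noteq> 0" using N \<eta>(1) by (simp_all add: c_def norm_divide)
      have "nrm (seq_dual (orlicz_space f)) (\<lambda>n. c * y n) \<le> \<eta>"
        using seq_dual_orlicz_scale(2)[OF f(1) y, of c] N by (simp add: cc flip: N_def)
      then obtain F where F: "F \<in> calderon_C" "Delta ell_infty ell_1 1 F = (\<lambda>n. c * y n)" "calderon_nrm F \<le> 4"
        using small[OF seq_dual_orlicz_scale(1)[OF f(1) y]] by blast
      have "cmod (inverse c) * calderon_nrm F \<le> (N / \<eta>) * 4"
        using F(3) N \<eta>(1) by (intro mult_mono) (auto simp: norm_inverse cc calderon_nrm_nonneg[OF F(1)])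
      hence "calderon_nrm (\<lambda>z n. inverse c * F z n) \<le> 4 / \<eta> * N"
        using calderon_scale(2)[OF F(1), of "inverse c"] by (simp add: mult.commute)
      moreover have "Delta ell_infty ell_1 1 (\<lambda>z n. inverse c * F z n) = y"
        unfolding calderon_scale(3)[OF F(1)] F(2) using cc(2) by (intro ext) (simp flip: mult.assoc)
      ultimately show ?thesis using calderon_scale(1)[OF F(1)] by blast
    qed
  qed (use \<eta>(1) in simp)
qed

lemma same_space_Delta_1_seq_dual:
  assumes f: "orlicz_function f" "t2log2_near_0 f"
  shows "same_space (Delta_image ell_infty ell_1 1 calderon_C) (seq_dual (orlicz_space f))"
proof -
  let ?X = "Delta_image ell_infty ell_1 1 calderon_C" and ?Y = "seq_dual (orlicz_space f)"
  obtain C where C: "C > 0" "\<And>F. F \<in> calderon_C \<Longrightarrow>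
    Delta ell_infty ell_1 1 F \<in> elems ?Y \<and> nrm ?Y (Delta ell_infty ell_1 1 F) \<le> C * calderon_nrm F"
    using Delta_1_in_seq_dual[OF f] by blast
  obtain c where c: "c > 0" "\<And>y. y \<in> elems ?Y \<Longrightarrow>
    \<exists>F\<in>calderon_C. Delta ell_infty ell_1 1 F = y \<and> calderon_nrm F \<le> c * nrm ?Y y"
    using seq_dual_in_Delta_1[OF f] by blast
  have nrmX: "nrm ?X x = Inf {calderon_nrm F | F. F \<in> calderon_C \<and> Delta ell_infty ell_1 1 F = x}" for x
    by (simp add: Delta_image_def)
  show ?thesis
  proof (rule same_spaceI[OF c(1) C(1)])
    fix x assume "x \<in> elems ?X"
    then obtain F0 where F0: "F0 \<in> calderon_C" "Delta ell_infty ell_1 1 F0 = x"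
      by (auto simp: Delta_image_def)
    have "nrm ?Y x / C \<le> nrm ?X x"
      unfolding nrmX
    proof (rule cInf_greatest)
      fix a assume "a \<in> {calderon_nrm F | F. F \<in> calderon_C \<and> Delta ell_infty ell_1 1 F = x}"
      then obtain F where "F \<in> calderon_C" "Delta ell_infty ell_1 1 F = x" "a = calderon_nrm F" by blast
      thus "nrm ?Y x / C \<le> a" using C by (auto simp: field_simps)
    qed (use F0 in blast)
    thus "x \<in> elems ?Y \<and> nrm ?Y x \<le> C * nrm ?X x" using C F0 by (auto simp: field_simps)
  next
    fix x assume "x \<in> elems ?Y"
    then obtain F where F: "F \<in> calderon_C" "Delta ell_infty ell_1 1 F = x" "calderon_nrm F \<le> c * nrm ?Y x"
      using c(2) by blast
    have "nrm ?X x \<le> calderon_nrm F"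
      unfolding nrmX
      by (rule cInf_lower) (use F calderon_nrm_nonneg in \<open>auto intro!: bdd_belowI[of _ 0]\<close>)
    thus "x \<in> elems ?X \<and> nrm ?X x \<le> c * nrm ?Y x" using F by (auto simp: Delta_image_def)
  qed
qed

theorem proposition5p4:
  fixes f :: "real \<Rightarrow> real"
  assumes "orlicz_function f" and "t2log2_near_0 f"
  shows "same_space (Delta_image ell_infty ell_1 2 (ker_Delta ell_infty ell_1 0))
                    (Delta_image ell_infty ell_1 1 (calderon ell_infty ell_1)) \<and>
         same_space (Delta_image ell_infty ell_1 1 (calderon ell_infty ell_1))
                    (seq_dual (orlicz_space f))"
  by (rule conjI[OF same_space_Delta_2_Delta_1 same_space_Delta_1_seq_dual[OF assms]])

end
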